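(* Let $K$ be an algebraically closed field, $G$ a finite group, $g\ge0$, $U\le G$ a subgroup with conjugacy class $O=\{aUa^{-1}\mid a\in G\}$, and let $C$ and $N$ be the centralizer and the normalizer of $U$ in $G$, and $Z=N/C$. Then the isomorphism $K[G/C]\otimes_{K[Z]}M^g_U\cong M^g(O)$ that sends $aC\otimes f$ (for $a\in G$, $f\in\Omega^g_U$) to the homomorphism $[\gamma]\mapsto af([\gamma])a^{-1}$ descends to cohomology: for all $m\ge0$, it induces an isomorphism $$H^m(G,M^g(O))\cong H^m(G,K[G/C])\otimes_{K[Z]}M^g_U.$$
   Context: $\Sigma_g$ is the closed oriented surface of genus $g$ with base point $x$ and $\Omega^g=\mathrm{Hom}(\pi_1(\Sigma_g,x),G)$. $K[X]$ denotes the vector space with basis $X$. For $V\le G$, $\Omega^g_V=\{f\in\Omega^g\mid\mathrm{im}(f)=V\}$ and $M^g_V=K[\Omega^g_V]$; further $M^g(O)=\bigoplus_{V\in O}M^g_V$. $G$ acts on $M^g(O)$ by linear extension of $(a.f)([\gamma])=af([\gamma])a^{-1}$. $Z=N/C$ acts on $\Omega^g_U$ from the left by $((bC).f)([\gamma])=bf([\gamma])b^{-1}$ ($b\in N$) and on the coset space $G/C$ from the right by $(aC).(bC)=abC$; by linear extension, $M^g_U$ is a left $K[Z]$-module and $K[G/C]$ is a right $K[Z]$-module. $K[G/C]$ is also a left $K[G]$-module by left translation; this action commutes with $Z$, so $H^m(G,K[G/C])$ is a right $K[Z]$-module. $H^m(G,-)=\mathrm{Ext}^m_{K[G]}(K,-)$.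 *)

theory Defs
  imports
    "HOL-Analysis.Homotopy"
    "HOL-Algebra.Algebraic_Closure"
    "HOL-Algebra.Group_Action"
    "HOL-Algebra.Left_Coset"
    "HOL-Algebra.AbelCoset"
begin

section \<open>Closed oriented surfaces and fundamental groups\<close>

text \<open>
  Boundary identifications of the standard polygon, realised as the closed unit disc.  For
  \<open>g > 0\<close> the unit circle is divided into \<open>4 g\<close> edges, edge \<open>j\<close> consisting of the points
  \<open>boundary_point g s\<close> with \<open>j \<le> s \<le> j + 1\<close>, which are labelled by the word
  \<open>a\<^sub>1 b\<^sub>1 a\<^sub>1\<inverse> b\<^sub>1\<inverse> \<dots> a\<^sub>g b\<^sub>g a\<^sub>g\<inverse> b\<^sub>g\<inverse>\<close>.  For \<open>g = 0\<close> the word is \<open>a a\<inverse>\<close>, which gives the sphere.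
\<close>

definition boundary_point :: "nat \<Rightarrow> real \<Rightarrow> complex"
  where "boundary_point g s = cis (2 * pi * s / (4 * real g))"

definition edge_identifications :: "nat \<Rightarrow> (complex \<times> complex) set"
  where "edge_identifications g =
    (if g = 0 then {(z, cnj z) | z. cmod z = 1}
     else {(boundary_point g (4 * real k + t), boundary_point g (4 * real k + 3 - t)) | k t.
              k < g \<and> 0 \<le> t \<and> t \<le> 1}
        \<union> {(boundary_point g (4 * real k + 1 + t), boundary_point g (4 * real k + 4 - t)) | k t.
              k < g \<and> 0 \<le> t \<and> t \<le> 1})"

text \<open>
  \<open>S\<close> is (homeomorphic to) the quotient of the polygon by the equivalence relation generated by
  these identifications.  The choice of one of the two orientations does not affect the
  fundamental group, so it is not recorded.
\<close>

definition closed_oriented_surface :: "nat \<Rightarrow> 's topology \<Rightarrow> bool"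
  where "closed_oriented_surface g S \<longleftrightarrow>
    (\<exists>q. quotient_map (top_of_set (cball 0 1)) S q \<and>
         (\<forall>z \<in> cball 0 1. \<forall>w \<in> cball 0 1.
            q z = q w \<longleftrightarrow> (z, w) \<in> rtrancl (edge_identifications g \<union> converse (edge_identifications g))))"

definition based_loops :: "'s topology \<Rightarrow> 's \<Rightarrow> (real \<Rightarrow> 's) set"
  where "based_loops S x = {p. pathin S p \<and> p 0 = x \<and> p 1 = x}"

definition loop_class :: "'s topology \<Rightarrow> 's \<Rightarrow> (real \<Rightarrow> 's) \<Rightarrow> (real \<Rightarrow> 's) set"
  where "loop_class S x p = {q \<in> based_loops S x.
    homotopic_with (\<lambda>r. r 0 = x \<and> r 1 = x) (top_of_set {0..1}) S p q}"

text \<open>The library's \<open>joinpaths\<close> requires the points to form a type of class \<open>topological_space\<close>.\<close>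

definition join_loops :: "(real \<Rightarrow> 's) \<Rightarrow> (real \<Rightarrow> 's) \<Rightarrow> real \<Rightarrow> 's"
  where "join_loops p q = (\<lambda>t. if t \<le> 1/2 then p (2 * t) else q (2 * t - 1))"

definition fundamental_group :: "'s topology \<Rightarrow> 's \<Rightarrow> (real \<Rightarrow> 's) set monoid"
  where "fundamental_group S x =
    \<lparr>carrier = loop_class S x ` based_loops S x,
     monoid.mult = (\<lambda>A B. \<Union>p\<in>A. \<Union>q\<in>B. loop_class S x (join_loops p q)),
     one = loop_class S x (\<lambda>_. x)\<rparr>"


section \<open>Modules over a group algebra\<close>

text \<open>
  A \<open>K[G]\<close>-module is a \<open>K\<close>-module with a \<open>K\<close>-linear action of \<open>G\<close>.  The fields \<open>mult\<close> and \<open>one\<close>,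
  which \<open>module\<close> inherits from \<open>ring\<close>, are irrelevant throughout.
\<close>

record ('k, 'v, 'g) gmodule = "('k, 'v) module" +
  gact :: "'g \<Rightarrow> 'v \<Rightarrow> 'v"

definition group_module ::
    "('k, 'a) ring_scheme \<Rightarrow> ('g, 'b) monoid_scheme \<Rightarrow> ('k, 'v, 'g, 'c) gmodule_scheme \<Rightarrow> bool"
  where "group_module K G M \<longleftrightarrow>
    Module.module K M \<and> group G \<and>
    (\<forall>a \<in> carrier G. \<forall>x \<in> carrier M. gact M a x \<in> carrier M) \<and>
    (\<forall>a \<in> carrier G. \<forall>x \<in> carrier M. \<forall>y \<in> carrier M.
       gact M a (x \<oplus>\<^bsub>M\<^esub> y) = gact M a x \<oplus>\<^bsub>M\<^esub> gact M a y) \<and>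
    (\<forall>a \<in> carrier G. \<forall>c \<in> carrier K. \<forall>x \<in> carrier M.
       gact M a (c \<odot>\<^bsub>M\<^esub> x) = c \<odot>\<^bsub>M\<^esub> gact M a x) \<and>
    (\<forall>x \<in> carrier M. gact M \<one>\<^bsub>G\<^esub> x = x) \<and>
    (\<forall>a \<in> carrier G. \<forall>b \<in> carrier G. \<forall>x \<in> carrier M.
       gact M (a \<otimes>\<^bsub>G\<^esub> b) x = gact M a (gact M b x))"

definition linear_maps ::
    "('k, 'a) ring_scheme \<Rightarrow> ('k, 'v, 'c) module_scheme \<Rightarrow> ('k, 'w, 'd) module_scheme \<Rightarrow> ('v \<Rightarrow> 'w) set"
  where "linear_maps K M N = {f \<in> carrier M \<rightarrow> carrier N.
    (\<forall>x \<in> carrier M. \<forall>y \<in> carrier M. f (x \<oplus>\<^bsub>M\<^esub> y) = f x \<oplus>\<^bsub>N\<^esub> f y) \<and>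
    (\<forall>c \<in> carrier K. \<forall>x \<in> carrier M. f (c \<odot>\<^bsub>M\<^esub> x) = c \<odot>\<^bsub>N\<^esub> f x)}"

definition linear_isos ::
    "('k, 'a) ring_scheme \<Rightarrow> ('k, 'v, 'c) module_scheme \<Rightarrow> ('k, 'w, 'd) module_scheme \<Rightarrow> ('v \<Rightarrow> 'w) set"
  where "linear_isos K M N = {f \<in> linear_maps K M N. bij_betw f (carrier M) (carrier N)}"

definition gmodule_homs ::
    "('k, 'a) ring_scheme \<Rightarrow> ('g, 'b) monoid_scheme \<Rightarrow> ('k, 'v, 'g, 'c) gmodule_scheme \<Rightarrow>
     ('k, 'w, 'g, 'd) gmodule_scheme \<Rightarrow> ('v \<Rightarrow> 'w) set"
  where "gmodule_homs K G M N = {f \<in> linear_maps K M N.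
    \<forall>a \<in> carrier G. \<forall>x \<in> carrier M. f (gact M a x) = gact N a (f x)}"

definition gmodule_isos ::
    "('k, 'a) ring_scheme \<Rightarrow> ('g, 'b) monoid_scheme \<Rightarrow> ('k, 'v, 'g, 'c) gmodule_scheme \<Rightarrow>
     ('k, 'w, 'g, 'd) gmodule_scheme \<Rightarrow> ('v \<Rightarrow> 'w) set"
  where "gmodule_isos K G M N = {f \<in> gmodule_homs K G M N. bij_betw f (carrier M) (carrier N)}"

definition trivial_gmodule :: "('k, 'a) ring_scheme \<Rightarrow> ('k, 'k, 'g) gmodule"
  where "trivial_gmodule K =
    \<lparr>carrier = carrier K, monoid.mult = monoid.mult K, one = \<one>\<^bsub>K\<^esub>, zero = \<zero>\<^bsub>K\<^esub>, add = add K,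
     smult = monoid.mult K, gact = (\<lambda>_ c. c)\<rparr>"

definition quotient_module :: "('k, 'v, 'c) module_scheme \<Rightarrow> 'v set \<Rightarrow> ('k, 'v set) module"
  where "quotient_module M N =
    \<lparr>carrier = a_rcosets\<^bsub>M\<^esub> N, monoid.mult = undefined, one = undefined, zero = N, add = set_add M,
     smult = (\<lambda>c Q. \<Union>x\<in>Q. N +>\<^bsub>M\<^esub> (c \<odot>\<^bsub>M\<^esub> x))\<rparr>"

definition submodule_hull ::
    "('k, 'a) ring_scheme \<Rightarrow> ('k, 'v, 'c) module_scheme \<Rightarrow> 'v set \<Rightarrow> 'v set"
  where "submodule_hull K M S = \<Inter>{N. submodule N K M \<and> S \<subseteq> N}"


subsection \<open>The vector space with a given basis\<close>

text \<open>\<open>K[S]\<close>: the finitely supported functions \<open>S \<rightarrow> K\<close>, extended by zero outside \<open>S\<close>.\<close>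

definition free_module :: "('k, 'a) ring_scheme \<Rightarrow> 's set \<Rightarrow> ('k, 's \<Rightarrow> 'k) module"
  where "free_module K S =
    \<lparr>carrier = {w. (\<forall>s. w s \<in> carrier K) \<and> finite {s. w s \<noteq> \<zero>\<^bsub>K\<^esub>} \<and> {s. w s \<noteq> \<zero>\<^bsub>K\<^esub>} \<subseteq> S},
     monoid.mult = undefined, one = undefined,
     zero = (\<lambda>_. \<zero>\<^bsub>K\<^esub>), add = (\<lambda>v w s. v s \<oplus>\<^bsub>K\<^esub> w s), smult = (\<lambda>c w s. c \<otimes>\<^bsub>K\<^esub> w s)\<rparr>"

definition basis_vec :: "('k, 'a) ring_scheme \<Rightarrow> 's \<Rightarrow> 's \<Rightarrow> 'k"
  where "basis_vec K s = (\<lambda>t. if t = s then \<one>\<^bsub>K\<^esub> else \<zero>\<^bsub>K\<^esub>)"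

definition linear_extension ::
    "('k, 'a) ring_scheme \<Rightarrow> ('k, 'v, 'c) module_scheme \<Rightarrow> ('s \<Rightarrow> 'v) \<Rightarrow> ('s \<Rightarrow> 'k) \<Rightarrow> 'v"
  where "linear_extension K M \<phi> w = (\<Oplus>\<^bsub>M\<^esub> s \<in> {s. w s \<noteq> \<zero>\<^bsub>K\<^esub>}. w s \<odot>\<^bsub>M\<^esub> \<phi> s)"

definition permutation_module ::
    "('k, 'a) ring_scheme \<Rightarrow> 's set \<Rightarrow> ('g \<Rightarrow> 's \<Rightarrow> 's) \<Rightarrow> ('k, 's \<Rightarrow> 'k, 'g) gmodule"
  where "permutation_module K S \<alpha> = module.extend (free_module K S)
    (gmodule.fields (\<lambda>a. linear_extension K (free_module K S) (\<lambda>s. basis_vec K (\<alpha> a s))))"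


section \<open>Ext groups\<close>

text \<open>The free \<open>K[G]\<close>-module with basis \<open>B\<close>.\<close>

definition free_gmodule ::
    "('k, 'a) ring_scheme \<Rightarrow> ('g, 'b) monoid_scheme \<Rightarrow> 's set \<Rightarrow> ('k, 'g \<times> 's \<Rightarrow> 'k, 'g) gmodule"
  where "free_gmodule K G B = permutation_module K (carrier G \<times> B) (\<lambda>a (b, s). (a \<otimes>\<^bsub>G\<^esub> b, s))"

text \<open>
  Projective means direct summand of a free module.  Bases in the type of elements of \<open>P\<close> suffice:
  if \<open>P\<close> is a summand of any free module, it is one of the free module with basis \<open>carrier P\<close>.
\<close>

definition projective_gmodule ::
    "('k, 'a) ring_scheme \<Rightarrow> ('g, 'b) monoid_scheme \<Rightarrow> ('k, 'p, 'g) gmodule \<Rightarrow> bool"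
  where "projective_gmodule K G P \<longleftrightarrow> group_module K G P \<and>
    (\<exists>(B :: 'p set) i r. i \<in> gmodule_homs K G P (free_gmodule K G B) \<and>
       r \<in> gmodule_homs K G (free_gmodule K G B) P \<and> (\<forall>x \<in> carrier P. r (i x) = x))"

text \<open>\<open>\<dots> \<rightarrow> P 2 \<rightarrow> P 1 \<rightarrow> P 0 \<rightarrow> K \<rightarrow> 0\<close> is exact, where \<open>d n\<close> maps \<open>P (n + 1)\<close> to \<open>P n\<close>.\<close>

definition projective_resolution ::
    "('k, 'a) ring_scheme \<Rightarrow> ('g, 'b) monoid_scheme \<Rightarrow>
     (nat \<Rightarrow> ('k, 'p, 'g) gmodule) \<Rightarrow> (nat \<Rightarrow> 'p \<Rightarrow> 'p) \<Rightarrow> ('p \<Rightarrow> 'k) \<Rightarrow> bool"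
  where "projective_resolution K G P d e \<longleftrightarrow>
    (\<forall>n. projective_gmodule K G (P n)) \<and>
    (\<forall>n. d n \<in> gmodule_homs K G (P (Suc n)) (P n)) \<and>
    e \<in> gmodule_homs K G (P 0) (trivial_gmodule K) \<and>
    e ` carrier (P 0) = carrier K \<and>
    {x \<in> carrier (P 0). e x = \<zero>\<^bsub>K\<^esub>} = d 0 ` carrier (P 1) \<and>
    (\<forall>n. {x \<in> carrier (P (Suc n)). d n x = \<zero>\<^bsub>P n\<^esub>} = d (Suc n) ` carrier (P (Suc (Suc n))))"

text \<open>\<open>Hom\<^bsub>K[G]\<^esub>(M, N)\<close>; extensionality makes its elements maps on \<open>carrier M\<close> only.\<close>

definition hom_module ::
    "('k, 'a) ring_scheme \<Rightarrow> ('g, 'b) monoid_scheme \<Rightarrow> ('k, 'v, 'g) gmodule \<Rightarrow> ('k, 'w, 'g) gmodule \<Rightarrow>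
     ('k, 'v \<Rightarrow> 'w) module"
  where "hom_module K G M N =
    \<lparr>carrier = gmodule_homs K G M N \<inter> extensional (carrier M), monoid.mult = undefined, one = undefined,
     zero = (\<lambda>x \<in> carrier M. \<zero>\<^bsub>N\<^esub>), add = (\<lambda>f h. \<lambda>x \<in> carrier M. f x \<oplus>\<^bsub>N\<^esub> h x),
     smult = (\<lambda>c f. \<lambda>x \<in> carrier M. c \<odot>\<^bsub>N\<^esub> f x)\<rparr>"

definition cocycles ::
    "('k, 'a) ring_scheme \<Rightarrow> ('g, 'b) monoid_scheme \<Rightarrow>
     (nat \<Rightarrow> ('k, 'p, 'g) gmodule) \<Rightarrow> (nat \<Rightarrow> 'p \<Rightarrow> 'p) \<Rightarrow> nat \<Rightarrow> ('k, 'v, 'g) gmodule \<Rightarrow> ('p \<Rightarrow> 'v) set"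
  where "cocycles K G P d m M =
    {c \<in> carrier (hom_module K G (P m) M).
       compose (carrier (P (Suc m))) c (d m) = \<zero>\<^bsub>hom_module K G (P (Suc m)) M\<^esub>}"

primrec coboundaries ::
    "('k, 'a) ring_scheme \<Rightarrow> ('g, 'b) monoid_scheme \<Rightarrow>
     (nat \<Rightarrow> ('k, 'p, 'g) gmodule) \<Rightarrow> (nat \<Rightarrow> 'p \<Rightarrow> 'p) \<Rightarrow> nat \<Rightarrow> ('k, 'v, 'g) gmodule \<Rightarrow> ('p \<Rightarrow> 'v) set"
  where
    "coboundaries K G P d 0 M = {\<zero>\<^bsub>hom_module K G (P 0) M\<^esub>}"
  | "coboundaries K G P d (Suc m) M =
       (\<lambda>c. compose (carrier (P (Suc m))) c (d m)) ` carrier (hom_module K G (P m) M)"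

text \<open>
  \<open>H\<^sup>m(Hom\<^bsub>K[G]\<^esub>(P\<^sub>\<bullet>, M))\<close>, which is \<open>H\<^sup>m(G, M) = Ext\<^sup>m\<^bsub>K[G]\<^esub>(K, M)\<close> when \<open>P\<^sub>\<bullet>\<close> is a projective
  resolution of the trivial module \<open>K\<close>.
\<close>

definition Ext_module ::
    "('k, 'a) ring_scheme \<Rightarrow> ('g, 'b) monoid_scheme \<Rightarrow>
     (nat \<Rightarrow> ('k, 'p, 'g) gmodule) \<Rightarrow> (nat \<Rightarrow> 'p \<Rightarrow> 'p) \<Rightarrow> nat \<Rightarrow> ('k, 'v, 'g) gmodule \<Rightarrow>
     ('k, ('p \<Rightarrow> 'v) set) module"
  where "Ext_module K G P d m M =
    quotient_module (hom_module K G (P m) M \<lparr>carrier := cocycles K G P d m M\<rparr>)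
      (coboundaries K G P d m M)"

text \<open>
  The map on \<open>Ext\<close> induced by a \<open>K[G]\<close>-homomorphism \<open>\<phi>\<close> into \<open>N\<close>.  It sends the class of \<open>c\<close> to
  the class of \<open>\<phi> \<circ> c\<close>; the cosets in the union coincide.
\<close>

definition Ext_map ::
    "('k, 'a) ring_scheme \<Rightarrow> ('g, 'b) monoid_scheme \<Rightarrow>
     (nat \<Rightarrow> ('k, 'p, 'g) gmodule) \<Rightarrow> (nat \<Rightarrow> 'p \<Rightarrow> 'p) \<Rightarrow> nat \<Rightarrow> ('k, 'w, 'g) gmodule \<Rightarrow>
     ('v \<Rightarrow> 'w) \<Rightarrow> ('p \<Rightarrow> 'v) set \<Rightarrow> ('p \<Rightarrow> 'w) set"
  where "Ext_map K G P d m N \<phi> Q =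
    (\<Union>c\<in>Q. coboundaries K G P d m N +>\<^bsub>hom_module K G (P m) N\<^esub> compose (carrier (P m)) \<phi> c)"


section \<open>Tensor products over a group algebra\<close>

text \<open>
  \<open>A \<otimes>\<^bsub>K[Z]\<^esub> B\<close> for a \<open>K\<close>-module \<open>A\<close> with a right action \<open>r\<close> of \<open>Z\<close> (written \<open>r z x\<close> for \<open>x . z\<close>)
  and a left \<open>K[Z]\<close>-module \<open>B\<close>: the quotient of \<open>K[A \<times> B]\<close> by the relations of \<open>K\<close>-bilinearity and
  \<open>x . z \<otimes> y = x \<otimes> z . y\<close>.  As \<open>Z\<close> spans \<open>K[Z]\<close>, these generate all the relations of \<open>K[Z]\<close>-balancedness.
\<close>

definition tensor_relations ::
    "('k, 'a) ring_scheme \<Rightarrow> ('z, 'b) monoid_scheme \<Rightarrow>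
     ('k, 'v, 'c) module_scheme \<Rightarrow> ('z \<Rightarrow> 'v \<Rightarrow> 'v) \<Rightarrow> ('k, 'w, 'z) gmodule \<Rightarrow> ('v \<times> 'w \<Rightarrow> 'k) set"
  where "tensor_relations K Z A r B =
    (let F = free_module K (carrier A \<times> carrier B); t = (\<lambda>x y. basis_vec K (x, y)) in
      submodule_hull K F
       ({t (x \<oplus>\<^bsub>A\<^esub> x') y \<ominus>\<^bsub>F\<^esub> (t x y \<oplus>\<^bsub>F\<^esub> t x' y) | x x' y.
            x \<in> carrier A \<and> x' \<in> carrier A \<and> y \<in> carrier B}
      \<union> {t x (y \<oplus>\<^bsub>B\<^esub> y') \<ominus>\<^bsub>F\<^esub> (t x y \<oplus>\<^bsub>F\<^esub> t x y') | x y y'.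
            x \<in> carrier A \<and> y \<in> carrier B \<and> y' \<in> carrier B}
      \<union> {t (c \<odot>\<^bsub>A\<^esub> x) y \<ominus>\<^bsub>F\<^esub> (c \<odot>\<^bsub>F\<^esub> t x y) | c x y.
            c \<in> carrier K \<and> x \<in> carrier A \<and> y \<in> carrier B}
      \<union> {t x (c \<odot>\<^bsub>B\<^esub> y) \<ominus>\<^bsub>F\<^esub> (c \<odot>\<^bsub>F\<^esub> t x y) | c x y.
            c \<in> carrier K \<and> x \<in> carrier A \<and> y \<in> carrier B}
      \<union> {t (r z x) y \<ominus>\<^bsub>F\<^esub> t x (gact B z y) | z x y.
            z \<in> carrier Z \<and> x \<in> carrier A \<and> y \<in> carrier B}))"

definition tensor_product ::
    "('k, 'a) ring_scheme \<Rightarrow> ('z, 'b) monoid_scheme \<Rightarrow>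
     ('k, 'v, 'c) module_scheme \<Rightarrow> ('z \<Rightarrow> 'v \<Rightarrow> 'v) \<Rightarrow> ('k, 'w, 'z) gmodule \<Rightarrow>
     ('k, ('v \<times> 'w \<Rightarrow> 'k) set) module"
  where "tensor_product K Z A r B =
    quotient_module (free_module K (carrier A \<times> carrier B)) (tensor_relations K Z A r B)"

definition pure_tensor ::
    "('k, 'a) ring_scheme \<Rightarrow> ('z, 'b) monoid_scheme \<Rightarrow>
     ('k, 'v, 'c) module_scheme \<Rightarrow> ('z \<Rightarrow> 'v \<Rightarrow> 'v) \<Rightarrow> ('k, 'w, 'z) gmodule \<Rightarrow>
     'v \<Rightarrow> 'w \<Rightarrow> ('v \<times> 'w \<Rightarrow> 'k) set"
  where "pure_tensor K Z A r B x y =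
    tensor_relations K Z A r B +>\<^bsub>free_module K (carrier A \<times> carrier B)\<^esub> basis_vec K (x, y)"

text \<open>
  If \<open>A\<close> also carries a left action of a group \<open>G\<close> commuting with \<open>r\<close>, then so does the tensor
  product, by \<open>a . (x \<otimes> y) = a . x \<otimes> y\<close>.
\<close>

definition tensor_gmodule ::
    "('k, 'a) ring_scheme \<Rightarrow> ('z, 'b) monoid_scheme \<Rightarrow>
     ('k, 'v, 'g) gmodule \<Rightarrow> ('z \<Rightarrow> 'v \<Rightarrow> 'v) \<Rightarrow> ('k, 'w, 'z) gmodule \<Rightarrow>
     ('k, ('v \<times> 'w \<Rightarrow> 'k) set, 'g) gmodule"
  where "tensor_gmodule K Z A r B = module.extend (tensor_product K Z A r B)
    (gmodule.fields (\<lambda>a Q. \<Union>w\<in>Q.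
       tensor_relations K Z A r B +>\<^bsub>free_module K (carrier A \<times> carrier B)\<^esub>
       linear_extension K (free_module K (carrier A \<times> carrier B))
         (\<lambda>(x, y). basis_vec K (gact A a x, y)) w))"


section \<open>Representations of a group in a finite group\<close>

definition centralizer :: "('g, 'b) monoid_scheme \<Rightarrow> 'g set \<Rightarrow> 'g set"
  where "centralizer G U = {a \<in> carrier G. \<forall>u \<in> U. a \<otimes>\<^bsub>G\<^esub> u = u \<otimes>\<^bsub>G\<^esub> a}"

definition conjugacy_class :: "('g, 'b) monoid_scheme \<Rightarrow> 'g set \<Rightarrow> 'g set set"
  where "conjugacy_class G U = {a <#\<^bsub>G\<^esub> U #>\<^bsub>G\<^esub> inv\<^bsub>G\<^esub> a | a. a \<in> carrier G}"

text \<open>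
  The homomorphisms from \<open>\<Gamma>\<close> to \<open>G\<close> with image \<open>V\<close>.  The library's \<open>hom\<close> leaves the values outside
  \<open>carrier \<Gamma>\<close> unconstrained; \<open>extensional\<close> fixes them.
\<close>

definition homs_onto :: "('s, 'a) monoid_scheme \<Rightarrow> ('g, 'b) monoid_scheme \<Rightarrow> 'g set \<Rightarrow> ('s \<Rightarrow> 'g) set"
  where "homs_onto \<Gamma> G V = {f \<in> hom \<Gamma> G \<inter> extensional (carrier \<Gamma>). f ` carrier \<Gamma> = V}"

definition conj_hom ::
    "('s, 'a) monoid_scheme \<Rightarrow> ('g, 'b) monoid_scheme \<Rightarrow> 'g \<Rightarrow> ('s \<Rightarrow> 'g) \<Rightarrow> ('s \<Rightarrow> 'g)"
  where "conj_hom \<Gamma> G a f = (\<lambda>\<gamma> \<in> carrier \<Gamma>. a \<otimes>\<^bsub>G\<^esub> f \<gamma> \<otimes>\<^bsub>G\<^esub> inv\<^bsub>G\<^esub> a)"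

text \<open>
  \<open>M(O)\<close>, the direct sum of the spaces \<open>K[homs_onto \<Gamma> G V]\<close> over \<open>V \<in> O\<close>.  Different \<open>V\<close> have
  disjoint bases, so this is the space whose basis is the union of these bases.
\<close>

definition rep_module ::
    "('k, 'a) ring_scheme \<Rightarrow> ('s, 'c) monoid_scheme \<Rightarrow> ('g, 'b) monoid_scheme \<Rightarrow> 'g set set \<Rightarrow>
     ('k, ('s \<Rightarrow> 'g) \<Rightarrow> 'k, 'g) gmodule"
  where "rep_module K \<Gamma> G Os = permutation_module K (\<Union>V\<in>Os. homs_onto \<Gamma> G V) (conj_hom \<Gamma> G)"

definition normalizer_quotient :: "('g, 'b) monoid_scheme \<Rightarrow> 'g set \<Rightarrow> 'g set monoid"
  where "normalizer_quotient G U = G\<lparr>carrier := normalizer G U\<rparr> Mod centralizer G U"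

text \<open>
  \<open>K[homs_onto \<Gamma> G U]\<close> as a left \<open>K[Z]\<close>-module, where \<open>Z = normalizer_quotient G U\<close>.  The action of a
  coset does not depend on the representative, since the centralizer of \<open>U\<close> fixes all \<open>f\<close> with image \<open>U\<close>.
\<close>

definition rep_module_onto ::
    "('k, 'a) ring_scheme \<Rightarrow> ('s, 'c) monoid_scheme \<Rightarrow> ('g, 'b) monoid_scheme \<Rightarrow> 'g set \<Rightarrow>
     ('k, ('s \<Rightarrow> 'g) \<Rightarrow> 'k, 'g set) gmodule"
  where "rep_module_onto K \<Gamma> G U =
    permutation_module K (homs_onto \<Gamma> G U) (\<lambda>z. conj_hom \<Gamma> G (SOME b. b \<in> z))"

definition coset_module ::
    "('k, 'a) ring_scheme \<Rightarrow> ('g, 'b) monoid_scheme \<Rightarrow> 'g set \<Rightarrow> ('k, 'g set \<Rightarrow> 'k, 'g) gmodule"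
  where "coset_module K G C = permutation_module K (lcosets\<^bsub>G\<^esub> C) (\<lambda>a A. a <#\<^bsub>G\<^esub> A)"

text \<open>
  The right action of \<open>z = b C\<close> on \<open>K[G/C]\<close>.  As \<open>b\<close> normalizes \<open>C\<close>, the product of the sets \<open>a C\<close>
  and \<open>b C\<close> is \<open>a b C\<close>.
\<close>

definition coset_right_action ::
    "('k, 'a) ring_scheme \<Rightarrow> ('g, 'b) monoid_scheme \<Rightarrow> 'g set \<Rightarrow> 'g set \<Rightarrow> ('g set \<Rightarrow> 'k) \<Rightarrow> ('g set \<Rightarrow> 'k)"
  where "coset_right_action K G C z =
    linear_extension K (free_module K (lcosets\<^bsub>G\<^esub> C)) (\<lambda>A. basis_vec K (A <#>\<^bsub>G\<^esub> z))"

end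

theory Submission
  imports Defs
begin

text \<open>
  Write \<open>\<Omega>\<close> for the set of homomorphisms \<open>\<Gamma> \<rightarrow> G\<close> with image \<open>U\<close> and \<open>\<Omega>'\<close> for those whose image is
  conjugate to \<open>U\<close>.  An element \<open>a\<close> of \<open>G\<close> fixes \<open>f \<in> \<Omega>\<close> under conjugation exactly if it centralizes
  the image \<open>U\<close> (\<open>cj_eq_iff\<close>).  Hence \<open>Z = N/C\<close> acts freely on \<open>\<Omega>\<close>, and every \<open>G\<close>-orbit on \<open>\<Omega>'\<close> is a
  copy of \<open>G/C\<close>.  Each of these orbits meets \<open>\<Omega>\<close> in one \<open>Z\<close>-orbit, so a set \<open>T\<close> of representatives of
  the \<open>Z\<close>-orbits on \<open>\<Omega>\<close> also represents the \<open>G\<close>-orbits on \<open>\<Omega>'\<close>.  Therefore \<open>M(O)\<close> is a direct sum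
  of copies of \<open>K[G/C]\<close>, one for each \<open>t \<in> T\<close>.  On the other side \<open>M\<^sub>U\<close> is a free \<open>K[Z]\<close>-module with
  basis \<open>T\<close>, so a tensor product \<open>X \<otimes> M\<^sub>U\<close> over \<open>K[Z]\<close> is a direct sum of copies of \<open>X\<close>, again
  indexed by \<open>T\<close>.  With \<open>X = K[G/C]\<close> this is the isomorphism \<open>\<Phi>\<close>; with \<open>X = H\<^sup>m(G, K[G/C])\<close> it gives
  \<open>\<Psi>\<close>, provided that cohomology commutes with the direct sum over \<open>T\<close>.

  Both isomorphisms come from one criterion, \<open>lift_is_iso\<close>: a balanced bilinear map
  \<open>\<beta> : X \<times> M\<^sub>U \<rightarrow> Y\<close> induces an isomorphism if there are linear maps \<open>p\<^sub>t : Y \<rightarrow> X\<close> that recover the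
  coordinates, \<open>p\<^sub>t (\<beta> (x, s)) = x\<close> for \<open>s = t\<close> and \<open>0\<close> otherwise, and if the values \<open>\<beta> (x, t)\<close> span \<open>Y\<close>.
  Here \<open>\<beta>\<close> is built from the inclusions \<open>push t\<close> of \<open>K[G/C]\<close> onto the summands of \<open>M(O)\<close>, and the \<open>p\<^sub>t\<close>
  from the projections \<open>pull t\<close>.  Since these are \<open>G\<close>-homomorphisms, the first condition passes to
  cohomology by functoriality.

  The spanning condition in cohomology is the substantial point when \<open>T\<close> is infinite, because the
  modules of the given resolution \<open>P\<close> may be infinitely generated, and then
  \<open>Hom\<^bsub>K[G]\<^esub>(P\<^sub>m, -)\<close> does not commute with infinite direct sums.  As \<open>G\<close> is finite and \<open>K\<close> is a field,
  however, the identity of \<open>P\<close> is chain homotopic to a map whose components all have finite rank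
  (\<open>identity_homotopic_to_finite_rank\<close>).  So every cocycle is cohomologous to one of finite rank
  (\<open>cocycle_finite_rank\<close>), and the values of such a cocycle in \<open>M(O)\<close> involve finitely many orbits
  only.  It is the sum of its finitely many components \<open>push t \<circ> pull t \<circ> c\<close>
  (\<open>ext_class_finitely_many_orbits\<close>).

  Conjugates of homomorphisms are homomorphisms because products of homotopy classes of loops are
  again such classes (\<open>fundamental_group_mult_closed\<close>).
\<close>

section \<open>Linear maps, submodules and quotients\<close>

lemma linear_mapsI:
  assumes "\<And>x. x \<in> carrier M \<Longrightarrow> f x \<in> carrier N"
    and "\<And>x y. x \<in> carrier M \<Longrightarrow> y \<in> carrier M \<Longrightarrow> f (x \<oplus>\<^bsub>M\<^esub> y) = f x \<oplus>\<^bsub>N\<^esub> f y"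
    and "\<And>c x. c \<in> carrier K \<Longrightarrow> x \<in> carrier M \<Longrightarrow> f (c \<odot>\<^bsub>M\<^esub> x) = c \<odot>\<^bsub>N\<^esub> f x"
  shows "f \<in> linear_maps K M N"
  using assms unfolding linear_maps_def by auto

lemma linear_mapsD:
  assumes "f \<in> linear_maps K M N"
  shows linear_maps_closed: "x \<in> carrier M \<Longrightarrow> f x \<in> carrier N"
    and linear_maps_add: "x \<in> carrier M \<Longrightarrow> y \<in> carrier M \<Longrightarrow> f (x \<oplus>\<^bsub>M\<^esub> y) = f x \<oplus>\<^bsub>N\<^esub> f y"
    and linear_maps_smult: "c \<in> carrier K \<Longrightarrow> x \<in> carrier M \<Longrightarrow> f (c \<odot>\<^bsub>M\<^esub> x) = c \<odot>\<^bsub>N\<^esub> f x"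
  using assms unfolding linear_maps_def by auto

lemma linear_maps_compose:
  assumes "f \<in> linear_maps K M N" "h \<in> linear_maps K N L"
  shows "(\<lambda>x. h (f x)) \<in> linear_maps K M L"
  using assms by (auto simp: linear_maps_def Pi_iff)

lemma linear_maps_zero:
  assumes "module K M" "module K N" "f \<in> linear_maps K M N"
  shows "f \<zero>\<^bsub>M\<^esub> = \<zero>\<^bsub>N\<^esub>"
proof -
  interpret M: module K M by fact
  interpret N: module K N by fact
  have "f (\<zero>\<^bsub>K\<^esub> \<odot>\<^bsub>M\<^esub> \<zero>\<^bsub>M\<^esub>) = \<zero>\<^bsub>K\<^esub> \<odot>\<^bsub>N\<^esub> f \<zero>\<^bsub>M\<^esub>"
    using assms(3) by (intro linear_maps_smult) auto
  then show ?thesis using linear_maps_closed[OF assms(3), of "\<zero>\<^bsub>M\<^esub>"] by simp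
qed

lemma linear_maps_uminus:
  assumes "module K M" "module K N" "f \<in> linear_maps K M N" "x \<in> carrier M"
  shows "f (\<ominus>\<^bsub>M\<^esub> x) = \<ominus>\<^bsub>N\<^esub> f x"
proof -
  interpret M: module K M by fact
  interpret N: module K N by fact
  have "f (\<ominus>\<^bsub>M\<^esub> x) \<oplus>\<^bsub>N\<^esub> f x = f (\<ominus>\<^bsub>M\<^esub> x \<oplus>\<^bsub>M\<^esub> x)"
    using assms by (simp add: linear_maps_add[OF assms(3)])
  also have "\<dots> = \<zero>\<^bsub>N\<^esub>" using assms by (simp add: M.M.l_neg linear_maps_zero)
  finally show ?thesis
    using assms by (intro N.M.minus_equality[symmetric]) (auto intro: linear_maps_closed)
qed

lemma linear_maps_minus:
  assumes "module K M" "module K N" "f \<in> linear_maps K M N" "x \<in> carrier M" "y \<in> carrier M"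
  shows "f (x \<ominus>\<^bsub>M\<^esub> y) = f x \<ominus>\<^bsub>N\<^esub> f y"
proof -
  interpret M: module K M by fact
  show ?thesis using assms
    by (simp add: a_minus_def linear_maps_add[OF assms(3)] linear_maps_uminus)
qed

lemma linear_maps_kernel_submodule:
  assumes "module K M" "module K N" "f \<in> linear_maps K M N"
  shows "submodule {x \<in> carrier M. f x = \<zero>\<^bsub>N\<^esub>} K M"
proof -
  interpret M: module K M by fact
  interpret N: module K N by fact
  show ?thesis
    by (rule M.submoduleI)
      (auto simp: linear_maps_zero[OF assms] linear_maps_uminus[OF assms] linear_maps_add[OF assms(3)]
        linear_maps_smult[OF assms(3)])
qed

lemma linear_maps_preimage_submodule:
  assumes "module K M" "module K N" "f \<in> linear_maps K M N" "submodule L K N"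
  shows "submodule {x \<in> carrier M. f x \<in> L} K M"
proof -
  interpret M: module K M by fact
  interpret N: module K N by fact
  note L = N.submoduleE[OF assms(4)]
  have "\<zero>\<^bsub>N\<^esub> \<in> L" using subgroup.one_closed[OF submodule.axioms(1)[OF assms(4)]] by simp
  then show ?thesis using L
    by (intro M.submoduleI)
      (auto simp: linear_maps_zero[OF assms(1-3)] linear_maps_uminus[OF assms(1-3)]
        linear_maps_add[OF assms(3)] linear_maps_smult[OF assms(3)])
qed

lemma linear_maps_image_submodule:
  assumes "module K M" "module K N" "f \<in> linear_maps K M N" "submodule L K M"
  shows "submodule (f ` L) K N"
proof -
  interpret M: module K M by fact
  interpret N: module K N by fact
  note L = M.submoduleE[OF assms(4)]
  have sub: "x \<in> carrier M" if "x \<in> L" for x using L(1) that by auto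
  have z: "\<zero>\<^bsub>M\<^esub> \<in> L" using subgroup.one_closed[OF submodule.axioms(1)[OF assms(4)]] by simp
  show ?thesis
  proof (rule N.submoduleI)
    show "f ` L \<subseteq> carrier N" using sub linear_maps_closed[OF assms(3)] by auto
    show "\<zero>\<^bsub>N\<^esub> \<in> f ` L" using z linear_maps_zero[OF assms(1-3)] by force
  next
    fix a assume "a \<in> f ` L"
    then obtain x where "x \<in> L" "a = f x" by auto
    then show "\<ominus>\<^bsub>N\<^esub> a \<in> f ` L" using linear_maps_uminus[OF assms(1-3)] L(3) sub by force
  next
    fix a b assume "a \<in> f ` L" "b \<in> f ` L"
    then obtain x y where "x \<in> L" "a = f x" "y \<in> L" "b = f y" by auto
    then show "a \<oplus>\<^bsub>N\<^esub> b \<in> f ` L" using linear_maps_add[OF assms(3)] L(5) sub by (metis image_eqI)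
  next
    fix c a assume "a \<in> f ` L" "c \<in> carrier K"
    then obtain x where "x \<in> L" "a = f x" by auto
    then show "c \<odot>\<^bsub>N\<^esub> a \<in> f ` L" using linear_maps_smult[OF assms(3)] L(4) sub \<open>c \<in> carrier K\<close> by (metis image_eqI)
  qed
qed

lemma submodule_zero: "submodule N K M \<Longrightarrow> \<zero>\<^bsub>M\<^esub> \<in> N"
  using subgroup.one_closed[OF submodule.axioms(1)] by force

lemma submodule_minus:
  fixes M (structure)
  assumes "module K M" "submodule N K M" "x \<in> N" "y \<in> N"
  shows "x \<ominus> y \<in> N"
  using module.submoduleE[OF assms(1,2)] assms(3,4) by (auto simp: a_minus_def)

lemma module_minus_zero:
  fixes M (structure)
  assumes "module K M" "x \<in> carrier M"
  shows "x \<ominus> \<zero> = x"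
proof -
  interpret M: module K M by fact
  have "\<ominus> \<zero> = \<zero>" using M.M.minus_equality[of "\<zero>" "\<zero>"] by simp
  then show ?thesis using assms(2) by (simp add: M.M.minus_eq)
qed

lemma submodule_Int:
  fixes M (structure)
  assumes M: "module K M" and "submodule V K M" "submodule W K M"
  shows "submodule (V \<inter> W) K M"
proof -
  interpret M: module K M by fact
  note V = M.submoduleE[OF assms(2)] and W = M.submoduleE[OF assms(3)]
  show ?thesis
  proof (rule M.submoduleI)
    show "V \<inter> W \<subseteq> carrier M" using V(1) by blast
    show "\<zero> \<in> V \<inter> W" using assms(2,3) by (simp add: submodule_zero)
  qed (simp_all add: V(3-5) W(3-5))
qed

lemma submodule_hull_least: "submodule N K M \<Longrightarrow> E \<subseteq> N \<Longrightarrow> submodule_hull K M E \<subseteq> N"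
  unfolding submodule_hull_def by auto

lemma submodule_hull_incl: "E \<subseteq> submodule_hull K M E"
  unfolding submodule_hull_def by auto

lemma submodule_hull_submodule:
  assumes "module K M" "E \<subseteq> carrier M"
  shows "submodule (submodule_hull K M E) K M"
proof -
  interpret M: module K M by fact
  show ?thesis
  proof (rule M.submoduleI)
    show "submodule_hull K M E \<subseteq> carrier M"
      by (rule submodule_hull_least[OF M.carrier_is_submodule assms(2)])
  qed (auto simp: submodule_hull_def submodule_zero dest: M.submoduleE)
qed

lemma submodule_hull_mono:
  assumes "module K M" "Y \<subseteq> carrier M" "E \<subseteq> Y"
  shows "submodule_hull K M E \<subseteq> submodule_hull K M Y"
  using submodule_hull_least[OF submodule_hull_submodule[OF assms(1,2)]] submodule_hull_incl assms(3)
  by (metis subset_trans)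

lemma mem_coset_iff:
  fixes M (structure)
  assumes "module K M" "submodule N K M" "x \<in> carrier M" "y \<in> carrier M"
  shows "y \<in> N +> x \<longleftrightarrow> y \<ominus> x \<in> N"
proof -
  interpret M: module K M by fact
  have N: "N \<subseteq> carrier M" using M.submoduleE(1)[OF assms(2)] .
  show ?thesis
  proof
    assume "y \<in> N +> x"
    then obtain n where n: "n \<in> N" "y = n \<oplus> x" by (auto simp: a_r_coset_def')
    with N assms(3) have "y \<ominus> x = n"
      by (auto simp: a_minus_def M.M.a_assoc M.M.r_neg subset_iff)
    with n show "y \<ominus> x \<in> N" by simp
  next
    assume "y \<ominus> x \<in> N"
    moreover have "y = (y \<ominus> x) \<oplus> x"
      using assms by (simp add: a_minus_def M.M.a_assoc M.M.l_neg)
    ultimately show "y \<in> N +> x" by (auto simp: a_r_coset_def')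
  qed
qed

lemma coset_eq_iff:
  fixes M (structure)
  assumes "module K M" "submodule N K M" "x \<in> carrier M" "y \<in> carrier M"
  shows "N +> x = N +> y \<longleftrightarrow> x \<ominus> y \<in> N"
proof -
  interpret M: module K M by fact
  have sg: "subgroup N (add_monoid M)" using submodule.axioms(1)[OF assms(2)] .
  have "N +> x = N +> y \<longleftrightarrow> x \<in> N +> y"
  proof
    assume "N +> x = N +> y"
    moreover have "x \<in> N +> x"
      using mem_coset_iff[OF assms(1,2,3,3)] assms(3) submodule_zero[OF assms(2)]
      by (simp add: a_minus_def M.M.r_neg)
    ultimately show "x \<in> N +> y" by simp
  next
    assume "x \<in> N +> y"
    then show "N +> x = N +> y"
      using M.M.a_repr_independence[OF _ assms(4) sg] by simp
  qed
  then show ?thesis using mem_coset_iff[OF assms(1,2,4,3)] by simp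
qed

text \<open>
  The module axioms, apart from the existence of negatives, are equations; all of them carry over along
  a surjection that respects the operations.  This yields the axioms for quotients in one go, and
  shows that they depend on the additive structure and the scalar action only.
\<close>

lemma module_surj_image:
  fixes M (structure)
  assumes "module K M" and img: "q ` carrier M = carrier Q" and zero: "q \<zero> = \<zero>\<^bsub>Q\<^esub>"
    and add: "\<And>x y. x \<in> carrier M \<Longrightarrow> y \<in> carrier M \<Longrightarrow> q x \<oplus>\<^bsub>Q\<^esub> q y = q (x \<oplus> y)"
    and smult: "\<And>c x. c \<in> carrier K \<Longrightarrow> x \<in> carrier M \<Longrightarrow> c \<odot>\<^bsub>Q\<^esub> q x = q (c \<odot> x)"
  shows "module K Q"
proof -
  interpret M: module K M by fact
  have ex: "\<exists>x' \<in> carrier M. x = q x'" if "x \<in> carrier Q" for x using that img by auto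
  have cl: "q x \<in> carrier Q" if "x \<in> carrier M" for x using that img by auto
  show ?thesis
  proof (rule moduleI[OF M.is_cring abelian_groupI])
    show "\<zero>\<^bsub>Q\<^esub> \<in> carrier Q" using cl[of "\<zero>"] by (simp add: zero)
  next
    fix x assume "x \<in> carrier Q"
    then obtain x' where x': "x' \<in> carrier M" "x = q x'" using ex by blast
    then have "q (\<ominus> x') \<oplus>\<^bsub>Q\<^esub> x = \<zero>\<^bsub>Q\<^esub>" by (simp add: add M.M.l_neg zero)
    then show "\<exists>y\<in>carrier Q. y \<oplus>\<^bsub>Q\<^esub> x = \<zero>\<^bsub>Q\<^esub>" using cl x' by blast
    show "\<zero>\<^bsub>Q\<^esub> \<oplus>\<^bsub>Q\<^esub> x = x" using x' by (simp add: zero[symmetric] add)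
    show "\<one>\<^bsub>K\<^esub> \<odot>\<^bsub>Q\<^esub> x = x" using x' by (simp add: smult)
    fix y assume "y \<in> carrier Q"
    then obtain y' where y': "y' \<in> carrier M" "y = q y'" using ex by blast
    show "x \<oplus>\<^bsub>Q\<^esub> y \<in> carrier Q" "x \<oplus>\<^bsub>Q\<^esub> y = y \<oplus>\<^bsub>Q\<^esub> x"
      using x' y' by (simp_all add: add cl M.M.a_comm)
    fix z assume "z \<in> carrier Q"
    then obtain z' where z': "z' \<in> carrier M" "z = q z'" using ex by blast
    show "x \<oplus>\<^bsub>Q\<^esub> y \<oplus>\<^bsub>Q\<^esub> z = x \<oplus>\<^bsub>Q\<^esub> (y \<oplus>\<^bsub>Q\<^esub> z)" using x' y' z' by (simp add: add M.M.a_assoc)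
  next
    fix a x assume a: "a \<in> carrier K" and "x \<in> carrier Q"
    then obtain x' where x': "x' \<in> carrier M" "x = q x'" using ex by blast
    show "a \<odot>\<^bsub>Q\<^esub> x \<in> carrier Q" using a x' cl by (simp add: smult)
    { fix b assume b: "b \<in> carrier K"
      show "(a \<oplus>\<^bsub>K\<^esub> b) \<odot>\<^bsub>Q\<^esub> x = a \<odot>\<^bsub>Q\<^esub> x \<oplus>\<^bsub>Q\<^esub> b \<odot>\<^bsub>Q\<^esub> x"
        using a b x' by (simp add: smult add M.smult_l_distr)
      show "a \<otimes>\<^bsub>K\<^esub> b \<odot>\<^bsub>Q\<^esub> x = a \<odot>\<^bsub>Q\<^esub> (b \<odot>\<^bsub>Q\<^esub> x)"
        using a b x' by (simp add: smult M.smult_assoc1) }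
    fix y assume "y \<in> carrier Q"
    then obtain y' where y': "y' \<in> carrier M" "y = q y'" using ex by blast
    show "a \<odot>\<^bsub>Q\<^esub> (x \<oplus>\<^bsub>Q\<^esub> y) = a \<odot>\<^bsub>Q\<^esub> x \<oplus>\<^bsub>Q\<^esub> a \<odot>\<^bsub>Q\<^esub> y"
      using a x' y' by (simp add: smult add M.smult_r_distr)
  qed
qed

lemma module_cong:
  assumes "module K M" "carrier M' = carrier M" "add M' = add M" "zero M' = zero M" "smult M' = smult M"
  shows "module K M'"
  by (rule module_surj_image[OF assms(1), of id]) (use assms in auto)

lemma quotient_module_carrier:
  "carrier (quotient_module M N) = (\<lambda>x. N +>\<^bsub>M\<^esub> x) ` carrier M"
  by (auto simp: quotient_module_def A_RCOSETS_def')

lemma quotient_module_zero: "\<zero>\<^bsub>quotient_module M N\<^esub> = N"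
  by (simp add: quotient_module_def)

lemma
  fixes M (structure)
  assumes M: "module K M" and N: "submodule N K M"
  shows quotient_map_add: "\<And>x y. x \<in> carrier M \<Longrightarrow> y \<in> carrier M \<Longrightarrow>
      (N +> x) \<oplus>\<^bsub>quotient_module M N\<^esub> (N +> y) = N +> (x \<oplus> y)"
    and quotient_map_smult: "\<And>c x. c \<in> carrier K \<Longrightarrow> x \<in> carrier M \<Longrightarrow>
      c \<odot>\<^bsub>quotient_module M N\<^esub> (N +> x) = N +> (c \<odot> x)"
    and quotient_module_module: "module K (quotient_module M N)"
    and quotient_map_linear: "(\<lambda>x. N +> x) \<in> linear_maps K M (quotient_module M N)"
proof -
  interpret M: module K M by fact
  have sg: "subgroup N (add_monoid M)" using submodule.axioms(1)[OF N] .
  interpret S: abelian_subgroup N M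
    by (rule abelian_subgroupI2[OF M.M.a_comm_group sg])
  note NE = M.submoduleE[OF N]
  show 1: "(N +> x) \<oplus>\<^bsub>quotient_module M N\<^esub> (N +> y) = N +> (x \<oplus> y)"
    if "x \<in> carrier M" "y \<in> carrier M" for x y
    using S.a_rcos_sum[OF that] by (simp add: quotient_module_def)
  show 2: "c \<odot>\<^bsub>quotient_module M N\<^esub> (N +> x) = N +> (c \<odot> x)"
    if c: "c \<in> carrier K" and x: "x \<in> carrier M" for c x
  proof -
    have "N +> (c \<odot> y) = N +> (c \<odot> x)" if y: "y \<in> N +> x" for y
    proof -
      have yc: "y \<in> carrier M" using y M.M.a_r_coset_subset_G[OF NE(1) x] by auto
      have "y \<ominus> x \<in> N" using y mem_coset_iff[OF M N x yc] by simp
      then have "c \<odot> (y \<ominus> x) \<in> N" using NE(4) c by blast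
      then have "c \<odot> y \<ominus> c \<odot> x \<in> N"
        using c x yc by (simp add: a_minus_def M.smult_r_distr M.smult_r_minus)
      then show ?thesis using coset_eq_iff[OF M N] c x yc by simp
    qed
    moreover have "x \<in> N +> x" using S.a_rcos_self[OF x] .
    ultimately have "(\<Union>y\<in>N +> x. N +> (c \<odot> y)) = N +> (c \<odot> x)" by blast
    then show ?thesis by (simp add: quotient_module_def)
  qed
  have 0: "N +> \<zero> = N" using NE(1) by simp
  show "module K (quotient_module M N)"
    by (rule module_surj_image[OF M, of "\<lambda>x. N +> x"])
      (simp_all add: quotient_module_carrier quotient_module_zero 0 1 2)
  show "(\<lambda>x. N +> x) \<in> linear_maps K M (quotient_module M N)"
    by (rule linear_mapsI) (auto simp: quotient_module_carrier 1 2)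
qed

lemma quotient_module_lift:
  fixes M (structure)
  assumes M: "module K M" and N: "submodule N K M" and L: "module K L"
    and f: "f \<in> linear_maps K M L" and ker: "\<And>x. x \<in> N \<Longrightarrow> f x = \<zero>\<^bsub>L\<^esub>"
  obtains h where "h \<in> linear_maps K (quotient_module M N) L"
    "\<And>x. x \<in> carrier M \<Longrightarrow> h (N +> x) = f x"
proof -
  interpret M: module K M by fact
  interpret L: module K L by fact
  define h where "h Q = f (SOME x. x \<in> carrier M \<and> N +> x = Q)" for Q
  have h: "h (N +> x) = f x" if x: "x \<in> carrier M" for x
  proof -
    let ?y = "SOME y. y \<in> carrier M \<and> N +> y = N +> x"
    have y: "?y \<in> carrier M \<and> N +> ?y = N +> x"
      by (rule someI[of "\<lambda>y. y \<in> carrier M \<and> N +> y = N +> x" x]) (use x in auto)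
    then have "?y \<ominus> x \<in> N" using coset_eq_iff[OF M N] x by blast
    then have "f ?y \<ominus>\<^bsub>L\<^esub> f x = \<zero>\<^bsub>L\<^esub>"
      using ker linear_maps_minus[OF M L f] x y by metis
    moreover have "f ?y \<in> carrier L" "f x \<in> carrier L" using linear_maps_closed[OF f] x y by auto
    ultimately have "f ?y = f x" using L.M.add.inv_solve_right' by (metis L.M.minus_eq L.M.l_zero L.M.zero_closed)
    then show ?thesis unfolding h_def .
  qed
  have "h \<in> linear_maps K (quotient_module M N) L"
  proof (rule linear_mapsI)
    fix Q assume "Q \<in> carrier (quotient_module M N)"
    then obtain x where x: "x \<in> carrier M" "Q = N +> x" by (auto simp: quotient_module_carrier)
    then show "h Q \<in> carrier L" using h linear_maps_closed[OF f] by simp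
    { fix c assume "c \<in> carrier K"
      then show "h (c \<odot>\<^bsub>quotient_module M N\<^esub> Q) = c \<odot>\<^bsub>L\<^esub> h Q"
        using x by (simp add: quotient_map_smult[OF M N] h linear_maps_smult[OF f]) }
    fix R assume "R \<in> carrier (quotient_module M N)"
    then obtain y where y: "y \<in> carrier M" "R = N +> y" by (auto simp: quotient_module_carrier)
    then show "h (Q \<oplus>\<^bsub>quotient_module M N\<^esub> R) = h Q \<oplus>\<^bsub>L\<^esub> h R"
      using x by (simp add: quotient_map_add[OF M N] h linear_maps_add[OF f])
  qed
  then show ?thesis using that h by blast
qed

lemma submodule_of_submodule:
  assumes "module K M" "submodule N K M" "submodule N' K M" "N' \<subseteq> N"
  shows "submodule N' K (M\<lparr>carrier := N\<rparr>)"
proof -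
  interpret N: module K "M\<lparr>carrier := N\<rparr>" by (rule submodule.submodule_is_module[OF assms(2,1)])
  show ?thesis
    using submodule.submodule_is_module[OF assms(3,1)] assms(4)
    by (intro N.module_incl_imp_submodule) auto
qed

section \<open>Free modules and permutation modules\<close>

lemma free_module_simps [simp]:
  "zero (free_module K S) = (\<lambda>_. \<zero>\<^bsub>K\<^esub>)"
  "add (free_module K S) = (\<lambda>v w s. v s \<oplus>\<^bsub>K\<^esub> w s)"
  "smult (free_module K S) = (\<lambda>c w s. c \<otimes>\<^bsub>K\<^esub> w s)"
  by (simp_all add: free_module_def)

lemma free_module_carrier:
  "w \<in> carrier (free_module K S) \<longleftrightarrow>
    (\<forall>s. w s \<in> carrier K) \<and> finite {s. w s \<noteq> \<zero>\<^bsub>K\<^esub>} \<and> {s. w s \<noteq> \<zero>\<^bsub>K\<^esub>} \<subseteq> S"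
  by (simp add: free_module_def)

lemma free_moduleI:
  assumes "\<And>s. w s \<in> carrier K" "finite F" "F \<subseteq> S" "\<And>s. s \<notin> F \<Longrightarrow> w s = \<zero>\<^bsub>K\<^esub>"
  shows "w \<in> carrier (free_module K S)"
proof -
  have "{s. w s \<noteq> \<zero>\<^bsub>K\<^esub>} \<subseteq> F" using assms(4) by blast
  then show ?thesis using assms(1-3) finite_subset by (auto simp: free_module_carrier)
qed

lemma free_moduleD:
  assumes "w \<in> carrier (free_module K S)"
  shows "w s \<in> carrier K" "finite {s. w s \<noteq> \<zero>\<^bsub>K\<^esub>}" "w s \<noteq> \<zero>\<^bsub>K\<^esub> \<Longrightarrow> s \<in> S"
  using assms by (auto simp: free_module_carrier)

lemma free_module_module:
  assumes "cring K"
  shows "module K (free_module K S)"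
proof -
  interpret K: cring K by fact
  have addc: "(\<lambda>s. v s \<oplus>\<^bsub>K\<^esub> w s) \<in> carrier (free_module K S)"
    if v: "v \<in> carrier (free_module K S)" and w: "w \<in> carrier (free_module K S)" for v w
    by (rule free_moduleI[where F = "{s. v s \<noteq> \<zero>\<^bsub>K\<^esub>} \<union> {s. w s \<noteq> \<zero>\<^bsub>K\<^esub>}"])
      (use free_moduleD[OF v] free_moduleD[OF w] in auto)
  have smultc: "(\<lambda>s. c \<otimes>\<^bsub>K\<^esub> w s) \<in> carrier (free_module K S)"
    if c: "c \<in> carrier K" and w: "w \<in> carrier (free_module K S)" for c w
    by (rule free_moduleI[where F = "{s. w s \<noteq> \<zero>\<^bsub>K\<^esub>}"]) (use free_moduleD[OF w] c in auto)
  show ?thesis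
  proof (rule moduleI[OF assms abelian_groupI])
    show "\<zero>\<^bsub>free_module K S\<^esub> \<in> carrier (free_module K S)"
      by (auto simp: free_module_carrier)
  next
    fix x assume x: "x \<in> carrier (free_module K S)"
    have "(\<lambda>s. \<ominus>\<^bsub>K\<^esub> x s) \<in> carrier (free_module K S)"
      by (rule free_moduleI[where F = "{s. x s \<noteq> \<zero>\<^bsub>K\<^esub>}"]) (use free_moduleD[OF x] in auto)
    then show "\<exists>y\<in>carrier (free_module K S). y \<oplus>\<^bsub>free_module K S\<^esub> x = \<zero>\<^bsub>free_module K S\<^esub>"
      by (rule bexI[rotated]) (use free_moduleD[OF x] in \<open>auto simp: K.l_neg\<close>)
  qed (auto simp: addc smultc free_moduleD(1) K.a_ac K.l_distr K.r_distr K.m_assoc)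
qed

lemma basis_vec_closed:
  assumes "cring K" "s \<in> S"
  shows "basis_vec K s \<in> carrier (free_module K S)"
proof -
  interpret K: cring K by fact
  show ?thesis
    by (rule free_moduleI[where F = "{s}"]) (use assms in \<open>auto simp: basis_vec_def\<close>)
qed

lemma free_module_induct [consumes 2, case_names zero add]:
  assumes "cring K" and w: "w \<in> carrier (free_module K S)"
    and zero: "P (\<lambda>_. \<zero>\<^bsub>K\<^esub>)"
    and add: "\<And>c s w. c \<in> carrier K \<Longrightarrow> s \<in> S \<Longrightarrow> w \<in> carrier (free_module K S) \<Longrightarrow> P w \<Longrightarrow>
      P ((c \<odot>\<^bsub>free_module K S\<^esub> basis_vec K s) \<oplus>\<^bsub>free_module K S\<^esub> w)"
  shows "P w"
proof -
  interpret K: cring K by fact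
  have "finite {s. w s \<noteq> \<zero>\<^bsub>K\<^esub>}" using free_moduleD(2)[OF w] .
  then show ?thesis using w
  proof (induction "{s. w s \<noteq> \<zero>\<^bsub>K\<^esub>}" arbitrary: w rule: finite_induct)
    case empty
    then have "w = (\<lambda>_. \<zero>\<^bsub>K\<^esub>)" by auto
    then show ?case using zero by simp
  next
    case (insert s F)
    note w = free_moduleD[OF insert.prems]
    define v where "v = w(s := \<zero>\<^bsub>K\<^esub>)"
    have F: "F = {s. v s \<noteq> \<zero>\<^bsub>K\<^esub>}" using insert.hyps(2,4) unfolding v_def by auto
    have v: "v \<in> carrier (free_module K S)"
      by (rule free_moduleI[where F = "{s. w s \<noteq> \<zero>\<^bsub>K\<^esub>}"]) (use w in \<open>auto simp: v_def\<close>)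
    have s: "s \<in> S" using insert.hyps(4) w(3)[of s] by auto
    have "w = (w s \<odot>\<^bsub>free_module K S\<^esub> basis_vec K s) \<oplus>\<^bsub>free_module K S\<^esub> v"
      using w(1) by (auto simp: v_def basis_vec_def)
    then show ?case using add[OF w(1)[of s] s v insert.hyps(3)[OF F v]] by simp
  qed
qed

text \<open>
  The sum in \<open>linear_extension\<close> runs over the support of its argument.  Enlarging the index set is what
  allows the sums for two different vectors to be compared term by term.
\<close>

lemma linear_extension_superset:
  fixes M (structure)
  assumes M: "module K M" and w: "w \<in> carrier (free_module K S)" and \<phi>: "\<And>s. s \<in> S \<Longrightarrow> \<phi> s \<in> carrier M"
    and T: "finite T" "T \<subseteq> S" "{s. w s \<noteq> \<zero>\<^bsub>K\<^esub>} \<subseteq> T"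
  shows "linear_extension K M \<phi> w = (\<Oplus>s\<in>T. w s \<odot> \<phi> s)"
proof -
  interpret M: module K M by fact
  show ?thesis unfolding linear_extension_def
    by (rule M.M.add.finprod_mono_neutral_cong_left)
      (use T \<phi> free_moduleD(1)[OF w] in \<open>auto simp: subset_iff Pi_iff\<close>)
qed

lemma linear_extension_linear:
  fixes M (structure)
  assumes M: "module K M" and \<phi>: "\<And>s. s \<in> S \<Longrightarrow> \<phi> s \<in> carrier M"
  shows "linear_extension K M \<phi> \<in> linear_maps K (free_module K S) M"
proof -
  interpret M: module K M by fact
  interpret F: module K "free_module K S" by (rule free_module_module) (rule M.is_cring)
  let ?s = "\<lambda>w. {s. w s \<noteq> \<zero>\<^bsub>K\<^esub>}"
  note ext = linear_extension_superset[OF M _ \<phi>]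
  show ?thesis
  proof (rule linear_mapsI)
    fix x assume x: "x \<in> carrier (free_module K S)"
    show "linear_extension K M \<phi> x \<in> carrier M"
      unfolding linear_extension_def using free_moduleD[OF x] \<phi> by (intro M.M.finsum_closed) auto
    { fix c assume c: "c \<in> carrier K"
      have cx: "c \<odot>\<^bsub>free_module K S\<^esub> x \<in> carrier (free_module K S)" using c x by (rule F.smult_closed)
      have T: "finite (?s x)" "?s x \<subseteq> S" using free_moduleD[OF x] by auto
      have fc: "(\<lambda>s. x s \<odot> \<phi> s) \<in> ?s x \<rightarrow> carrier M" using free_moduleD(1)[OF x] T \<phi> by auto
      have "linear_extension K M \<phi> (c \<odot>\<^bsub>free_module K S\<^esub> x)
          = (\<Oplus>s\<in>?s x. (c \<otimes>\<^bsub>K\<^esub> x s) \<odot> \<phi> s)"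
        using c T(2) by (subst ext[OF cx _ T]) auto
      also have "\<dots> = (\<Oplus>s\<in>?s x. c \<odot> (x s \<odot> \<phi> s))"
        by (rule M.M.finsum_cong') (use c T \<phi> free_moduleD(1)[OF x] in \<open>auto simp: M.smult_assoc1 subset_iff\<close>)
      also have "\<dots> = c \<odot> (\<Oplus>s\<in>?s x. x s \<odot> \<phi> s)"
        by (rule M.finsum_smult_ldistr[symmetric, OF T(1) c fc])
      finally show "linear_extension K M \<phi> (c \<odot>\<^bsub>free_module K S\<^esub> x) = c \<odot> linear_extension K M \<phi> x"
        by (simp add: linear_extension_def) }
    fix y assume y: "y \<in> carrier (free_module K S)"
    have xy: "x \<oplus>\<^bsub>free_module K S\<^esub> y \<in> carrier (free_module K S)" using x y by blast
    let ?T = "?s x \<union> ?s y"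
    have T: "finite ?T" "?T \<subseteq> S" using free_moduleD[OF x] free_moduleD[OF y] by auto
    have "linear_extension K M \<phi> (x \<oplus>\<^bsub>free_module K S\<^esub> y)
        = (\<Oplus>s\<in>?T. (x s \<oplus>\<^bsub>K\<^esub> y s) \<odot> \<phi> s)"
      using T(2) by (subst ext[OF xy _ T]) auto
    also have "\<dots> = (\<Oplus>s\<in>?T. x s \<odot> \<phi> s \<oplus> y s \<odot> \<phi> s)"
      by (rule M.M.finsum_cong')
        (use T \<phi> free_moduleD(1)[OF x] free_moduleD(1)[OF y] in \<open>auto simp: M.smult_l_distr subset_iff\<close>)
    also have "\<dots> = (\<Oplus>s\<in>?T. x s \<odot> \<phi> s) \<oplus> (\<Oplus>s\<in>?T. y s \<odot> \<phi> s)"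
      by (rule M.M.finsum_addf)
        (use T \<phi> free_moduleD(1)[OF x] free_moduleD(1)[OF y] in \<open>auto simp: subset_iff\<close>)
    also have "\<dots> = linear_extension K M \<phi> x \<oplus> linear_extension K M \<phi> y"
      using ext[OF x _ T] ext[OF y _ T] by simp
    finally show "linear_extension K M \<phi> (x \<oplus>\<^bsub>free_module K S\<^esub> y)
        = linear_extension K M \<phi> x \<oplus> linear_extension K M \<phi> y" .
  qed
qed

lemma linear_extension_basis_vec:
  fixes M (structure)
  assumes M: "module K M" and "\<phi> s \<in> carrier M"
  shows "linear_extension K M \<phi> (basis_vec K s) = \<phi> s"
proof -
  interpret M: module K M by fact
  have "linear_extension K M \<phi> (basis_vec K s) = (\<Oplus>t\<in>{s}. basis_vec K s t \<odot> \<phi> t)"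
    by (rule linear_extension_superset[OF M basis_vec_closed[OF M.is_cring, of s "{s}"]])
      (use assms in \<open>auto simp: basis_vec_def\<close>)
  also have "\<dots> = \<phi> s" using assms(2) by (simp add: basis_vec_def)
  finally show ?thesis .
qed

lemma linear_maps_eq_on_basis:
  fixes M (structure)
  assumes M: "module K M" and "f \<in> linear_maps K (free_module K S) M" "h \<in> linear_maps K (free_module K S) M"
    and basis: "\<And>s. s \<in> S \<Longrightarrow> f (basis_vec K s) = h (basis_vec K s)"
    and w: "w \<in> carrier (free_module K S)"
  shows "f w = h w"
proof -
  interpret M: module K M by fact
  have F: "module K (free_module K S)" by (rule free_module_module[OF M.is_cring])
  interpret F: module K "free_module K S" by fact
  note b = basis_vec_closed[OF M.is_cring]
  note z = linear_maps_zero[OF F M assms(2)] linear_maps_zero[OF F M assms(3)]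
  from M.is_cring w show ?thesis
  proof (induction rule: free_module_induct)
    case zero
    show ?case using z by simp
  next
    case (add c s w)
    have "f (c \<odot>\<^bsub>free_module K S\<^esub> basis_vec K s \<oplus>\<^bsub>free_module K S\<^esub> w) = c \<odot> f (basis_vec K s) \<oplus> f w"
      using add b[OF add(2)] by (simp add: linear_maps_add[OF assms(2)] linear_maps_smult[OF assms(2)] del: free_module_simps)
    moreover have "h (c \<odot>\<^bsub>free_module K S\<^esub> basis_vec K s \<oplus>\<^bsub>free_module K S\<^esub> w) = c \<odot> h (basis_vec K s) \<oplus> h w"
      using add b[OF add(2)] by (simp add: linear_maps_add[OF assms(3)] linear_maps_smult[OF assms(3)] del: free_module_simps)
    ultimately show ?case using basis[OF add(2)] add by simp
  qed
qed

lemma submodule_free_module_eqI: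
  assumes "cring K" and L: "submodule L K (free_module K S)" and "\<And>s. s \<in> S \<Longrightarrow> basis_vec K s \<in> L"
    and w: "w \<in> carrier (free_module K S)"
  shows "w \<in> L"
  using assms(1) w
proof (induction rule: free_module_induct)
  interpret F: module K "free_module K S" by (rule free_module_module[OF assms(1)])
  { case zero show ?case using submodule_zero[OF L] by simp }
  { case (add c s w) then show ?case using F.submoduleE(4,5)[OF L] assms(3) by blast }
qed

lemma linear_extension_cong:
  assumes M: "module K M" and w: "w \<in> carrier (free_module K S)"
    and \<phi>: "\<And>s. s \<in> S \<Longrightarrow> \<phi> s = \<psi> s" and \<psi>: "\<And>s. s \<in> S \<Longrightarrow> \<psi> s \<in> carrier M"
  shows "linear_extension K M \<phi> w = linear_extension K M \<psi> w"
proof -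
  interpret M: module K M by fact
  have "{s. w s \<noteq> \<zero>\<^bsub>K\<^esub>} \<subseteq> S" "\<And>s. w s \<in> carrier K" using free_moduleD[OF w] by auto
  then show ?thesis
    unfolding linear_extension_def by (intro M.M.finsum_cong') (use \<phi> \<psi> in \<open>auto simp: subset_iff\<close>)
qed

lemma linear_extension_add_family:
  fixes M (structure)
  assumes M: "module K M" and \<phi>: "\<And>s. s \<in> S \<Longrightarrow> \<phi> s \<in> carrier M" and \<psi>: "\<And>s. s \<in> S \<Longrightarrow> \<psi> s \<in> carrier M"
    and w: "w \<in> carrier (free_module K S)"
  shows "linear_extension K M (\<lambda>s. \<phi> s \<oplus> \<psi> s) w
    = linear_extension K M \<phi> w \<oplus> linear_extension K M \<psi> w"
proof -
  interpret M: module K M by fact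
  have s: "finite {s. w s \<noteq> \<zero>\<^bsub>K\<^esub>}" "\<And>s. w s \<in> carrier K" "{s. w s \<noteq> \<zero>\<^bsub>K\<^esub>} \<subseteq> S" using free_moduleD[OF w] by auto
  have "linear_extension K M (\<lambda>s. \<phi> s \<oplus> \<psi> s) w
      = (\<Oplus>s\<in>{s. w s \<noteq> \<zero>\<^bsub>K\<^esub>}. w s \<odot> \<phi> s \<oplus> w s \<odot> \<psi> s)"
    unfolding linear_extension_def
    by (rule M.M.finsum_cong') (use s \<phi> \<psi> in \<open>auto simp: M.smult_r_distr subset_iff\<close>)
  also have "\<dots> = linear_extension K M \<phi> w \<oplus> linear_extension K M \<psi> w"
    unfolding linear_extension_def
    by (rule M.M.finsum_addf) (use s \<phi> \<psi> in \<open>auto simp: subset_iff\<close>)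
  finally show ?thesis .
qed

lemma linear_extension_smult_family:
  fixes M (structure)
  assumes M: "module K M" and \<phi>: "\<And>s. s \<in> S \<Longrightarrow> \<phi> s \<in> carrier M" and c: "c \<in> carrier K"
    and w: "w \<in> carrier (free_module K S)"
  shows "linear_extension K M (\<lambda>s. c \<odot> \<phi> s) w = c \<odot> linear_extension K M \<phi> w"
proof -
  interpret M: module K M by fact
  have s: "finite {s. w s \<noteq> \<zero>\<^bsub>K\<^esub>}" "\<And>s. w s \<in> carrier K" "{s. w s \<noteq> \<zero>\<^bsub>K\<^esub>} \<subseteq> S" using free_moduleD[OF w] by auto
  have "linear_extension K M (\<lambda>s. c \<odot> \<phi> s) w
      = (\<Oplus>s\<in>{s. w s \<noteq> \<zero>\<^bsub>K\<^esub>}. c \<odot> (w s \<odot> \<phi> s))"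
    unfolding linear_extension_def
    by (rule M.M.finsum_cong')
      (use s \<phi> c in \<open>auto simp: M.smult_assoc1[symmetric] subset_iff M.m_comm\<close>)
  also have "\<dots> = c \<odot> linear_extension K M \<phi> w"
    unfolding linear_extension_def
    by (rule M.finsum_smult_ldistr[symmetric, OF s(1) c]) (use s \<phi> in \<open>auto simp: subset_iff\<close>)
  finally show ?thesis .
qed

lemma permutation_module_simps [simp]:
  "carrier (permutation_module K S \<alpha>) = carrier (free_module K S)"
  "add (permutation_module K S \<alpha>) = add (free_module K S)"
  "zero (permutation_module K S \<alpha>) = zero (free_module K S)"
  "smult (permutation_module K S \<alpha>) = smult (free_module K S)"
  "gact (permutation_module K S \<alpha>) = (\<lambda>a. linear_extension K (free_module K S) (\<lambda>s. basis_vec K (\<alpha> a s)))"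
  by (simp_all add: permutation_module_def module.extend_def gmodule.fields_def)

lemma permutation_module_module: "cring K \<Longrightarrow> module K (permutation_module K S \<alpha>)"
  by (rule module_cong[OF free_module_module]) simp_all

lemma linear_maps_permutation_module [simp]:
  "linear_maps K (permutation_module K S \<alpha>) M = linear_maps K (free_module K S) M"
  "linear_maps K M (permutation_module K S \<alpha>) = linear_maps K M (free_module K S)"
  by (simp_all add: linear_maps_def)

section \<open>Modules over a group algebra\<close>

lemma group_moduleD:
  fixes M (structure)
  assumes "group_module K G M"
  shows group_module_module: "module K M"
    and group_module_group: "group G"
    and gact_closed: "a \<in> carrier G \<Longrightarrow> x \<in> carrier M \<Longrightarrow> gact M a x \<in> carrier M"
    and gact_add: "a \<in> carrier G \<Longrightarrow> x \<in> carrier M \<Longrightarrow> y \<in> carrier M \<Longrightarrow>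
      gact M a (x \<oplus> y) = gact M a x \<oplus> gact M a y"
    and gact_smult: "a \<in> carrier G \<Longrightarrow> c \<in> carrier K \<Longrightarrow> x \<in> carrier M \<Longrightarrow>
      gact M a (c \<odot> x) = c \<odot> gact M a x"
    and gact_one: "x \<in> carrier M \<Longrightarrow> gact M \<one>\<^bsub>G\<^esub> x = x"
    and gact_mult: "a \<in> carrier G \<Longrightarrow> b \<in> carrier G \<Longrightarrow> x \<in> carrier M \<Longrightarrow>
      gact M (a \<otimes>\<^bsub>G\<^esub> b) x = gact M a (gact M b x)"
  using assms unfolding group_module_def by blast+

lemma gact_linear:
  assumes "group_module K G M" "a \<in> carrier G"
  shows "gact M a \<in> linear_maps K M M"
  using group_moduleD[OF assms(1)] assms(2) by (auto intro: linear_mapsI)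

lemma permutation_module_group_module:
  assumes "cring K" "group G"
    and closed: "\<And>a s. a \<in> carrier G \<Longrightarrow> s \<in> S \<Longrightarrow> \<alpha> a s \<in> S"
    and one: "\<And>s. s \<in> S \<Longrightarrow> \<alpha> \<one>\<^bsub>G\<^esub> s = s"
    and mult: "\<And>a b s. a \<in> carrier G \<Longrightarrow> b \<in> carrier G \<Longrightarrow> s \<in> S \<Longrightarrow> \<alpha> (a \<otimes>\<^bsub>G\<^esub> b) s = \<alpha> a (\<alpha> b s)"
  shows "group_module K G (permutation_module K S \<alpha>)"
proof -
  interpret G: group G by fact
  let ?F = "free_module K S"
  have F: "module K ?F" by (rule free_module_module[OF assms(1)])
  let ?g = "\<lambda>a. linear_extension K ?F (\<lambda>s. basis_vec K (\<alpha> a s))"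
  note b = basis_vec_closed[OF assms(1)]
  have lin: "?g a \<in> linear_maps K ?F ?F" if "a \<in> carrier G" for a
    by (rule linear_extension_linear[OF F]) (use that b[OF closed] in auto)
  have bas: "?g a (basis_vec K s) = basis_vec K (\<alpha> a s)" if "a \<in> carrier G" "s \<in> S" for a s
    by (rule linear_extension_basis_vec[OF F]) (use that b[OF closed] in auto)
  have "?g \<one>\<^bsub>G\<^esub> x = x" if x: "x \<in> carrier ?F" for x
    by (rule linear_maps_eq_on_basis[OF F lin[OF G.one_closed] _ _ x, of "\<lambda>x. x"])
      (auto intro: linear_mapsI simp: bas one)
  moreover have "?g (a \<otimes>\<^bsub>G\<^esub> c) x = ?g a (?g c x)"
    if ac: "a \<in> carrier G" "c \<in> carrier G" and x: "x \<in> carrier ?F" for a c x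
    by (rule linear_maps_eq_on_basis[OF F lin[OF G.m_closed[OF ac]]
          linear_maps_compose[OF lin[OF ac(2)] lin[OF ac(1)]] _ x])
      (use ac in \<open>simp add: bas closed mult\<close>)
  ultimately show ?thesis
    unfolding group_module_def permutation_module_simps
    using permutation_module_module[OF assms(1), of S \<alpha>] assms(2) linear_mapsD[OF lin]
    by simp
qed

lemma gmodule_homsI:
  assumes "f \<in> linear_maps K M N"
    and "\<And>a x. a \<in> carrier G \<Longrightarrow> x \<in> carrier M \<Longrightarrow> f (gact M a x) = gact N a (f x)"
  shows "f \<in> gmodule_homs K G M N"
  using assms unfolding gmodule_homs_def by auto

lemma gmodule_homsD:
  assumes "f \<in> gmodule_homs K G M N"
  shows gmodule_homs_linear: "f \<in> linear_maps K M N"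
    and gmodule_homs_gact: "a \<in> carrier G \<Longrightarrow> x \<in> carrier M \<Longrightarrow> f (gact M a x) = gact N a (f x)"
  using assms unfolding gmodule_homs_def by auto

lemma gmodule_homs_compose:
  assumes "f \<in> gmodule_homs K G M N" "h \<in> gmodule_homs K G N L"
  shows "(\<lambda>x. h (f x)) \<in> gmodule_homs K G M L"
  using assms linear_maps_compose[of f K M N h L]
  by (auto simp: gmodule_homs_def linear_maps_def Pi_iff)

text \<open>
  Both sides of the equivariance condition are linear, so it is enough to compare them on the basis that
  \<open>G\<close> permutes.
\<close>

lemma permutation_module_homI:
  assumes "cring K" and f: "f \<in> linear_maps K (free_module K S) N"
    and N: "group_module K G N"
    and closed: "\<And>a s. a \<in> carrier G \<Longrightarrow> s \<in> S \<Longrightarrow> \<alpha> a s \<in> S"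
    and basis: "\<And>a s. a \<in> carrier G \<Longrightarrow> s \<in> S \<Longrightarrow> f (basis_vec K (\<alpha> a s)) = gact N a (f (basis_vec K s))"
  shows "f \<in> gmodule_homs K G (permutation_module K S \<alpha>) N"
proof (rule gmodule_homsI)
  show "f \<in> linear_maps K (permutation_module K S \<alpha>) N" using f by simp
  fix a x assume a: "a \<in> carrier G" and "x \<in> carrier (permutation_module K S \<alpha>)"
  then have x: "x \<in> carrier (free_module K S)" by simp
  let ?F = "free_module K S"
  have F: "module K ?F" by (rule free_module_module[OF assms(1)])
  let ?g = "linear_extension K ?F (\<lambda>s. basis_vec K (\<alpha> a s))"
  note b = basis_vec_closed[OF assms(1)]
  have g: "?g \<in> linear_maps K ?F ?F"
    by (rule linear_extension_linear[OF F]) (use a b[OF closed] in auto)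
  have bas: "?g (basis_vec K s) = basis_vec K (\<alpha> a s)" if "s \<in> S" for s
    by (rule linear_extension_basis_vec[OF F]) (use a that b[OF closed] in auto)
  have "f (?g x) = gact N a (f x)"
    by (rule linear_maps_eq_on_basis[OF group_module_module[OF N] linear_maps_compose[OF g f]
          linear_maps_compose[OF f gact_linear[OF N a]] _ x]) (use a basis bas in simp)
  then show "f (gact (permutation_module K S \<alpha>) a x) = gact N a (f x)" by simp
qed

section \<open>Tensor products over a group algebra\<close>

text \<open>
  The relations \<open>x . z \<otimes> y = x \<otimes> z . y\<close> identify two families of operators indexed by \<open>Z\<close>.  In the
  applications \<open>A\<close> is the coset module or its cohomology.
\<close>

locale balanced_pair = A: module K A + B: module K B
  for K :: "('k, 'a) ring_scheme" and Z :: "('z, 'b) monoid_scheme"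
    and A :: "('k, 'v, 'c) module_scheme" and r :: "'z \<Rightarrow> 'v \<Rightarrow> 'v" and B :: "('k, 'w, 'z) gmodule" +
  assumes right_closed: "z \<in> carrier Z \<Longrightarrow> x \<in> carrier A \<Longrightarrow> r z x \<in> carrier A"
    and left_closed: "z \<in> carrier Z \<Longrightarrow> y \<in> carrier B \<Longrightarrow> gact B z y \<in> carrier B"
begin

abbreviation "F \<equiv> free_module K (carrier A \<times> carrier B)"
abbreviation "rel \<equiv> tensor_relations K Z A r B"
abbreviation "tensor \<equiv> tensor_product K Z A r B"
abbreviation "pure \<equiv> pure_tensor K Z A r B"

lemma F_module: "module K F" by (rule free_module_module[OF A.is_cring])

lemma basis_F: "x \<in> carrier A \<Longrightarrow> y \<in> carrier B \<Longrightarrow> basis_vec K (x, y) \<in> carrier F"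
  by (rule basis_vec_closed[OF A.is_cring]) simp

text \<open>
  The relations whose span is divided out in \<open>tensor_relations\<close>, set apart so that they can be
  enumerated without unfolding the hull.
\<close>

definition generators where
  "generators = (let t = (\<lambda>x y. basis_vec K (x, y)) in
       ({t (x \<oplus>\<^bsub>A\<^esub> x') y \<ominus>\<^bsub>F\<^esub> (t x y \<oplus>\<^bsub>F\<^esub> t x' y) | x x' y.
            x \<in> carrier A \<and> x' \<in> carrier A \<and> y \<in> carrier B}
      \<union> {t x (y \<oplus>\<^bsub>B\<^esub> y') \<ominus>\<^bsub>F\<^esub> (t x y \<oplus>\<^bsub>F\<^esub> t x y') | x y y'.
            x \<in> carrier A \<and> y \<in> carrier B \<and> y' \<in> carrier B}
      \<union> {t (c \<odot>\<^bsub>A\<^esub> x) y \<ominus>\<^bsub>F\<^esub> (c \<odot>\<^bsub>F\<^esub> t x y) | c x y.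
            c \<in> carrier K \<and> x \<in> carrier A \<and> y \<in> carrier B}
      \<union> {t x (c \<odot>\<^bsub>B\<^esub> y) \<ominus>\<^bsub>F\<^esub> (c \<odot>\<^bsub>F\<^esub> t x y) | c x y.
            c \<in> carrier K \<and> x \<in> carrier A \<and> y \<in> carrier B}
      \<union> {t (r z x) y \<ominus>\<^bsub>F\<^esub> t x (gact B z y) | z x y.
            z \<in> carrier Z \<and> x \<in> carrier A \<and> y \<in> carrier B}))"

lemma rel_def: "rel = submodule_hull K F generators"
  by (simp only: tensor_relations_def generators_def Let_def)

lemma generators_closed: "generators \<subseteq> carrier F"
proof -
  interpret F: module K F by (rule F_module)
  show ?thesis
    unfolding generators_def Let_def
    using basis_F right_closed left_closed
    by (auto simp del: free_module_simps intro!: F.M.minus_closed F.M.a_closed F.smult_closed)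
qed

lemma rel_submodule: "submodule rel K F"
  unfolding rel_def by (rule submodule_hull_submodule[OF F_module generators_closed])

lemma tensor_module: "module K tensor"
  unfolding tensor_product_def by (rule quotient_module_module[OF F_module rel_submodule])

lemma pure_def: "pure x y = rel +>\<^bsub>F\<^esub> basis_vec K (x, y)"
  by (rule pure_tensor_def)

lemma tensor_map_linear: "(\<lambda>w. rel +>\<^bsub>F\<^esub> w) \<in> linear_maps K F tensor"
  unfolding tensor_product_def by (rule quotient_map_linear[OF F_module rel_submodule])

lemma pure_closed: "x \<in> carrier A \<Longrightarrow> y \<in> carrier B \<Longrightarrow> pure x y \<in> carrier tensor"
  unfolding pure_def by (rule linear_maps_closed[OF tensor_map_linear basis_F])

lemma coset_eqI:
  assumes "v \<ominus>\<^bsub>F\<^esub> w \<in> generators" "v \<in> carrier F" "w \<in> carrier F"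
  shows "rel +>\<^bsub>F\<^esub> v = rel +>\<^bsub>F\<^esub> w"
  using assms submodule_hull_incl[of generators K F]
  by (subst coset_eq_iff[OF F_module rel_submodule]) (auto simp: rel_def)

lemma
  assumes x: "x \<in> carrier A" and y: "y \<in> carrier B"
  shows pure_add_left: "x' \<in> carrier A \<Longrightarrow> pure (x \<oplus>\<^bsub>A\<^esub> x') y = pure x y \<oplus>\<^bsub>tensor\<^esub> pure x' y"
    and pure_add_right: "y' \<in> carrier B \<Longrightarrow> pure x (y \<oplus>\<^bsub>B\<^esub> y') = pure x y \<oplus>\<^bsub>tensor\<^esub> pure x y'"
    and pure_smult_left: "c \<in> carrier K \<Longrightarrow> pure (c \<odot>\<^bsub>A\<^esub> x) y = c \<odot>\<^bsub>tensor\<^esub> pure x y"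
    and pure_smult_right: "c \<in> carrier K \<Longrightarrow> pure x (c \<odot>\<^bsub>B\<^esub> y) = c \<odot>\<^bsub>tensor\<^esub> pure x y"
    and pure_balanced: "z \<in> carrier Z \<Longrightarrow> pure (r z x) y = pure x (gact B z y)"
proof -
  interpret F: module K F by (rule F_module)
  note [simp] = basis_F right_closed left_closed and [simp del] = free_module_simps
  note add = linear_maps_add[OF tensor_map_linear, symmetric] and smult = linear_maps_smult[OF tensor_map_linear, symmetric]
  show "pure (x \<oplus>\<^bsub>A\<^esub> x') y = pure x y \<oplus>\<^bsub>tensor\<^esub> pure x' y" if "x' \<in> carrier A"
    using that x y by (simp add: pure_def add) (rule coset_eqI, auto simp: generators_def Let_def)
  show "pure x (y \<oplus>\<^bsub>B\<^esub> y') = pure x y \<oplus>\<^bsub>tensor\<^esub> pure x y'" if "y' \<in> carrier B"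
    using that x y by (simp add: pure_def add) (rule coset_eqI, auto simp: generators_def Let_def)
  show "pure (c \<odot>\<^bsub>A\<^esub> x) y = c \<odot>\<^bsub>tensor\<^esub> pure x y" if "c \<in> carrier K"
    using that x y by (simp add: pure_def smult) (rule coset_eqI, auto simp: generators_def Let_def)
  show "pure x (c \<odot>\<^bsub>B\<^esub> y) = c \<odot>\<^bsub>tensor\<^esub> pure x y" if "c \<in> carrier K"
    using that x y by (simp add: pure_def smult) (rule coset_eqI, auto simp: generators_def Let_def)
  show "pure (r z x) y = pure x (gact B z y)" if "z \<in> carrier Z"
    using that x y unfolding pure_def by (intro coset_eqI) (auto simp: generators_def Let_def)
qed

lemma pure_linear_left: "y \<in> carrier B \<Longrightarrow> (\<lambda>x. pure x y) \<in> linear_maps K A tensor"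
  by (rule linear_mapsI) (auto simp: pure_closed pure_add_left pure_smult_left)

lemma pure_linear_right: "x \<in> carrier A \<Longrightarrow> pure x \<in> linear_maps K B tensor"
  by (rule linear_mapsI) (auto simp: pure_closed pure_add_right pure_smult_right)

lemma tensor_induct [consumes 1, case_names pure add]:
  assumes \<tau>: "\<tau> \<in> carrier tensor"
    and pure: "\<And>x y. x \<in> carrier A \<Longrightarrow> y \<in> carrier B \<Longrightarrow> P (pure x y)"
    and add: "\<And>\<sigma> \<tau>. \<sigma> \<in> carrier tensor \<Longrightarrow> \<tau> \<in> carrier tensor \<Longrightarrow> P \<sigma> \<Longrightarrow> P \<tau> \<Longrightarrow> P (\<sigma> \<oplus>\<^bsub>tensor\<^esub> \<tau>)"
  shows "P \<tau>"
proof -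
  interpret T: module K tensor by (rule tensor_module)
  interpret F: module K F by (rule F_module)
  obtain w where w: "w \<in> carrier F" "\<tau> = rel +>\<^bsub>F\<^esub> w"
    using \<tau> unfolding tensor_product_def quotient_module_carrier by blast
  have "P (rel +>\<^bsub>F\<^esub> w)"
    using A.is_cring w(1)
  proof (induction rule: free_module_induct)
    case zero
    have "pure \<zero>\<^bsub>A\<^esub> \<zero>\<^bsub>B\<^esub> = \<zero>\<^bsub>tensor\<^esub>"
      using linear_maps_zero[OF A.module_axioms tensor_module pure_linear_left[of "\<zero>\<^bsub>B\<^esub>"]] by simp
    moreover have "rel +>\<^bsub>F\<^esub> \<zero>\<^bsub>F\<^esub> = \<zero>\<^bsub>tensor\<^esub>"
      by (rule linear_maps_zero[OF F_module tensor_module tensor_map_linear])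
    ultimately show ?case using pure[of "\<zero>\<^bsub>A\<^esub>" "\<zero>\<^bsub>B\<^esub>"] by simp
  next
    case (add c s w)
    obtain x y where s: "s = (x, y)" "x \<in> carrier A" "y \<in> carrier B" using add(2) by auto
    have "rel +>\<^bsub>F\<^esub> (c \<odot>\<^bsub>F\<^esub> basis_vec K s \<oplus>\<^bsub>F\<^esub> w) = pure (c \<odot>\<^bsub>A\<^esub> x) y \<oplus>\<^bsub>tensor\<^esub> (rel +>\<^bsub>F\<^esub> w)"
      using add s basis_F[OF s(2,3)]
      by (simp add: linear_maps_add[OF tensor_map_linear] linear_maps_smult[OF tensor_map_linear]
          pure_smult_left pure_def[symmetric] del: free_module_simps)
    then show ?case
      using add s assms(3)[OF pure_closed linear_maps_closed[OF tensor_map_linear]] pure by simp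
  qed
  with w show ?thesis by simp
qed

end

lemma linear_extension_pairs_linear:
  assumes "module K M" "\<And>x y. x \<in> X' \<Longrightarrow> y \<in> Y' \<Longrightarrow> \<beta> x y \<in> carrier M"
  shows "linear_extension K M (\<lambda>(x, y). \<beta> x y) \<in> linear_maps K (free_module K (X' \<times> Y')) M"
  by (rule linear_extension_linear[OF assms(1)]) (use assms(2) in auto)

locale balanced_map = balanced_pair K Z A r B + Y: module K Y
  for K :: "('k, 'a) ring_scheme" and Z :: "('z, 'b) monoid_scheme"
    and A :: "('k, 'v, 'c) module_scheme" and r :: "'z \<Rightarrow> 'v \<Rightarrow> 'v" and B :: "('k, 'w, 'z) gmodule"
    and Y :: "('k, 'y, 'd) module_scheme" +
  fixes \<beta> :: "'v \<Rightarrow> 'w \<Rightarrow> 'y"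
  assumes linear_left: "y \<in> carrier B \<Longrightarrow> (\<lambda>x. \<beta> x y) \<in> linear_maps K A Y"
    and linear_right: "x \<in> carrier A \<Longrightarrow> \<beta> x \<in> linear_maps K B Y"
    and balanced: "z \<in> carrier Z \<Longrightarrow> x \<in> carrier A \<Longrightarrow> y \<in> carrier B \<Longrightarrow> \<beta> (r z x) y = \<beta> x (gact B z y)"
begin

abbreviation "ext \<equiv> linear_extension K Y (\<lambda>(x, y). \<beta> x y)"

lemma \<beta>_closed: "x \<in> carrier A \<Longrightarrow> y \<in> carrier B \<Longrightarrow> \<beta> x y \<in> carrier Y"
  by (rule linear_maps_closed[OF linear_right])

lemma ext_linear: "ext \<in> linear_maps K F Y"
  by (rule linear_extension_pairs_linear[OF Y.module_axioms \<beta>_closed])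

lemma ext_basis: "x \<in> carrier A \<Longrightarrow> y \<in> carrier B \<Longrightarrow> ext (basis_vec K (x, y)) = \<beta> x y"
  by (subst linear_extension_basis_vec[OF Y.module_axioms]) (auto simp: \<beta>_closed)

text \<open>
  Bilinearity and balancedness of \<open>\<beta>\<close> say exactly that \<open>ext\<close> vanishes on the generating relations, and
  its kernel is a submodule.
\<close>

lemma ext_rel: "w \<in> rel \<Longrightarrow> ext w = \<zero>\<^bsub>Y\<^esub>"
proof -
  interpret F: module K F by (rule F_module)
  note e = ext_basis linear_maps_minus[OF F_module Y.module_axioms ext_linear] linear_maps_add[OF ext_linear]
    linear_maps_smult[OF ext_linear] basis_F
  have 0: "\<And>y. y \<in> carrier Y \<Longrightarrow> y \<ominus>\<^bsub>Y\<^esub> y = \<zero>\<^bsub>Y\<^esub>" by (simp add: a_minus_def Y.M.r_neg)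
  have "generators \<subseteq> {w \<in> carrier F. ext w = \<zero>\<^bsub>Y\<^esub>}"
    using generators_closed unfolding generators_def Let_def
    by (auto simp: e \<beta>_closed right_closed left_closed balanced 0 linear_maps_add[OF linear_left]
        linear_maps_add[OF linear_right] linear_maps_smult[OF linear_left] linear_maps_smult[OF linear_right]
        simp del: free_module_simps)
  then have "rel \<subseteq> {w \<in> carrier F. ext w = \<zero>\<^bsub>Y\<^esub>}"
    unfolding rel_def
    by (rule submodule_hull_least[OF linear_maps_kernel_submodule[OF F_module Y.module_axioms ext_linear]])
  then show "w \<in> rel \<Longrightarrow> ext w = \<zero>\<^bsub>Y\<^esub>" by auto
qed

lemma tensor_lift:
  obtains \<Psi> where "\<Psi> \<in> linear_maps K tensor Y"
    "\<And>w. w \<in> carrier F \<Longrightarrow> \<Psi> (rel +>\<^bsub>F\<^esub> w) = ext w"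
    "\<And>x y. x \<in> carrier A \<Longrightarrow> y \<in> carrier B \<Longrightarrow> \<Psi> (pure x y) = \<beta> x y"
proof -
  from quotient_module_lift[OF F_module rel_submodule Y.module_axioms ext_linear ext_rel]
  obtain \<Psi> where \<Psi>: "\<Psi> \<in> linear_maps K tensor Y" "\<And>w. w \<in> carrier F \<Longrightarrow> \<Psi> (rel +>\<^bsub>F\<^esub> w) = ext w"
    unfolding tensor_product_def by blast
  have "\<Psi> (pure x y) = \<beta> x y" if "x \<in> carrier A" "y \<in> carrier B" for x y
    using that by (simp add: pure_def \<Psi>(2) basis_F ext_basis)
  with \<Psi> that show ?thesis by blast
qed

end

text \<open>
  The situation in which the induced map is recognised as an isomorphism.  \<open>B\<close> is spanned by vectors
  \<open>e s\<close>, and the operators of \<open>Z\<close> carry those with \<open>s \<in> T\<close> to all the others; hence every tensor is a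
  sum of terms \<open>x\<^sub>t \<otimes> e t\<close> with \<open>t \<in> T\<close>.  The maps \<open>p t\<close> read off \<open>x\<^sub>t\<close> from the image in \<open>Y\<close>.
  Surjectivity is expressed by the condition that no proper submodule of \<open>Y\<close> contains all
  \<open>\<beta> x (e t)\<close>.
\<close>

locale balanced_map_projections = balanced_map K Z A r B Y \<beta>
  for K :: "('k, 'a) ring_scheme" and Z :: "('z, 'b) monoid_scheme"
    and A :: "('k, 'v, 'c) module_scheme" and r :: "'z \<Rightarrow> 'v \<Rightarrow> 'v" and B :: "('k, 'w, 'z) gmodule"
    and Y :: "('k, 'y, 'd) module_scheme" and \<beta> :: "'v \<Rightarrow> 'w \<Rightarrow> 'y" +
  fixes S T :: "'s set" and e :: "'s \<Rightarrow> 'w" and p :: "'s \<Rightarrow> 'y \<Rightarrow> 'v"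
  assumes B_span: "\<And>L. submodule L K B \<Longrightarrow> (\<And>s. s \<in> S \<Longrightarrow> e s \<in> L) \<Longrightarrow> carrier B \<subseteq> L"
    and B_basis: "s \<in> S \<Longrightarrow> e s \<in> carrier B"
    and T_subset: "T \<subseteq> S"
    and T_represents: "s \<in> S \<Longrightarrow> \<exists>z\<in>carrier Z. \<exists>t\<in>T. e s = gact B z (e t)"
    and p_linear: "t \<in> T \<Longrightarrow> p t \<in> linear_maps K Y A"
    and p_\<beta>: "t \<in> T \<Longrightarrow> s \<in> T \<Longrightarrow> x \<in> carrier A \<Longrightarrow> p t (\<beta> x (e s)) = (if s = t then x else \<zero>\<^bsub>A\<^esub>)"
    and Y_span: "\<And>L. submodule L K Y \<Longrightarrow> (\<And>x t. x \<in> carrier A \<Longrightarrow> t \<in> T \<Longrightarrow> \<beta> x (e t) \<in> L) \<Longrightarrow> carrier Y \<subseteq> L"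
begin

text \<open>
  The coordinates of \<open>\<tau>\<close> are written as \<open>p t (\<Psi> \<tau>)\<close>, so that both sides of the claim are linear in \<open>\<tau>\<close>
  and it passes from pure tensors to sums.  The claim is made for all finite sets beyond some \<open>D\<close>, since
  two tensors then have a common index set.
\<close>

lemma tensor_coordinates:
  assumes \<Psi>: "\<Psi> \<in> linear_maps K tensor Y"
      "\<And>x y. x \<in> carrier A \<Longrightarrow> y \<in> carrier B \<Longrightarrow> \<Psi> (pure x y) = \<beta> x y"
    and \<tau>: "\<tau> \<in> carrier tensor"
  shows "\<exists>D. finite D \<and> D \<subseteq> T \<and> (\<forall>D'. finite D' \<longrightarrow> D \<subseteq> D' \<longrightarrow> D' \<subseteq> T \<longrightarrow>
    \<tau> = (\<Oplus>\<^bsub>tensor\<^esub>t\<in>D'. pure (p t (\<Psi> \<tau>)) (e t)))"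
proof -
  interpret T: module K tensor by (rule tensor_module)
  define good where "good \<tau> \<longleftrightarrow> (\<exists>D. finite D \<and> D \<subseteq> T \<and> (\<forall>D'. finite D' \<longrightarrow> D \<subseteq> D' \<longrightarrow> D' \<subseteq> T \<longrightarrow>
    \<tau> = (\<Oplus>\<^bsub>tensor\<^esub>t\<in>D'. pure (p t (\<Psi> \<tau>)) (e t))))" for \<tau>
  define c where "c = (\<lambda>t \<tau>. pure (p t (\<Psi> \<tau>)) (e t))"
  have e: "e t \<in> carrier B" if "t \<in> T" for t using T_subset B_basis that by auto
  have c: "c t \<in> linear_maps K tensor tensor" if "t \<in> T" for t
    unfolding c_def
    by (rule linear_maps_compose[OF linear_maps_compose[OF \<Psi>(1) p_linear[OF that]] pure_linear_left[OF e[OF that]]])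
  have good_add: "good (\<sigma> \<oplus>\<^bsub>tensor\<^esub> \<tau>)"
    if \<sigma>: "\<sigma> \<in> carrier tensor" and \<tau>: "\<tau> \<in> carrier tensor" and g: "good \<sigma>" "good \<tau>" for \<sigma> \<tau>
  proof -
    obtain D where D: "finite D" "D \<subseteq> T" "\<And>D'. finite D' \<Longrightarrow> D \<subseteq> D' \<Longrightarrow> D' \<subseteq> T \<Longrightarrow> \<sigma> = (\<Oplus>\<^bsub>tensor\<^esub>t\<in>D'. c t \<sigma>)"
      using g(1) unfolding good_def c_def by blast
    obtain E where E: "finite E" "E \<subseteq> T" "\<And>D'. finite D' \<Longrightarrow> E \<subseteq> D' \<Longrightarrow> D' \<subseteq> T \<Longrightarrow> \<tau> = (\<Oplus>\<^bsub>tensor\<^esub>t\<in>D'. c t \<tau>)"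
      using g(2) unfolding good_def c_def by blast
    have "\<sigma> \<oplus>\<^bsub>tensor\<^esub> \<tau> = (\<Oplus>\<^bsub>tensor\<^esub>t\<in>D'. c t (\<sigma> \<oplus>\<^bsub>tensor\<^esub> \<tau>))"
      if D': "finite D'" "D \<union> E \<subseteq> D'" "D' \<subseteq> T" for D'
    proof -
      have "(\<Oplus>\<^bsub>tensor\<^esub>t\<in>D'. c t (\<sigma> \<oplus>\<^bsub>tensor\<^esub> \<tau>)) = (\<Oplus>\<^bsub>tensor\<^esub>t\<in>D'. c t \<sigma> \<oplus>\<^bsub>tensor\<^esub> c t \<tau>)"
        by (rule T.M.finsum_cong')
          (use D' \<sigma> \<tau> linear_maps_add[OF c] linear_maps_closed[OF c] in \<open>auto simp: subset_iff\<close>)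
      also have "\<dots> = (\<Oplus>\<^bsub>tensor\<^esub>t\<in>D'. c t \<sigma>) \<oplus>\<^bsub>tensor\<^esub> (\<Oplus>\<^bsub>tensor\<^esub>t\<in>D'. c t \<tau>)"
        by (rule T.M.finsum_addf) (use D' \<sigma> \<tau> linear_maps_closed[OF c] in auto)
      finally show ?thesis using D(3)[of D'] E(3)[of D'] D' by simp
    qed
    then show ?thesis
      unfolding good_def c_def[symmetric] using D(1,2) E(1,2) by (intro exI[of _ "D \<union> E"]) (simp add: c_def)
  qed
  have good_zero: "good \<zero>\<^bsub>tensor\<^esub>"
  proof -
    have "c t \<zero>\<^bsub>tensor\<^esub> = \<zero>\<^bsub>tensor\<^esub>" if "t \<in> T" for t
      by (rule linear_maps_zero[OF tensor_module tensor_module c[OF that]])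
    then have "(\<Oplus>\<^bsub>tensor\<^esub>t\<in>D'. c t \<zero>\<^bsub>tensor\<^esub>) = \<zero>\<^bsub>tensor\<^esub>" if "D' \<subseteq> T" for D'
      using that by (intro T.M.add.finprod_one_eqI) auto
    then show ?thesis unfolding good_def by (intro exI[of _ "{}"]) (simp add: c_def)
  qed
  have good_T: "good (pure x (e s))" if x: "x \<in> carrier A" and s: "s \<in> T" for x s
  proof -
    have "pure x (e s) = (\<Oplus>\<^bsub>tensor\<^esub>t\<in>D'. c t (pure x (e s)))"
      if D': "finite D'" "{s} \<subseteq> D'" "D' \<subseteq> T" for D'
    proof -
      have z: "pure \<zero>\<^bsub>A\<^esub> (e t) = \<zero>\<^bsub>tensor\<^esub>" if "t \<in> T" for t
        by (rule linear_maps_zero[OF A.module_axioms tensor_module pure_linear_left[OF e[OF that]]])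
      have "c t (pure x (e s)) = (if s = t then pure x (e t) else \<zero>\<^bsub>tensor\<^esub>)" if "t \<in> D'" for t
        using that D' x s e by (auto simp: c_def \<Psi>(2) p_\<beta> z subset_iff)
      then have "(\<Oplus>\<^bsub>tensor\<^esub>t\<in>D'. c t (pure x (e s)))
          = (\<Oplus>\<^bsub>tensor\<^esub>t\<in>D'. if s = t then pure x (e t) else \<zero>\<^bsub>tensor\<^esub>)"
        using D' x e by (intro T.M.finsum_cong') (auto simp: pure_closed subset_iff)
      also have "\<dots> = pure x (e s)"
        by (rule T.M.finsum_singleton) (use D' x e in \<open>auto simp: pure_closed subset_iff\<close>)
      finally show ?thesis by simp
    qed
    then show ?thesis unfolding good_def using s by (intro exI[of _ "{s}"]) (simp add: c_def)
  qed
  have good_smult: "good (k \<odot>\<^bsub>tensor\<^esub> \<tau>)" if k: "k \<in> carrier K" and \<tau>: "\<tau> \<in> carrier tensor" "good \<tau>" for k \<tau>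
  proof -
    obtain D where D: "finite D" "D \<subseteq> T" "\<And>D'. finite D' \<Longrightarrow> D \<subseteq> D' \<Longrightarrow> D' \<subseteq> T \<Longrightarrow> \<tau> = (\<Oplus>\<^bsub>tensor\<^esub>t\<in>D'. c t \<tau>)"
      using \<tau>(2) unfolding good_def c_def by blast
    have "k \<odot>\<^bsub>tensor\<^esub> \<tau> = (\<Oplus>\<^bsub>tensor\<^esub>t\<in>D'. c t (k \<odot>\<^bsub>tensor\<^esub> \<tau>))"
      if D': "finite D'" "D \<subseteq> D'" "D' \<subseteq> T" for D'
    proof -
      have "(\<Oplus>\<^bsub>tensor\<^esub>t\<in>D'. c t (k \<odot>\<^bsub>tensor\<^esub> \<tau>)) = (\<Oplus>\<^bsub>tensor\<^esub>t\<in>D'. k \<odot>\<^bsub>tensor\<^esub> c t \<tau>)"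
        by (rule T.M.finsum_cong')
          (use D' \<tau> k linear_maps_smult[OF c] linear_maps_closed[OF c] in \<open>auto simp: subset_iff\<close>)
      also have "\<dots> = k \<odot>\<^bsub>tensor\<^esub> (\<Oplus>\<^bsub>tensor\<^esub>t\<in>D'. c t \<tau>)"
        by (rule T.finsum_smult_ldistr[symmetric, OF D'(1) k]) (use D' \<tau> linear_maps_closed[OF c] in auto)
      finally show ?thesis using D(3)[of D'] D' by simp
    qed
    then show ?thesis
      unfolding good_def using D(1,2) by (intro exI[of _ D]) (simp add: c_def)
  qed
  have good_submodule: "submodule {\<tau> \<in> carrier tensor. good \<tau>} K tensor"
  proof (rule T.submoduleI)
    fix a assume "a \<in> {\<tau> \<in> carrier tensor. good \<tau>}"
    moreover from this have "\<ominus>\<^bsub>tensor\<^esub> a = (\<ominus>\<^bsub>K\<^esub> \<one>\<^bsub>K\<^esub>) \<odot>\<^bsub>tensor\<^esub> a" by (simp add: T.smult_l_minus)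
    ultimately show "\<ominus>\<^bsub>tensor\<^esub> a \<in> {\<tau> \<in> carrier tensor. good \<tau>}" using good_smult by simp
  qed (auto simp: good_zero good_add good_smult)
  \<comment> \<open>Here the balancing relation moves the operator of \<open>Z\<close> from the right factor to the left one.\<close>
  have good_S: "good (pure x (e s))" if x: "x \<in> carrier A" and s: "s \<in> S" for x s
  proof -
    obtain z t where "z \<in> carrier Z" "t \<in> T" "e s = gact B z (e t)" using T_represents[OF s] by blast
    then show ?thesis
      using x good_T[OF right_closed] pure_balanced e by metis
  qed
  have good_pure: "good (pure x y)" if x: "x \<in> carrier A" and y: "y \<in> carrier B" for x y
  proof -
    let ?L = "{y \<in> carrier B. pure x y \<in> {\<tau> \<in> carrier tensor. good \<tau>}}"
    have "submodule ?L K B"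
      by (rule linear_maps_preimage_submodule[OF B.module_axioms tensor_module pure_linear_right[OF x] good_submodule])
    moreover have "e s \<in> ?L" if "s \<in> S" for s using good_S[OF x that] B_basis[OF that] pure_closed[OF x] by simp
    ultimately have "carrier B \<subseteq> ?L" by (rule B_span)
    then show ?thesis using y by auto
  qed
  have "good \<tau>" using \<tau>
  proof (induction rule: tensor_induct)
    case (pure x y)
    then show ?case by (rule good_pure)
  next
    case (add \<sigma> \<tau>)
    then show ?case by (rule good_add)
  qed
  then show ?thesis unfolding good_def .
qed

text \<open>
  A tensor with image \<open>0\<close> has all its coordinates \<open>p t 0 = 0\<close>; surjectivity holds because the image is a
  submodule.
\<close>

lemma lift_is_iso:
  assumes \<Psi>: "\<Psi> \<in> linear_maps K tensor Y"
      "\<And>x y. x \<in> carrier A \<Longrightarrow> y \<in> carrier B \<Longrightarrow> \<Psi> (pure x y) = \<beta> x y"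
  shows "\<Psi> \<in> linear_isos K tensor Y"
proof -
  interpret T: module K tensor by (rule tensor_module)
  have ker: "\<tau> = \<zero>\<^bsub>tensor\<^esub>" if \<tau>: "\<tau> \<in> carrier tensor" "\<Psi> \<tau> = \<zero>\<^bsub>Y\<^esub>" for \<tau>
  proof -
    from tensor_coordinates[OF \<Psi> \<tau>(1)]
    obtain D where "finite D \<and> D \<subseteq> T \<and> (\<forall>D'. finite D' \<longrightarrow> D \<subseteq> D' \<longrightarrow> D' \<subseteq> T \<longrightarrow>
        \<tau> = (\<Oplus>\<^bsub>tensor\<^esub>t\<in>D'. pure (p t (\<Psi> \<tau>)) (e t)))" by (rule exE)
    then have D: "D \<subseteq> T" "\<tau> = (\<Oplus>\<^bsub>tensor\<^esub>t\<in>D. pure (p t (\<Psi> \<tau>)) (e t))" by auto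
    have "pure (p t (\<Psi> \<tau>)) (e t) = \<zero>\<^bsub>tensor\<^esub>" if t: "t \<in> D" for t
    proof -
      have "t \<in> T" "e t \<in> carrier B" using t D(1) T_subset B_basis by auto
      then show ?thesis
        using \<tau>(2) linear_maps_zero[OF Y.module_axioms A.module_axioms p_linear]
          linear_maps_zero[OF A.module_axioms tensor_module pure_linear_left] by simp
    qed
    then have "(\<Oplus>\<^bsub>tensor\<^esub>t\<in>D. pure (p t (\<Psi> \<tau>)) (e t)) = \<zero>\<^bsub>tensor\<^esub>"
      by (intro T.M.add.finprod_one_eqI)
    with D(2) show ?thesis by simp
  qed
  have "inj_on \<Psi> (carrier tensor)"
  proof (rule inj_onI)
    fix \<sigma> \<tau> assume *: "\<sigma> \<in> carrier tensor" "\<tau> \<in> carrier tensor" "\<Psi> \<sigma> = \<Psi> \<tau>"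
    then have "\<Psi> (\<sigma> \<ominus>\<^bsub>tensor\<^esub> \<tau>) = \<zero>\<^bsub>Y\<^esub>"
      using linear_maps_closed[OF \<Psi>(1)]
      by (simp add: linear_maps_minus[OF tensor_module Y.module_axioms \<Psi>(1)] Y.M.minus_eq Y.M.r_neg)
    then have "\<sigma> \<ominus>\<^bsub>tensor\<^esub> \<tau> = \<zero>\<^bsub>tensor\<^esub>" using ker * T.M.minus_closed by blast
    then show "\<sigma> = \<tau>" using * T.M.add.inv_solve_right' by (metis T.M.minus_eq T.M.l_zero T.M.zero_closed)
  qed
  moreover have "carrier Y \<subseteq> \<Psi> ` carrier tensor"
  proof (rule Y_span)
    show "submodule (\<Psi> ` carrier tensor) K Y"
      by (rule linear_maps_image_submodule[OF tensor_module Y.module_axioms \<Psi>(1) T.carrier_is_submodule])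
    fix x t assume "x \<in> carrier A" "t \<in> T"
    then have "\<beta> x (e t) = \<Psi> (pure x (e t))" "pure x (e t) \<in> carrier tensor"
      using \<Psi>(2) T_subset B_basis pure_closed by (auto simp: subset_iff)
    then show "\<beta> x (e t) \<in> \<Psi> ` carrier tensor" by blast
  qed
  moreover have "\<Psi> ` carrier tensor \<subseteq> carrier Y" using linear_maps_closed[OF \<Psi>(1)] by auto
  ultimately show ?thesis using \<Psi>(1) by (auto simp: linear_isos_def bij_betw_def)
qed

end

section \<open>Functoriality of Ext\<close>

lemma gmodule_homs_restrict:
  assumes "group_module K G P" "f \<in> gmodule_homs K G P M"
  shows "restrict f (carrier P) \<in> gmodule_homs K G P M"
proof -
  interpret P: module K P by (rule group_module_module[OF assms(1)])
  note f = gmodule_homsD[OF assms(2)]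
  show ?thesis
    by (rule gmodule_homsI[OF linear_mapsI])
      (use linear_mapsD[OF f(1)] f(2) gact_closed[OF assms(1)] in auto)
qed

lemma gmodule_homs_add:
  fixes M (structure)
  assumes M: "group_module K G M" and f: "f \<in> gmodule_homs K G P M" "h \<in> gmodule_homs K G P M"
  shows "(\<lambda>x. f x \<oplus> h x) \<in> gmodule_homs K G P M"
proof -
  interpret M: module K M by (rule group_module_module[OF M])
  note f' = gmodule_homsD[OF f(1)] and h' = gmodule_homsD[OF f(2)]
  show ?thesis
    by (rule gmodule_homsI[OF linear_mapsI])
      (auto simp: linear_mapsD[OF f'(1)] linear_mapsD[OF h'(1)] f'(2) h'(2) gact_add[OF M] M.M.a_ac M.smult_r_distr)
qed

lemma gmodule_homs_smult:
  fixes M (structure)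
  assumes M: "group_module K G M" and f: "f \<in> gmodule_homs K G P M" and c: "c \<in> carrier K"
  shows "(\<lambda>x. c \<odot> f x) \<in> gmodule_homs K G P M"
proof -
  interpret M: module K M by (rule group_module_module[OF M])
  note f' = gmodule_homsD[OF f]
  show ?thesis
    using c by (intro gmodule_homsI[OF linear_mapsI])
      (auto simp: linear_mapsD[OF f'(1)] f'(2) gact_smult[OF M] M.smult_r_distr M.smult_assoc1[symmetric] M.R.m_comm)
qed

lemma gmodule_homs_zero:
  fixes M (structure)
  assumes M: "group_module K G M"
  shows "(\<lambda>_. \<zero>) \<in> gmodule_homs K G P M"
proof -
  interpret M: module K M by (rule group_module_module[OF M])
  have "gact M a \<zero> = \<zero>" if "a \<in> carrier G" for a
    using linear_maps_zero[OF M.module_axioms M.module_axioms gact_linear[OF M that]] .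
  then show ?thesis by (intro gmodule_homsI[OF linear_mapsI]) auto
qed

lemma gmodule_homs_id: "(\<lambda>x. x) \<in> gmodule_homs K G M M"
  by (auto simp: gmodule_homs_def linear_maps_def)

lemma gmodule_homs_diff:
  fixes M (structure)
  assumes M: "group_module K G M" and f: "f \<in> gmodule_homs K G P M" "h \<in> gmodule_homs K G P M"
  shows "(\<lambda>x. f x \<ominus> h x) \<in> gmodule_homs K G P M"
proof -
  interpret M: module K M by (rule group_module_module[OF M])
  note f' = gmodule_homsD[OF f(1)] and h' = gmodule_homsD[OF f(2)]
  have "gact M a (x \<ominus> y) = gact M a x \<ominus> gact M a y"
    if "a \<in> carrier G" "x \<in> carrier M" "y \<in> carrier M" for a x y
    using linear_maps_minus[OF M.module_axioms M.module_axioms gact_linear[OF M that(1)] that(2,3)] .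
  then show ?thesis
    by (intro gmodule_homsI[OF linear_mapsI])
      (auto simp: linear_mapsD[OF f'(1)] linear_mapsD[OF h'(1)] f'(2) h'(2) a_minus_def M.M.a_ac
        M.M.minus_add M.smult_r_distr M.smult_r_minus)
qed

lemma hom_module_carrier:
  "f \<in> carrier (hom_module K G P M) \<longleftrightarrow> f \<in> gmodule_homs K G P M \<and> f \<in> extensional (carrier P)"
  by (simp add: hom_module_def)

lemma hom_module_simps:
  "zero (hom_module K G P M) = (\<lambda>x \<in> carrier P. \<zero>\<^bsub>M\<^esub>)"
  "add (hom_module K G P M) = (\<lambda>f h. \<lambda>x \<in> carrier P. f x \<oplus>\<^bsub>M\<^esub> h x)"
  "smult (hom_module K G P M) = (\<lambda>c f. \<lambda>x \<in> carrier P. c \<odot>\<^bsub>M\<^esub> f x)"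
  by (simp_all add: hom_module_def)

lemma hom_module_restrict:
  assumes "group_module K G P" "f \<in> gmodule_homs K G P M"
  shows "restrict f (carrier P) \<in> carrier (hom_module K G P M)"
  using gmodule_homs_restrict[OF assms] by (simp add: hom_module_carrier)

lemma hom_module_closed:
  "f \<in> carrier (hom_module K G P M) \<Longrightarrow> x \<in> carrier P \<Longrightarrow> f x \<in> carrier M"
  by (simp add: hom_module_carrier gmodule_homs_def linear_maps_def Pi_iff)

lemma hom_module_eqI:
  assumes "f \<in> carrier (hom_module K G P M)" "h \<in> carrier (hom_module K G P M)"
    and "\<And>x. x \<in> carrier P \<Longrightarrow> f x = h x"
  shows "f = h"
  using assms by (auto simp: hom_module_carrier intro: extensionalityI)

lemma hom_module_module:
  fixes M (structure)
  assumes P: "group_module K G P" and M: "group_module K G M"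
  shows "module K (hom_module K G P M)"
proof -
  interpret M: module K M by (rule group_module_module[OF M])
  let ?H = "hom_module K G P M"
  have hom: "f \<in> gmodule_homs K G P M" if "f \<in> carrier ?H" for f using that by (simp add: hom_module_carrier)
  note c = hom_module_restrict[OF P]
  note v = hom_module_closed[of _ K G P M]
  have r: "x \<notin> carrier P \<Longrightarrow> f x = undefined" if "f \<in> carrier ?H" for f x
    using extensional_arb[of f "carrier P"] that by (auto simp: hom_module_carrier)
  show ?thesis
  proof (rule moduleI[OF M.is_cring abelian_groupI])
    show "\<zero>\<^bsub>?H\<^esub> \<in> carrier ?H" unfolding hom_module_simps by (rule c[OF gmodule_homs_zero[OF M]])
  next
    fix f assume f: "f \<in> carrier ?H"
    show "\<exists>h\<in>carrier ?H. h \<oplus>\<^bsub>?H\<^esub> f = \<zero>\<^bsub>?H\<^esub>"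
    proof
      show "(\<lambda>x\<in>carrier P. (\<ominus>\<^bsub>K\<^esub> \<one>\<^bsub>K\<^esub>) \<odot> f x) \<in> carrier ?H"
        by (rule c[OF gmodule_homs_smult[OF M hom[OF f]]]) simp
      show "(\<lambda>x\<in>carrier P. (\<ominus>\<^bsub>K\<^esub> \<one>\<^bsub>K\<^esub>) \<odot> f x) \<oplus>\<^bsub>?H\<^esub> f = \<zero>\<^bsub>?H\<^esub>"
        using v[OF f] by (auto simp: hom_module_simps M.smult_l_minus M.M.l_neg intro!: restrict_ext)
    qed
    show "\<zero>\<^bsub>?H\<^esub> \<oplus>\<^bsub>?H\<^esub> f = f"
      using v[OF f] r[OF f] by (auto simp: hom_module_simps fun_eq_iff)
    show "\<one>\<^bsub>K\<^esub> \<odot>\<^bsub>?H\<^esub> f = f"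
      using v[OF f] r[OF f] by (auto simp: hom_module_simps fun_eq_iff)
    { fix h assume h: "h \<in> carrier ?H"
      show "f \<oplus>\<^bsub>?H\<^esub> h \<in> carrier ?H"
        unfolding hom_module_simps by (rule c[OF gmodule_homs_add[OF M hom[OF f] hom[OF h]]])
      show "f \<oplus>\<^bsub>?H\<^esub> h = h \<oplus>\<^bsub>?H\<^esub> f"
        using v[OF f] v[OF h] by (auto simp: hom_module_simps M.M.a_comm intro!: restrict_ext)
      { fix k assume k: "k \<in> carrier ?H"
        show "f \<oplus>\<^bsub>?H\<^esub> h \<oplus>\<^bsub>?H\<^esub> k = f \<oplus>\<^bsub>?H\<^esub> (h \<oplus>\<^bsub>?H\<^esub> k)"
          using v[OF f] v[OF h] v[OF k] by (auto simp: hom_module_simps M.M.a_assoc intro!: restrict_ext) }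
      fix a assume a: "a \<in> carrier K"
      show "a \<odot>\<^bsub>?H\<^esub> (f \<oplus>\<^bsub>?H\<^esub> h) = a \<odot>\<^bsub>?H\<^esub> f \<oplus>\<^bsub>?H\<^esub> a \<odot>\<^bsub>?H\<^esub> h"
        using v[OF f] v[OF h] a by (auto simp: hom_module_simps M.smult_r_distr intro!: restrict_ext) }
    fix a assume a: "a \<in> carrier K"
    show "a \<odot>\<^bsub>?H\<^esub> f \<in> carrier ?H"
      unfolding hom_module_simps by (rule c[OF gmodule_homs_smult[OF M hom[OF f] a]])
    fix b assume b: "b \<in> carrier K"
    show "(a \<oplus>\<^bsub>K\<^esub> b) \<odot>\<^bsub>?H\<^esub> f = a \<odot>\<^bsub>?H\<^esub> f \<oplus>\<^bsub>?H\<^esub> b \<odot>\<^bsub>?H\<^esub> f"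
      using v[OF f] a b by (auto simp: hom_module_simps M.smult_l_distr intro!: restrict_ext)
    show "a \<otimes>\<^bsub>K\<^esub> b \<odot>\<^bsub>?H\<^esub> f = a \<odot>\<^bsub>?H\<^esub> (b \<odot>\<^bsub>?H\<^esub> f)"
      using v[OF f] a b by (auto simp: hom_module_simps M.smult_assoc1 intro!: restrict_ext)
  qed
qed

lemma hom_module_minus_apply:
  fixes M (structure)
  assumes P: "group_module K G P" and M: "group_module K G M"
    and "f \<in> carrier (hom_module K G P M)" "h \<in> carrier (hom_module K G P M)" "x \<in> carrier P"
  shows "(f \<ominus>\<^bsub>hom_module K G P M\<^esub> h) x = f x \<ominus> h x"
proof -
  interpret H: module K "hom_module K G P M" by (rule hom_module_module[OF P M])
  interpret M: module K M by (rule group_module_module[OF M])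
  have "(\<lambda>f. f x) \<in> linear_maps K (hom_module K G P M) M"
    using assms(5) by (intro linear_mapsI) (auto simp: hom_module_simps hom_module_closed)
  from linear_maps_minus[OF H.module_axioms M.module_axioms this assms(3,4)] show ?thesis .
qed

lemma pre_compose_linear:
  assumes P: "group_module K G P" "group_module K G P'" and M: "group_module K G M"
    and d: "d \<in> gmodule_homs K G P' P"
  shows "(\<lambda>c. compose (carrier P') c d) \<in> linear_maps K (hom_module K G P M) (hom_module K G P' M)"
proof -
  note dc = linear_maps_closed[OF gmodule_homs_linear[OF d]]
  show ?thesis
  proof (rule linear_mapsI)
    fix c assume "c \<in> carrier (hom_module K G P M)"
    then show "compose (carrier P') c d \<in> carrier (hom_module K G P' M)"
      unfolding compose_def
      by (intro hom_module_restrict[OF P(2)] gmodule_homs_compose[OF d]) (simp add: hom_module_carrier)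
  qed (auto simp: hom_module_simps compose_def dc intro!: restrict_ext)
qed

lemma post_compose_linear:
  assumes P: "group_module K G P" and M: "group_module K G M"
    and \<phi>: "\<phi> \<in> gmodule_homs K G M N"
  shows "compose (carrier P) \<phi> \<in> linear_maps K (hom_module K G P M) (hom_module K G P N)"
proof -
  note l = linear_mapsD[OF gmodule_homs_linear[OF \<phi>]]
  show ?thesis
  proof (rule linear_mapsI)
    fix c assume "c \<in> carrier (hom_module K G P M)"
    then show "compose (carrier P) \<phi> c \<in> carrier (hom_module K G P N)"
      unfolding compose_def
      by (intro hom_module_restrict[OF P] gmodule_homs_compose[OF _ \<phi>]) (simp add: hom_module_carrier)
  qed (auto simp: hom_module_simps compose_def l hom_module_closed intro!: restrict_ext)
qed

locale gmodule_complex =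
  fixes K :: "('k, 'a) ring_scheme" and G :: "('g, 'b) monoid_scheme"
    and P :: "nat \<Rightarrow> ('k, 'p, 'g) gmodule" and d :: "nat \<Rightarrow> 'p \<Rightarrow> 'p"
  assumes P: "group_module K G (P n)"
    and d: "d n \<in> gmodule_homs K G (P (Suc n)) (P n)"
    and dd: "x \<in> carrier (P (Suc (Suc n))) \<Longrightarrow> d n (d (Suc n) x) = \<zero>\<^bsub>P n\<^esub>"
begin

abbreviation "Hom m M \<equiv> hom_module K G (P m) M"
abbreviation "Ext m M \<equiv> Ext_module K G P d m M"

text \<open>
  The coset is formed in the module of all cochains, as in \<open>Ext_map\<close>; it is the same set as the coset
  in the module of cocycles, of which \<open>Ext_module\<close> is a quotient.
\<close>

definition ext_class :: "nat \<Rightarrow> ('k, 'v, 'g) gmodule \<Rightarrow> ('p \<Rightarrow> 'v) \<Rightarrow> ('p \<Rightarrow> 'v) set"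
  where "ext_class m M c = coboundaries K G P d m M +>\<^bsub>Hom m M\<^esub> c"

lemma d_closed: "x \<in> carrier (P (Suc n)) \<Longrightarrow> d n x \<in> carrier (P n)"
  by (rule linear_maps_closed[OF gmodule_homs_linear[OF d]])

lemma cocycles_iff:
  "c \<in> cocycles K G P d m M \<longleftrightarrow>
    c \<in> carrier (Hom m M) \<and> (\<forall>x \<in> carrier (P (Suc m)). c (d m x) = \<zero>\<^bsub>M\<^esub>)"
  by (auto simp: cocycles_def hom_module_simps compose_def restrict_def fun_eq_iff)

context
  fixes M :: "('k, 'v, 'g) gmodule"
  assumes M: "group_module K G M"
begin

lemma Hom_module: "module K (Hom m M)"
  by (rule hom_module_module[OF P M])

lemma cocycles_submodule: "submodule (cocycles K G P d m M) K (Hom m M)"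
  using linear_maps_kernel_submodule[OF Hom_module Hom_module pre_compose_linear[OF P P M d]]
  by (simp add: cocycles_def)

lemma coboundaries_submodule: "submodule (coboundaries K G P d m M) K (Hom m M)"
proof (cases m)
  case 0
  interpret H: module K "Hom 0 M" by (rule Hom_module)
  have "submodule {\<zero>\<^bsub>Hom 0 M\<^esub>} K (Hom 0 M)" by (rule H.submoduleI) auto
  with 0 show ?thesis by simp
next
  case (Suc n)
  interpret H: module K "Hom n M" by (rule Hom_module)
  show ?thesis
    using linear_maps_image_submodule[OF Hom_module Hom_module pre_compose_linear[OF P P M d] H.carrier_is_submodule] Suc
    by simp
qed

lemma coboundaries_cocycles: "coboundaries K G P d m M \<subseteq> cocycles K G P d m M"
proof (cases m)
  case 0
  then show ?thesis using submodule_zero[OF cocycles_submodule[of 0]] by simp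
next
  case (Suc n)
  interpret M: module K M by (rule group_module_module[OF M])
  have "c \<zero>\<^bsub>P n\<^esub> = \<zero>\<^bsub>M\<^esub>" if "c \<in> carrier (Hom n M)" for c
    using that linear_maps_zero[OF group_module_module[OF P] M.module_axioms]
    by (simp add: hom_module_carrier gmodule_homs_def)
  then show ?thesis
    using Suc linear_maps_closed[OF pre_compose_linear[OF P P M d]]
    by (auto simp: cocycles_iff compose_eq d_closed dd)
qed

lemma Ext_quotient:
  "Ext m M = quotient_module (Hom m M\<lparr>carrier := cocycles K G P d m M\<rparr>) (coboundaries K G P d m M)"
  by (rule Ext_module_def)

lemma cocycle_module: "module K (Hom m M\<lparr>carrier := cocycles K G P d m M\<rparr>)"
  by (rule submodule.submodule_is_module[OF cocycles_submodule Hom_module])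

lemma coboundaries_submodule_cocycles:
  "submodule (coboundaries K G P d m M) K (Hom m M\<lparr>carrier := cocycles K G P d m M\<rparr>)"
  by (rule submodule_of_submodule[OF Hom_module cocycles_submodule coboundaries_submodule coboundaries_cocycles])

lemma ext_class_alt:
  "coboundaries K G P d m M +>\<^bsub>Hom m M\<lparr>carrier := cocycles K G P d m M\<rparr>\<^esub> c = ext_class m M c"
  by (simp add: ext_class_def a_r_coset_def r_coset_def)

lemma Ext_is_module: "module K (Ext m M)"
  unfolding Ext_quotient by (rule quotient_module_module[OF cocycle_module coboundaries_submodule_cocycles])

lemma ext_class_linear:
  "ext_class m M \<in> linear_maps K (Hom m M\<lparr>carrier := cocycles K G P d m M\<rparr>) (Ext m M)"
  using quotient_map_linear[OF cocycle_module coboundaries_submodule_cocycles]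
  by (simp add: ext_class_alt Ext_quotient)

lemma ext_class_closed: "c \<in> cocycles K G P d m M \<Longrightarrow> ext_class m M c \<in> carrier (Ext m M)"
  using linear_maps_closed[OF ext_class_linear] by simp

lemma ext_class_add: "c \<in> cocycles K G P d m M \<Longrightarrow> c' \<in> cocycles K G P d m M \<Longrightarrow>
    ext_class m M (c \<oplus>\<^bsub>Hom m M\<^esub> c') = ext_class m M c \<oplus>\<^bsub>Ext m M\<^esub> ext_class m M c'"
  using linear_maps_add[OF ext_class_linear] by simp

lemma ext_class_smult: "k \<in> carrier K \<Longrightarrow> c \<in> cocycles K G P d m M \<Longrightarrow>
    ext_class m M (k \<odot>\<^bsub>Hom m M\<^esub> c) = k \<odot>\<^bsub>Ext m M\<^esub> ext_class m M c"
  using linear_maps_smult[OF ext_class_linear] by simp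

lemma ext_class_zero: "ext_class m M \<zero>\<^bsub>Hom m M\<^esub> = \<zero>\<^bsub>Ext m M\<^esub>"
  using linear_maps_zero[OF cocycle_module Ext_is_module ext_class_linear] by simp

lemma Ext_cases:
  assumes "\<xi> \<in> carrier (Ext m M)"
  obtains c where "c \<in> cocycles K G P d m M" "\<xi> = ext_class m M c"
  using assms unfolding Ext_quotient quotient_module_carrier ext_class_alt by auto

lemma ext_class_eq_iff:
  assumes "c \<in> cocycles K G P d m M" "c' \<in> cocycles K G P d m M"
  shows "ext_class m M c = ext_class m M c' \<longleftrightarrow> c \<ominus>\<^bsub>Hom m M\<^esub> c' \<in> coboundaries K G P d m M"
  unfolding ext_class_def using assms
  by (intro coset_eq_iff[OF Hom_module coboundaries_submodule]) (auto simp: cocycles_iff)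

lemma mem_ext_class:
  assumes "c \<in> cocycles K G P d m M"
  shows "c \<in> ext_class m M c"
    and "c' \<in> ext_class m M c \<Longrightarrow> c' \<in> cocycles K G P d m M \<and> ext_class m M c' = ext_class m M c"
proof -
  interpret H: module K "Hom m M" by (rule Hom_module)
  have c: "c \<in> carrier (Hom m M)" using assms by (simp add: cocycles_iff)
  have sg: "subgroup (coboundaries K G P d m M) (add_monoid (Hom m M))"
    by (rule submodule.axioms(1)[OF coboundaries_submodule])
  show "c \<in> ext_class m M c"
    unfolding ext_class_def using c submodule_zero[OF coboundaries_submodule]
    by (subst mem_coset_iff[OF H.module_axioms coboundaries_submodule c c]) (simp add: a_minus_def H.M.r_neg)
  assume c': "c' \<in> ext_class m M c"
  then obtain b where b: "b \<in> coboundaries K G P d m M" "c' = b \<oplus>\<^bsub>Hom m M\<^esub> c"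
    by (auto simp: ext_class_def a_r_coset_def')
  have "c' \<in> cocycles K G P d m M"
    using b coboundaries_cocycles assms H.submoduleE(5)[OF cocycles_submodule] by auto
  moreover have "ext_class m M c' = ext_class m M c"
    using c' H.M.a_repr_independence[OF _ c sg] by (simp add: ext_class_def)
  ultimately show "c' \<in> cocycles K G P d m M \<and> ext_class m M c' = ext_class m M c" ..
qed

end

lemma post_compose_cocycle:
  assumes M: "group_module K G M" and N: "group_module K G N" and \<phi>: "\<phi> \<in> gmodule_homs K G M N"
    and c: "c \<in> cocycles K G P d m M"
  shows "compose (carrier (P m)) \<phi> c \<in> cocycles K G P d m N"
  using c linear_maps_closed[OF post_compose_linear[OF P M \<phi>]]
    linear_maps_zero[OF group_module_module[OF M] group_module_module[OF N] gmodule_homs_linear[OF \<phi>]]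
  by (auto simp: cocycles_iff compose_eq d_closed)

lemma post_compose_coboundary:
  assumes M: "group_module K G M" and N: "group_module K G N" and \<phi>: "\<phi> \<in> gmodule_homs K G M N"
    and c: "c \<in> coboundaries K G P d m M"
  shows "compose (carrier (P m)) \<phi> c \<in> coboundaries K G P d m N"
proof (cases m)
  case 0
  then show ?thesis
    using c linear_maps_zero[OF Hom_module[OF M] Hom_module[OF N] post_compose_linear[OF P M \<phi>]] by simp
next
  case (Suc n)
  then obtain b where b: "b \<in> carrier (Hom n M)" "c = compose (carrier (P (Suc n))) b (d n)"
    using c by auto
  have "compose (carrier (P (Suc n))) \<phi> c = compose (carrier (P (Suc n))) (compose (carrier (P n)) \<phi> b) (d n)"
    by (auto simp: b(2) compose_def d_closed intro!: restrict_ext)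
  then show ?thesis
    using Suc b(1) linear_maps_closed[OF post_compose_linear[OF P M \<phi>]] by simp
qed

text \<open>
  Post-composition with \<open>\<phi>\<close> takes coboundaries to coboundaries, so the cosets united in \<open>Ext_map\<close>
  coincide.
\<close>

lemma Ext_map_class:
  assumes M: "group_module K G M" and N: "group_module K G N" and \<phi>: "\<phi> \<in> gmodule_homs K G M N"
    and c: "c \<in> cocycles K G P d m M"
  shows "Ext_map K G P d m N \<phi> (ext_class m M c) = ext_class m N (compose (carrier (P m)) \<phi> c)"
proof -
  have "ext_class m N (compose (carrier (P m)) \<phi> c') = ext_class m N (compose (carrier (P m)) \<phi> c)"
    if "c' \<in> ext_class m M c" for c'
  proof -
    have c': "c' \<in> cocycles K G P d m M" "ext_class m M c' = ext_class m M c"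
      using mem_ext_class(2)[OF M c that] by auto
    then have "c' \<ominus>\<^bsub>Hom m M\<^esub> c \<in> coboundaries K G P d m M" using ext_class_eq_iff[OF M c'(1) c] by simp
    then have "compose (carrier (P m)) \<phi> (c' \<ominus>\<^bsub>Hom m M\<^esub> c) \<in> coboundaries K G P d m N"
      by (rule post_compose_coboundary[OF M N \<phi>])
    then show ?thesis
      using linear_maps_minus[OF Hom_module[OF M] Hom_module[OF N] post_compose_linear[OF P M \<phi>], where x = c' and y = c] c c'
        ext_class_eq_iff[OF N post_compose_cocycle[OF M N \<phi> c'(1)] post_compose_cocycle[OF M N \<phi> c]]
      by (simp add: cocycles_iff)
  qed
  then show ?thesis
    using mem_ext_class(1)[OF M c] unfolding Ext_map_def ext_class_def[symmetric] by blast
qed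

lemma Ext_map_linear:
  assumes M: "group_module K G M" and N: "group_module K G N" and \<phi>: "\<phi> \<in> gmodule_homs K G M N"
  shows "Ext_map K G P d m N \<phi> \<in> linear_maps K (Ext m M) (Ext m N)"
proof (rule linear_mapsI)
  interpret HM: module K "Hom m M" by (rule Hom_module[OF M])
  note sub = HM.submoduleE[OF cocycles_submodule[OF M]]
  note l = post_compose_linear[OF P M \<phi>]
  note pc = post_compose_cocycle[OF M N \<phi>]
  fix x assume "x \<in> carrier (Ext m M)"
  then obtain c where c: "c \<in> cocycles K G P d m M" "x = ext_class m M c" by (rule Ext_cases[OF M])
  then have c': "c \<in> carrier (Hom m M)" by (simp add: cocycles_iff)
  show "Ext_map K G P d m N \<phi> x \<in> carrier (Ext m N)"
    using c by (simp add: Ext_map_class[OF M N \<phi>] ext_class_closed[OF N] pc)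
  { fix k assume k: "k \<in> carrier K"
    show "Ext_map K G P d m N \<phi> (k \<odot>\<^bsub>Ext m M\<^esub> x) = k \<odot>\<^bsub>Ext m N\<^esub> Ext_map K G P d m N \<phi> x"
      using k c c' sub(4)[OF k c(1)] ext_class_smult[OF M k c(1)] ext_class_smult[OF N k pc[OF c(1)]]
      by (simp add: Ext_map_class[OF M N \<phi>] linear_maps_smult[OF l] flip: ext_class_smult[OF M k c(1)]) }
  fix y assume "y \<in> carrier (Ext m M)"
  then obtain b where b: "b \<in> cocycles K G P d m M" "y = ext_class m M b" by (rule Ext_cases[OF M])
  then have b': "b \<in> carrier (Hom m M)" by (simp add: cocycles_iff)
  show "Ext_map K G P d m N \<phi> (x \<oplus>\<^bsub>Ext m M\<^esub> y) = Ext_map K G P d m N \<phi> x \<oplus>\<^bsub>Ext m N\<^esub> Ext_map K G P d m N \<phi> y"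
    using b b' c c' sub(5)[OF c(1) b(1)] ext_class_add[OF N pc[OF c(1)] pc[OF b(1)]]
    by (simp add: Ext_map_class[OF M N \<phi>] linear_maps_add[OF l] flip: ext_class_add[OF M c(1) b(1)])
qed

lemma Ext_map_cong:
  assumes M: "group_module K G M" and "\<xi> \<in> carrier (Ext m M)"
    and "\<And>x. x \<in> carrier M \<Longrightarrow> \<phi> x = \<psi> x"
  shows "Ext_map K G P d m N \<phi> \<xi> = Ext_map K G P d m N \<psi> \<xi>"
proof -
  obtain c where c: "c \<in> cocycles K G P d m M" "\<xi> = ext_class m M c" using Ext_cases[OF M assms(2)] by blast
  have "compose (carrier (P m)) \<phi> c' = compose (carrier (P m)) \<psi> c'" if "c' \<in> \<xi>" for c'
  proof -
    have "c' \<in> carrier (Hom m M)" using mem_ext_class(2)[OF M c(1)] that c(2) by (simp add: cocycles_iff)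
    then have "c' x \<in> carrier M" if "x \<in> carrier (P m)" for x using that by (rule hom_module_closed)
    then show ?thesis unfolding compose_def using assms(3) by (intro restrict_ext) simp
  qed
  then show ?thesis by (simp add: Ext_map_def)
qed

lemma Ext_map_compose:
  assumes M: "group_module K G M" and N: "group_module K G N" and L: "group_module K G L"
    and \<phi>: "\<phi> \<in> gmodule_homs K G M N" and \<psi>: "\<psi> \<in> gmodule_homs K G N L" and \<xi>: "\<xi> \<in> carrier (Ext m M)"
  shows "Ext_map K G P d m L \<psi> (Ext_map K G P d m N \<phi> \<xi>) = Ext_map K G P d m L (\<lambda>x. \<psi> (\<phi> x)) \<xi>"
proof -
  obtain c where c: "c \<in> cocycles K G P d m M" "\<xi> = ext_class m M c" using Ext_cases[OF M \<xi>] by blast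
  have "compose (carrier (P m)) \<psi> (compose (carrier (P m)) \<phi> c) = compose (carrier (P m)) (\<lambda>x. \<psi> (\<phi> x)) c"
    by (auto simp: compose_def intro!: restrict_ext)
  then show ?thesis
    using c by (simp add: Ext_map_class[OF M N \<phi>] Ext_map_class[OF N L \<psi>] post_compose_cocycle[OF M N \<phi>]
        Ext_map_class[OF M L gmodule_homs_compose[OF \<phi> \<psi>]])
qed

text \<open>
  Additivity and homogeneity in the homomorphism make the cohomological pairing linear in its second
  argument.
\<close>

lemma Ext_map_add:
  assumes M: "group_module K G M" and N: "group_module K G N"
    and \<phi>: "\<phi> \<in> gmodule_homs K G M N" and \<psi>: "\<psi> \<in> gmodule_homs K G M N" and \<xi>: "\<xi> \<in> carrier (Ext m M)"
  shows "Ext_map K G P d m N (\<lambda>x. \<phi> x \<oplus>\<^bsub>N\<^esub> \<psi> x) \<xi>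
    = Ext_map K G P d m N \<phi> \<xi> \<oplus>\<^bsub>Ext m N\<^esub> Ext_map K G P d m N \<psi> \<xi>"
proof -
  obtain c where c: "c \<in> cocycles K G P d m M" "\<xi> = ext_class m M c" using Ext_cases[OF M \<xi>] by blast
  have "compose (carrier (P m)) (\<lambda>x. \<phi> x \<oplus>\<^bsub>N\<^esub> \<psi> x) c
      = compose (carrier (P m)) \<phi> c \<oplus>\<^bsub>Hom m N\<^esub> compose (carrier (P m)) \<psi> c"
    by (auto simp: compose_def hom_module_simps intro!: restrict_ext)
  then show ?thesis
    using c by (simp add: Ext_map_class[OF M N] \<phi> \<psi> gmodule_homs_add[OF N] ext_class_add[OF N] post_compose_cocycle[OF M N])
qed

lemma Ext_map_smult:
  assumes M: "group_module K G M" and N: "group_module K G N"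
    and \<phi>: "\<phi> \<in> gmodule_homs K G M N" and k: "k \<in> carrier K" and \<xi>: "\<xi> \<in> carrier (Ext m M)"
  shows "Ext_map K G P d m N (\<lambda>x. k \<odot>\<^bsub>N\<^esub> \<phi> x) \<xi> = k \<odot>\<^bsub>Ext m N\<^esub> Ext_map K G P d m N \<phi> \<xi>"
proof -
  obtain c where c: "c \<in> cocycles K G P d m M" "\<xi> = ext_class m M c" using Ext_cases[OF M \<xi>] by blast
  have "compose (carrier (P m)) (\<lambda>x. k \<odot>\<^bsub>N\<^esub> \<phi> x) c = k \<odot>\<^bsub>Hom m N\<^esub> compose (carrier (P m)) \<phi> c"
    by (auto simp: compose_def hom_module_simps intro!: restrict_ext)
  then show ?thesis
    using c k by (simp add: Ext_map_class[OF M N] \<phi> gmodule_homs_smult[OF N] ext_class_smult[OF N] post_compose_cocycle[OF M N])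
qed

lemma Ext_map_id:
  assumes M: "group_module K G M" and \<xi>: "\<xi> \<in> carrier (Ext m M)"
  shows "Ext_map K G P d m M (\<lambda>x. x) \<xi> = \<xi>"
proof -
  obtain c where c: "c \<in> cocycles K G P d m M" "\<xi> = ext_class m M c" using Ext_cases[OF M \<xi>] by blast
  have "compose (carrier (P m)) (\<lambda>x. x) c = c"
    using c(1) by (auto simp: compose_def cocycles_iff hom_module_carrier intro: extensional_restrict)
  then show ?thesis using c by (simp add: Ext_map_class[OF M M gmodule_homs_id])
qed

lemma Ext_map_zero:
  assumes M: "group_module K G M" and N: "group_module K G N" and \<xi>: "\<xi> \<in> carrier (Ext m M)"
  shows "Ext_map K G P d m N (\<lambda>_. \<zero>\<^bsub>N\<^esub>) \<xi> = \<zero>\<^bsub>Ext m N\<^esub>"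
proof -
  obtain c where c: "c \<in> cocycles K G P d m M" "\<xi> = ext_class m M c" using Ext_cases[OF M \<xi>] by blast
  have "compose (carrier (P m)) (\<lambda>_. \<zero>\<^bsub>N\<^esub>) c = \<zero>\<^bsub>Hom m N\<^esub>"
    by (auto simp: compose_def hom_module_simps)
  then show ?thesis
    using c by (simp add: Ext_map_class[OF M N] gmodule_homs_zero[OF N] ext_class_zero[OF N])
qed

end

section \<open>Cocycles of finite rank\<close>

text \<open>
  \<open>V\<close> lies in a finite-dimensional subspace.  This is stable under passing to subsets, and \<open>V\<close> need not
  be a subspace.
\<close>

definition finite_rank :: "('k, 'a) ring_scheme \<Rightarrow> ('k, 'v, 'c) module_scheme \<Rightarrow> 'v set \<Rightarrow> bool"
  where "finite_rank K M V \<longleftrightarrow> (\<exists>E. finite E \<and> E \<subseteq> carrier M \<and> V \<subseteq> submodule_hull K M E)"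

lemma finite_rank_subset: "finite_rank K M W \<Longrightarrow> V \<subseteq> W \<Longrightarrow> finite_rank K M V"
  unfolding finite_rank_def by (elim exE) (rule exI, auto)

lemma submodule_hull_insert:
  fixes M (structure)
  assumes M: "module K M" and x: "x \<in> carrier M" and E: "E \<subseteq> carrier M"
    and v: "v \<in> submodule_hull K M (insert x E)"
  obtains c u where "c \<in> carrier K" "u \<in> submodule_hull K M E" "v = c \<odot> x \<oplus> u"
proof -
  interpret M: module K M by fact
  let ?H = "submodule_hull K M E"
  let ?L = "{c \<odot> x \<oplus> u | c u. c \<in> carrier K \<and> u \<in> ?H}"
  have H: "submodule ?H K M" by (rule submodule_hull_submodule[OF M E])
  note HE = M.submoduleE[OF H]
  have Hc: "u \<in> carrier M" if "u \<in> ?H" for u using HE(1) that by auto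
  have mem: "w \<in> ?L" if "c \<in> carrier K" "u \<in> ?H" "w = c \<odot> x \<oplus> u" for c u w using that by blast
  have "submodule ?L K M"
  proof (rule M.submoduleI)
    show "?L \<subseteq> carrier M" using Hc x by auto
    show "\<zero> \<in> ?L"
      by (rule mem[of "\<zero>\<^bsub>K\<^esub>" "\<zero>"]) (use x submodule_zero[OF H] in auto)
  next
    fix a assume "a \<in> ?L"
    then obtain c u where a: "c \<in> carrier K" "u \<in> ?H" "a = c \<odot> x \<oplus> u" by blast
    show "\<ominus> a \<in> ?L"
      by (rule mem[of "\<ominus>\<^bsub>K\<^esub> c" "\<ominus> u"]) (use a x Hc HE(3) in \<open>auto simp: M.smult_l_minus M.M.minus_add\<close>)
    fix b assume "b \<in> ?L"
    then obtain c' u' where b: "c' \<in> carrier K" "u' \<in> ?H" "b = c' \<odot> x \<oplus> u'" by blast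
    show "a \<oplus> b \<in> ?L"
      by (rule mem[of "c \<oplus>\<^bsub>K\<^esub> c'" "u \<oplus> u'"]) (use a b x Hc HE(5) in \<open>auto simp: M.smult_l_distr M.M.a_ac\<close>)
  next
    fix k a assume k: "k \<in> carrier K" and "a \<in> ?L"
    then obtain c u where a: "c \<in> carrier K" "u \<in> ?H" "a = c \<odot> x \<oplus> u" by blast
    show "k \<odot> a \<in> ?L"
      by (rule mem[of "k \<otimes>\<^bsub>K\<^esub> c" "k \<odot> u"])
        (use a k x Hc HE(4) in \<open>auto simp: M.smult_r_distr M.smult_assoc1\<close>)
  qed
  moreover have "insert x E \<subseteq> ?L"
  proof (rule insert_subsetI)
    show "x \<in> ?L"
      by (rule mem[of "\<one>\<^bsub>K\<^esub>" "\<zero>"]) (use x submodule_zero[OF H] in auto)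
    have "u \<in> ?L" if "u \<in> ?H" for u
      by (rule mem[of "\<zero>\<^bsub>K\<^esub>" u]) (use x Hc that in auto)
    then show "E \<subseteq> ?L" using submodule_hull_incl[of E K M] by (meson subsetD subsetI)
  qed
  ultimately have "v \<in> ?L" using submodule_hull_least v by blast
  then show ?thesis using that by blast
qed

text \<open>
  Finite-dimensional spaces are noetherian.  The point is that the spanning vectors are found in \<open>V\<close>
  itself: when \<open>V\<close> is the image of a linear map, they can be lifted.
\<close>

lemma subspace_finitely_spanned:
  fixes M (structure)
  assumes K: "field K" and M: "module K M"
    and "finite E" "E \<subseteq> carrier M" "submodule V K M" "V \<subseteq> submodule_hull K M E"
  shows "\<exists>Y. finite Y \<and> Y \<subseteq> V \<and> V \<subseteq> submodule_hull K M Y"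
  using assms(3-)
proof (induction E arbitrary: V rule: finite_induct)
  case empty
  then show ?case by (intro exI[of _ "{}"]) simp
next
  case (insert x E)
  interpret K: field K by fact
  interpret M: module K M by fact
  let ?H = "submodule_hull K M"
  have x: "x \<in> carrier M" and E: "E \<subseteq> carrier M" using insert.prems by auto
  have H: "submodule (?H E) K M" by (rule submodule_hull_submodule[OF M E])
  note V = M.submoduleE[OF insert.prems(2)] and HE = M.submoduleE[OF H]
  have Vc: "v \<in> carrier M" if "v \<in> V" for v using V(1) that by auto
  have cancel: "(p \<oplus> q) \<ominus> p = q" if "p \<in> carrier M" "q \<in> carrier M" for p q
    using that by (simp add: M.M.minus_eq M.M.a_comm[of p q] M.M.a_assoc M.M.r_neg)
  show ?case
  proof (cases "V \<subseteq> ?H E")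
    case True
    then show ?thesis using insert.IH[OF E insert.prems(2)] by blast
  next
    case False
    \<comment> \<open>\<open>v0\<close> has a nonzero coordinate at \<open>x\<close>, so subtracting multiples of it moves \<open>V\<close> into the hull of \<open>E\<close>.\<close>
    then obtain v0 where v0: "v0 \<in> V" "v0 \<notin> ?H E" by blast
    then obtain c0 u0 where c0: "c0 \<in> carrier K" "u0 \<in> ?H E" "v0 = c0 \<odot> x \<oplus> u0"
      using submodule_hull_insert[OF M x E] insert.prems(3) by blast
    have u0: "u0 \<in> carrier M" using c0(2) HE(1) by blast
    have "c0 \<noteq> \<zero>\<^bsub>K\<^esub>" using c0 v0 x u0 by auto
    then have inv: "inv\<^bsub>K\<^esub> c0 \<in> carrier K" "inv\<^bsub>K\<^esub> c0 \<otimes>\<^bsub>K\<^esub> c0 = \<one>\<^bsub>K\<^esub>"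
      using c0(1) K.field_Units by auto
    have "submodule (V \<inter> ?H E) K M"
      by (rule submodule_Int[OF M insert.prems(2) H])
    from insert.IH[OF E this]
    obtain Y where Y: "finite Y" "Y \<subseteq> V \<inter> ?H E" "V \<inter> ?H E \<subseteq> ?H Y" by auto
    have Yc: "insert v0 Y \<subseteq> carrier M" using Y(2) v0(1) V(1) by auto
    note HY = M.submoduleE[OF submodule_hull_submodule[OF M Yc]]
    have "v \<in> ?H (insert v0 Y)" if v: "v \<in> V" for v
    proof -
      obtain c u where c: "c \<in> carrier K" "u \<in> ?H E" "v = c \<odot> x \<oplus> u"
        using submodule_hull_insert[OF M x E] insert.prems(3) v by blast
      have u: "u \<in> carrier M" using c(2) HE(1) by blast
      define k where "k = c \<otimes>\<^bsub>K\<^esub> inv\<^bsub>K\<^esub> c0"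
      have k: "k \<in> carrier K" "k \<otimes>\<^bsub>K\<^esub> c0 = c" using c(1) inv c0(1) by (auto simp: k_def K.m_assoc)
      have kv: "k \<odot> v0 = c \<odot> x \<oplus> k \<odot> u0"
        using k c0 x u0 by (simp add: M.smult_r_distr M.smult_assoc1[symmetric])
      have "k \<odot> v0 \<oplus> (u \<ominus> k \<odot> u0) = c \<odot> x \<oplus> (u \<oplus> (k \<odot> u0 \<ominus> k \<odot> u0))"
        unfolding kv using k c x u u0 by (simp add: M.M.minus_eq M.M.a_ac)
      also have "\<dots> = v" using k u0 c x u by (simp add: M.M.minus_eq M.M.r_neg)
      finally have v': "v = k \<odot> v0 \<oplus> (u \<ominus> k \<odot> u0)" ..
      have w: "u \<ominus> k \<odot> u0 \<in> ?H E" using submodule_minus[OF M H c(2)] HE(4) k c0(2) by blast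
      have "u \<ominus> k \<odot> u0 = v \<ominus> k \<odot> v0"
        using k(1) Vc[OF v0(1)] u u0 by (subst v', subst cancel) (simp_all add: M.M.minus_eq)
      then have "u \<ominus> k \<odot> u0 \<in> V" using submodule_minus[OF M insert.prems(2) v] V(4) k v0(1) by simp
      then have "u \<ominus> k \<odot> u0 \<in> ?H (insert v0 Y)"
        using w Y(3) submodule_hull_mono[OF M Yc, of Y] by blast
      moreover have "v0 \<in> ?H (insert v0 Y)" using submodule_hull_incl[of "insert v0 Y"] by blast
      ultimately show ?thesis by (subst v') (intro HY(5) HY(4) k(1))
    qed
    then show ?thesis using Y(1,2) v0(1) by (intro exI[of _ "insert v0 Y"]) auto
  qed
qed

lemma linear_maps_image_hull:
  assumes "module K M" "module K N" "f \<in> linear_maps K M N" "E \<subseteq> carrier M" "x \<in> submodule_hull K M E"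
  shows "f x \<in> submodule_hull K N (f ` E)"
proof -
  have fE: "f ` E \<subseteq> carrier N" using assms(4) linear_maps_closed[OF assms(3)] by auto
  have "submodule {x \<in> carrier M. f x \<in> submodule_hull K N (f ` E)} K M"
    by (rule linear_maps_preimage_submodule[OF assms(1-3) submodule_hull_submodule[OF assms(2) fE]])
  moreover have "E \<subseteq> {x \<in> carrier M. f x \<in> submodule_hull K N (f ` E)}"
    using assms(4) submodule_hull_incl[of "f ` E"] by blast
  ultimately show ?thesis using submodule_hull_least assms(5) by blast
qed

text \<open>
  Together with \<open>submodule\<close> this describes the submodules over the group algebra.
\<close>

definition gact_closed_subset :: "('g, 'b) monoid_scheme \<Rightarrow> ('k, 'v, 'g) gmodule \<Rightarrow> 'v set \<Rightarrow> bool"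
  where "gact_closed_subset G M W \<longleftrightarrow> (\<forall>a \<in> carrier G. \<forall>w \<in> W. gact M a w \<in> W)"

text \<open>
  Since \<open>G\<close> is finite, the translates of finitely many vectors are still finite in number.
\<close>

lemma finite_rank_gsubmodule:
  assumes M: "group_module K G M" and "finite (carrier G)" "finite E" "E \<subseteq> carrier M"
  obtains W where "submodule W K M" "gact_closed_subset G M W" "finite_rank K M W" "E \<subseteq> W"
proof -
  interpret M: module K M by (rule group_module_module[OF M])
  interpret G: group G by (rule group_module_group[OF M])
  let ?E = "(\<lambda>(a, x). gact M a x) ` (carrier G \<times> E)"
  let ?W = "submodule_hull K M ?E"
  have E: "?E \<subseteq> carrier M" using assms(4) gact_closed[OF M] by auto
  have W: "submodule ?W K M" by (rule submodule_hull_submodule[OF M.module_axioms E])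
  have gen: "gact M a y \<in> ?W" if "a \<in> carrier G" "y \<in> E" for a y
  proof -
    have "gact M a y \<in> ?E" using that by (intro image_eqI[of _ _ "(a, y)"]) auto
    then show ?thesis by (rule subsetD[OF submodule_hull_incl])
  qed
  have "gact M a w \<in> ?W" if a: "a \<in> carrier G" and w: "w \<in> ?W" for a w
  proof -
    have "x \<in> {x \<in> carrier M. gact M a x \<in> ?W}" if x: "x \<in> ?E" for x
    proof -
      obtain b y where by': "b \<in> carrier G" "y \<in> E" "x = gact M b y" using x by auto
      then have "gact M a x = gact M (a \<otimes>\<^bsub>G\<^esub> b) y"
        using a assms(4) gact_mult[OF M a by'(1)] by auto
      then show ?thesis using gen[OF G.m_closed[OF a by'(1)] by'(2)] subsetD[OF E x] by simp
    qed
    then have "?W \<subseteq> {x \<in> carrier M. gact M a x \<in> ?W}"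
      by (intro submodule_hull_least[OF
            linear_maps_preimage_submodule[OF M.module_axioms M.module_axioms gact_linear[OF M a] W]] subsetI)
    then show ?thesis using w by auto
  qed
  then have "gact_closed_subset G M ?W" unfolding gact_closed_subset_def by simp
  moreover have "finite_rank K M ?W" unfolding finite_rank_def using E assms(2,3) by (intro exI[of _ ?E]) auto
  moreover have "E \<subseteq> ?W"
  proof
    fix x assume x: "x \<in> E"
    then have "gact M \<one>\<^bsub>G\<^esub> x = x" using assms(4) gact_one[OF M] by auto
    then show "x \<in> ?W" using gen[OF G.one_closed x] by simp
  qed
  ultimately show ?thesis by (rule that[OF W])
qed

lemma free_gmodule_group_module:
  assumes "cring K" "group G"
  shows "group_module K G (free_gmodule K G B)"
proof -
  interpret G: group G by fact
  show ?thesis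
    unfolding free_gmodule_def
    by (rule permutation_module_group_module[OF assms]) (auto simp: G.m_assoc)
qed

lemma free_gmodule_basis:
  assumes "cring K" "group G" "b \<in> B"
  shows "a \<in> carrier G \<Longrightarrow> basis_vec K (a, b) \<in> carrier (free_gmodule K G B)"
    and "a \<in> carrier G \<Longrightarrow> gact (free_gmodule K G B) a (basis_vec K (\<one>\<^bsub>G\<^esub>, b)) = basis_vec K (a, b)"
proof -
  interpret G: group G by fact
  show c: "basis_vec K (a, b) \<in> carrier (free_gmodule K G B)" if "a \<in> carrier G" for a
    using basis_vec_closed[OF assms(1), of "(a, b)" "carrier G \<times> B"] that assms(3)
    by (simp add: free_gmodule_def)
  show "gact (free_gmodule K G B) a (basis_vec K (\<one>\<^bsub>G\<^esub>, b)) = basis_vec K (a, b)" if a: "a \<in> carrier G"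
    using linear_extension_basis_vec[OF free_module_module[OF assms(1)],
        of "\<lambda>s. basis_vec K (case s of (c, s) \<Rightarrow> (a \<otimes>\<^bsub>G\<^esub> c, s))" "(\<one>\<^bsub>G\<^esub>, b)" "carrier G \<times> B"] a c[OF a]
    by (simp add: free_gmodule_def)
qed

lemma free_gmodule_hom:
  assumes K: "cring K" and Q: "group_module K G Q" and y: "\<And>b. b \<in> B \<Longrightarrow> y b \<in> carrier Q"
  obtains s where "s \<in> gmodule_homs K G (free_gmodule K G B) Q"
    "\<And>b. b \<in> B \<Longrightarrow> s (basis_vec K (\<one>\<^bsub>G\<^esub>, b)) = y b"
proof -
  interpret G: group G by (rule group_module_group[OF Q])
  have Qm: "module K Q" by (rule group_module_module[OF Q])
  let ?\<phi> = "\<lambda>(a, b). gact Q a (y b)"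
  let ?s = "linear_extension K Q ?\<phi>"
  have bas: "?s (basis_vec K (a, b)) = gact Q a (y b)" if "a \<in> carrier G" "b \<in> B" for a b
    using that by (subst linear_extension_basis_vec[OF Qm]) (auto intro: gact_closed[OF Q] y)
  have lin: "?s \<in> linear_maps K (free_module K (carrier G \<times> B)) Q"
    by (rule linear_extension_linear[OF Qm]) (auto intro: gact_closed[OF Q] y)
  have "?s \<in> gmodule_homs K G (free_gmodule K G B) Q"
    unfolding free_gmodule_def
    by (rule permutation_module_homI[OF K lin Q]) (auto simp: bas y gact_mult[OF Q])
  then show ?thesis using that bas by (simp add: gact_one[OF Q] y)
qed

text \<open>
  The lifting property of projective modules, modulo a submodule \<open>W\<close> that absorbs the errors: the
  condition says that \<open>h\<close> maps into the sum of \<open>W\<close> and the image of \<open>D\<close>.  On a free module lifts are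
  chosen for the basis; a direct summand inherits them.
\<close>

lemma projective_lift:
  fixes P :: "('k, 'p, 'g) gmodule"
  assumes K: "cring K" and P: "projective_gmodule K G P" and Q: "group_module K G Q" and L: "group_module K G L"
    and h: "h \<in> gmodule_homs K G P L" and D: "D \<in> gmodule_homs K G Q L"
    and W: "submodule W K L" "gact_closed_subset G L W"
    and lift: "\<And>x. x \<in> carrier P \<Longrightarrow> \<exists>q \<in> carrier Q. h x \<ominus>\<^bsub>L\<^esub> D q \<in> W"
  obtains s where "s \<in> gmodule_homs K G P Q" "\<forall>x \<in> carrier P. h x \<ominus>\<^bsub>L\<^esub> D (s x) \<in> W"
proof -
  obtain B :: "'p set" and i r where ir: "i \<in> gmodule_homs K G P (free_gmodule K G B)"
      "r \<in> gmodule_homs K G (free_gmodule K G B) P" "\<And>x. x \<in> carrier P \<Longrightarrow> r (i x) = x"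
    using P unfolding projective_gmodule_def by blast
  let ?F = "free_gmodule K G B"
  interpret G: group G by (rule group_module_group[OF Q])
  interpret L: module K L by (rule group_module_module[OF L])
  have F: "group_module K G ?F" by (rule free_gmodule_group_module[OF K G.group_axioms])
  note b = free_gmodule_basis[OF K G.group_axioms]
  define y where "y b = (SOME q. q \<in> carrier Q \<and> h (r (basis_vec K (\<one>\<^bsub>G\<^esub>, b))) \<ominus>\<^bsub>L\<^esub> D q \<in> W)" for b
  have y: "y b \<in> carrier Q \<and> h (r (basis_vec K (\<one>\<^bsub>G\<^esub>, b))) \<ominus>\<^bsub>L\<^esub> D (y b) \<in> W" if "b \<in> B" for b
  proof -
    have "r (basis_vec K (\<one>\<^bsub>G\<^esub>, b)) \<in> carrier P"
      using linear_maps_closed[OF gmodule_homs_linear[OF ir(2)]] b(1)[OF that] by simp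
    from lift[OF this] show ?thesis unfolding y_def by (rule someI2_bex) simp
  qed
  obtain s where s: "s \<in> gmodule_homs K G ?F Q" "\<And>b. b \<in> B \<Longrightarrow> s (basis_vec K (\<one>\<^bsub>G\<^esub>, b)) = y b"
    using free_gmodule_hom[OF K Q, of B y] y by blast
  define f where "f u = h (r u) \<ominus>\<^bsub>L\<^esub> D (s u)" for u
  have f: "f \<in> gmodule_homs K G ?F L"
    unfolding f_def by (rule gmodule_homs_diff[OF L gmodule_homs_compose[OF ir(2) h] gmodule_homs_compose[OF s(1) D]])
  have fW: "f u \<in> W" if u: "u \<in> carrier ?F" for u
  proof -
    let ?L = "{u \<in> carrier ?F. f u \<in> W}"
    have sub: "submodule ?L K (free_module K (carrier G \<times> B))"
      using linear_maps_preimage_submodule[OF free_module_module[OF K] L.module_axioms, of f "carrier G \<times> B" W]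
        gmodule_homs_linear[OF f] W(1) by (simp add: free_gmodule_def)
    have "basis_vec K (a, c) \<in> ?L" if "a \<in> carrier G" "c \<in> B" for a c
    proof -
      have "f (basis_vec K (a, c)) = gact L a (f (basis_vec K (\<one>\<^bsub>G\<^esub>, c)))"
        using gmodule_homs_gact[OF f that(1) b(1)[OF that(2) G.one_closed]] b(2)[OF that(2,1)] by simp
      moreover have "f (basis_vec K (\<one>\<^bsub>G\<^esub>, c)) \<in> W" using y[OF that(2)] s(2)[OF that(2)] by (simp add: f_def)
      ultimately show ?thesis using W(2) that b(1) by (simp add: gact_closed_subset_def)
    qed
    then have "basis_vec K q \<in> ?L" if "q \<in> carrier G \<times> B" for q using that by (cases q) simp
    moreover have "u \<in> carrier (free_module K (carrier G \<times> B))" using u by (simp add: free_gmodule_def)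
    ultimately have "u \<in> ?L" by (rule submodule_free_module_eqI[OF K sub])
    then show ?thesis by simp
  qed
  have "h x \<ominus>\<^bsub>L\<^esub> D (s (i x)) \<in> W" if "x \<in> carrier P" for x
    using fW[OF linear_maps_closed[OF gmodule_homs_linear[OF ir(1)] that]] ir(3)[OF that] by (simp add: f_def)
  then have "\<forall>x \<in> carrier P. h x \<ominus>\<^bsub>L\<^esub> D (s (i x)) \<in> W" ..
  then show ?thesis by (rule that[OF gmodule_homs_compose[OF ir(1) s(1)]])
qed

text \<open>
  The induction step for the homotopy.  If \<open>D \<circ> h\<close> has finite rank, then its image is spanned by the images
  of finitely many vectors \<open>h x\<close>.  Let \<open>W\<close> be the submodule over the group algebra that these vectors
  generate; it has finite rank, and \<open>h\<close> differs from a map into \<open>W\<close> by a map into the kernel of \<open>D\<close>, which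
  is the image of \<open>d\<close>.
\<close>

lemma lift_modulo_finite_rank:
  assumes K: "field K" and fin: "finite (carrier G)" and P: "projective_gmodule K G P" and Q: "group_module K G Q"
    and d: "d \<in> gmodule_homs K G Q P" and L: "module K L" and D: "D \<in> linear_maps K P L"
    and exact: "{x \<in> carrier P. D x = \<zero>\<^bsub>L\<^esub>} = d ` carrier Q"
    and h: "h \<in> gmodule_homs K G P P" and rank: "finite_rank K L ((\<lambda>x. D (h x)) ` carrier P)"
  obtains s W where "s \<in> gmodule_homs K G P Q" "submodule W K P" "gact_closed_subset G P W" "finite_rank K P W"
    "\<forall>x \<in> carrier P. h x \<ominus>\<^bsub>P\<^esub> d (s x) \<in> W"
proof -
  interpret K: field K by fact
  have Pg: "group_module K G P" using P by (simp add: projective_gmodule_def)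
  interpret P: module K P by (rule group_module_module[OF Pg])
  interpret L: module K L by fact
  note hl = gmodule_homs_linear[OF h]
  have Dh: "(\<lambda>x. D (h x)) \<in> linear_maps K P L" by (rule linear_maps_compose[OF hl D])
  obtain E where E: "finite E" "E \<subseteq> carrier L" "(\<lambda>x. D (h x)) ` carrier P \<subseteq> submodule_hull K L E"
    using rank unfolding finite_rank_def by blast
  obtain Y where Y: "finite Y" "Y \<subseteq> (\<lambda>x. D (h x)) ` carrier P"
      "(\<lambda>x. D (h x)) ` carrier P \<subseteq> submodule_hull K L Y"
    using subspace_finitely_spanned[OF K L E(1,2) linear_maps_image_submodule[OF P.module_axioms L Dh P.carrier_is_submodule] E(3)]
    by blast
  obtain E' where E': "E' \<subseteq> carrier P" "finite E'" "Y = (\<lambda>x. D (h x)) ` E'"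
    using finite_subset_image[OF Y(1,2)] by blast
  have "h ` E' \<subseteq> carrier P" using E'(1) linear_maps_closed[OF hl] by auto
  then obtain W where W: "submodule W K P" "gact_closed_subset G P W" "finite_rank K P W" "h ` E' \<subseteq> W"
    using finite_rank_gsubmodule[OF Pg fin, of "h ` E'"] E'(2) by blast
  have "\<exists>q \<in> carrier Q. h x \<ominus>\<^bsub>P\<^esub> d q \<in> W" if x: "x \<in> carrier P" for x
  proof -
    have hx: "h x \<in> carrier P" using x by (rule linear_maps_closed[OF hl])
    have "submodule_hull K L Y \<subseteq> D ` W"
      by (rule submodule_hull_least[OF linear_maps_image_submodule[OF P.module_axioms L D W(1)]])
        (use E'(3) W(4) in auto)
    then obtain w where w: "w \<in> W" "D (h x) = D w" using Y(3) x by blast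
    have wc: "w \<in> carrier P" using w(1) P.submoduleE(1)[OF W(1)] by blast
    have "D (h x \<ominus>\<^bsub>P\<^esub> w) = \<zero>\<^bsub>L\<^esub>"
      using linear_maps_minus[OF P.module_axioms L D hx wc] w(2) linear_maps_closed[OF D wc]
      by (simp add: L.M.minus_eq L.M.r_neg)
    then obtain q where q: "q \<in> carrier Q" "h x \<ominus>\<^bsub>P\<^esub> w = d q" using exact hx wc by blast
    have "h x \<ominus>\<^bsub>P\<^esub> d q = w"
      using hx wc by (simp add: q(2)[symmetric] P.M.minus_eq P.M.minus_add P.M.a_assoc[symmetric] P.M.r_neg)
    then show ?thesis using q(1) w(1) by auto
  qed
  then obtain s where s: "s \<in> gmodule_homs K G P Q" "\<forall>x \<in> carrier P. h x \<ominus>\<^bsub>P\<^esub> d (s x) \<in> W"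
    by (rule projective_lift[OF K.is_cring P Q Pg h d W(1,2)])
  show ?thesis by (rule that[OF s(1) W(1-3) s(2)])
qed

locale finite_group_resolution =
  fixes K :: "('k, 'a) ring_scheme" and G :: "('g, 'b) monoid_scheme"
    and P :: "nat \<Rightarrow> ('k, 'p, 'g) gmodule" and d :: "nat \<Rightarrow> 'p \<Rightarrow> 'p" and e :: "'p \<Rightarrow> 'k"
  assumes field: "field K" and finite_group: "finite (carrier G)"
    and resolution: "projective_resolution K G P d e"
begin

lemma projective: "projective_gmodule K G (P n)"
  using resolution by (simp add: projective_resolution_def)

sublocale gmodule_complex K G P d
proof
  have d: "d n \<in> gmodule_homs K G (P (Suc n)) (P n)" for n
    using resolution by (simp add: projective_resolution_def)
  show "group_module K G (P n)" for n using projective by (simp add: projective_gmodule_def)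
  show "d n \<in> gmodule_homs K G (P (Suc n)) (P n)" for n by (rule d)
  show "d n (d (Suc n) x) = \<zero>\<^bsub>P n\<^esub>" if "x \<in> carrier (P (Suc (Suc n)))" for n x
  proof -
    have "d (Suc n) x \<in> {y \<in> carrier (P (Suc n)). d n y = \<zero>\<^bsub>P n\<^esub>}"
      using resolution that unfolding projective_resolution_def by blast
    then show ?thesis by simp
  qed
qed

lemma trivial_module: "module K (trivial_gmodule K)"
proof -
  interpret K: field K by (rule field)
  show ?thesis
    by (intro moduleI[OF K.is_cring] abelian_groupI)
      (auto simp: trivial_gmodule_def K.a_ac K.m_assoc K.l_distr K.r_distr intro: K.l_neg bexI[of _ "\<ominus>\<^bsub>K\<^esub> _"])
qed

text \<open>
  The shape of the term \<open>s\<^bsub>m-1\<^esub> \<circ> d\<^bsub>m-1\<^esub>\<close> of a chain homotopy in degree \<open>m\<close>; in degree \<open>0\<close> this term is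
  zero.
\<close>

definition factors_through_differential :: "nat \<Rightarrow> ('p \<Rightarrow> 'p) \<Rightarrow> bool"
  where "factors_through_differential m t \<longleftrightarrow> (case m of
      0 \<Rightarrow> \<forall>x \<in> carrier (P 0). t x = \<zero>\<^bsub>P 0\<^esub>
    | Suc n \<Rightarrow> \<exists>s \<in> gmodule_homs K G (P n) (P m). \<forall>x \<in> carrier (P m). t x = s (d n x))"

lemma factors_through_differential_zero:
  assumes "factors_through_differential m t" "x \<in> carrier (P (Suc m))"
  shows "t (d m x) = \<zero>\<^bsub>P m\<^esub>"
proof (cases m)
  case 0
  then show ?thesis using assms d_closed[of x 0] by (auto simp: factors_through_differential_def)
next
  case (Suc n)
  then obtain s where s: "s \<in> gmodule_homs K G (P n) (P m)" "\<And>x. x \<in> carrier (P m) \<Longrightarrow> t x = s (d n x)"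
    using assms(1) by (auto simp: factors_through_differential_def)
  have "s (d n (d m x)) = \<zero>\<^bsub>P m\<^esub>"
    using dd[of x n] assms(2) Suc
      linear_maps_zero[OF group_module_module[OF P] group_module_module[OF P] gmodule_homs_linear[OF s(1)]] by simp
  then show ?thesis using s(2)[OF d_closed[OF assms(2)]] by simp
qed

text \<open>
  With \<open>t = s\<^bsub>m-1\<^esub> \<circ> d\<^bsub>m-1\<^esub>\<close> this says that \<open>id - s\<^bsub>m-1\<^esub> \<circ> d\<^bsub>m-1\<^esub> - d\<^bsub>m\<^esub> \<circ> s\<^bsub>m\<^esub>\<close> has finite rank.  The homotopy is
  constructed degree by degree.  If \<open>\<rho>\<close> denotes the map of finite rank obtained in degree \<open>m\<close>, then
  \<open>d\<^bsub>m\<^esub> \<circ> (id - s\<^bsub>m\<^esub> \<circ> d\<^bsub>m\<^esub>) = \<rho> \<circ> d\<^bsub>m\<^esub>\<close>, because \<open>t \<circ> d\<^bsub>m\<^esub> = 0\<close>; so \<open>lift_modulo_finite_rank\<close> applies to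
  \<open>id - s\<^bsub>m\<^esub> \<circ> d\<^bsub>m\<^esub>\<close> in the next degree.
\<close>

lemma identity_homotopic_to_finite_rank:
  "\<exists>t s W. t \<in> gmodule_homs K G (P m) (P m) \<and> factors_through_differential m t \<and>
    s \<in> gmodule_homs K G (P m) (P (Suc m)) \<and> submodule W K (P m) \<and> finite_rank K (P m) W \<and>
    (\<forall>x \<in> carrier (P m). (x \<ominus>\<^bsub>P m\<^esub> t x) \<ominus>\<^bsub>P m\<^esub> d m (s x) \<in> W)"
proof (induction m)
  case 0
  interpret K: field K by (rule field)
  interpret P0: module K "P 0" by (rule group_module_module[OF P])
  \<comment> \<open>In degree \<open>0\<close> the augmentation takes the place of the differential; its target is one-dimensional.\<close>
  let ?T = "trivial_gmodule K :: ('k, 'k, 'g) gmodule"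
  interpret T: module K ?T by (rule trivial_module)
  have "e \<in> gmodule_homs K G (P 0) ?T" using resolution by (simp add: projective_resolution_def)
  then have e: "e \<in> linear_maps K (P 0) ?T" by (rule gmodule_homs_linear)
  have exact: "{x \<in> carrier (P 0). e x = \<zero>\<^bsub>?T\<^esub>} = d 0 ` carrier (P (Suc 0))"
    using resolution by (simp add: projective_resolution_def trivial_gmodule_def)
  have z: "(\<lambda>_. \<zero>\<^bsub>P 0\<^esub>) \<in> gmodule_homs K G (P 0) (P 0)" by (rule gmodule_homs_zero[OF P])
  have rank: "finite_rank K ?T ((\<lambda>x. e (x \<ominus>\<^bsub>P 0\<^esub> \<zero>\<^bsub>P 0\<^esub>)) ` carrier (P 0))"
  proof -
    have one: "{\<one>\<^bsub>K\<^esub>} \<subseteq> carrier ?T" by (simp add: trivial_gmodule_def)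
    have "c \<in> submodule_hull K ?T {\<one>\<^bsub>K\<^esub>}" if "c \<in> carrier ?T" for c
    proof -
      have "\<one>\<^bsub>K\<^esub> \<in> submodule_hull K ?T {\<one>\<^bsub>K\<^esub>}" by (rule subsetD[OF submodule_hull_incl]) simp
      moreover have "c \<in> carrier K" using that by (simp add: trivial_gmodule_def)
      ultimately have "c \<odot>\<^bsub>?T\<^esub> \<one>\<^bsub>K\<^esub> \<in> submodule_hull K ?T {\<one>\<^bsub>K\<^esub>}"
        by (intro T.submoduleE(4)[OF submodule_hull_submodule[OF T.module_axioms one]])
      moreover have "c \<odot>\<^bsub>?T\<^esub> \<one>\<^bsub>K\<^esub> = c" using that by (simp add: trivial_gmodule_def)
      ultimately show ?thesis by (simp only:)
    qed
    moreover have "e (x \<ominus>\<^bsub>P 0\<^esub> \<zero>\<^bsub>P 0\<^esub>) \<in> carrier ?T" if "x \<in> carrier (P 0)" for x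
      using linear_maps_closed[OF e] that P0.M.minus_closed by simp
    ultimately show ?thesis
      unfolding finite_rank_def using one by (intro exI[of _ "{\<one>\<^bsub>K\<^esub>}"]) auto
  qed
  obtain s W where "s \<in> gmodule_homs K G (P 0) (P (Suc 0))" "submodule W K (P 0)" "gact_closed_subset G (P 0) W"
      "finite_rank K (P 0) W"
      "\<forall>x \<in> carrier (P 0). (x \<ominus>\<^bsub>P 0\<^esub> \<zero>\<^bsub>P 0\<^esub>) \<ominus>\<^bsub>P 0\<^esub> d 0 (s x) \<in> W"
    by (rule lift_modulo_finite_rank[OF field finite_group projective P d trivial_module e exact
        gmodule_homs_diff[OF P gmodule_homs_id z] rank])
  moreover have "factors_through_differential 0 (\<lambda>_. \<zero>\<^bsub>P 0\<^esub>)" by (simp add: factors_through_differential_def)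
  ultimately show ?case using z by blast
next
  case (Suc m)
  then obtain t s W where t: "t \<in> gmodule_homs K G (P m) (P m)" "factors_through_differential m t"
    and s: "s \<in> gmodule_homs K G (P m) (P (Suc m))"
    and W: "submodule W K (P m)" "finite_rank K (P m) W"
    and x: "\<And>x. x \<in> carrier (P m) \<Longrightarrow> (x \<ominus>\<^bsub>P m\<^esub> t x) \<ominus>\<^bsub>P m\<^esub> d m (s x) \<in> W" by blast
  interpret P0: module K "P m" by (rule group_module_module[OF P])
  interpret P1: module K "P (Suc m)" by (rule group_module_module[OF P])
  let ?t = "\<lambda>x. s (d m x)"
  have t': "?t \<in> gmodule_homs K G (P (Suc m)) (P (Suc m))" by (rule gmodule_homs_compose[OF d s])
  have "factors_through_differential (Suc m) ?t"
    using s by (auto simp: factors_through_differential_def)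
  moreover have exact: "{x \<in> carrier (P (Suc m)). d m x = \<zero>\<^bsub>P m\<^esub>} = d (Suc m) ` carrier (P (Suc (Suc m)))"
    using resolution by (simp add: projective_resolution_def)
  have "d m (x \<ominus>\<^bsub>P (Suc m)\<^esub> ?t x) \<in> W" if x1: "x \<in> carrier (P (Suc m))" for x
  proof -
    have "d m x \<in> carrier (P m)" using x1 by (rule d_closed)
    moreover have "?t x \<in> carrier (P (Suc m))" using x1 by (rule linear_maps_closed[OF gmodule_homs_linear[OF t']])
    ultimately show ?thesis
      using x[of "d m x"] x1 factors_through_differential_zero[OF t(2) x1]
        linear_maps_minus[OF P1.module_axioms P0.module_axioms gmodule_homs_linear[OF d] x1, of "?t x"]
      by (simp add: module_minus_zero[OF P0.module_axioms])
  qed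
  then have "(\<lambda>x. d m (x \<ominus>\<^bsub>P (Suc m)\<^esub> ?t x)) ` carrier (P (Suc m)) \<subseteq> W" by auto
  then have rank: "finite_rank K (P m) ((\<lambda>x. d m (x \<ominus>\<^bsub>P (Suc m)\<^esub> ?t x)) ` carrier (P (Suc m)))"
    by (rule finite_rank_subset[OF W(2)])
  obtain s' W' where "s' \<in> gmodule_homs K G (P (Suc m)) (P (Suc (Suc m)))" "submodule W' K (P (Suc m))"
      "gact_closed_subset G (P (Suc m)) W'" "finite_rank K (P (Suc m)) W'"
      "\<forall>x \<in> carrier (P (Suc m)). (x \<ominus>\<^bsub>P (Suc m)\<^esub> ?t x) \<ominus>\<^bsub>P (Suc m)\<^esub> d (Suc m) (s' x) \<in> W'"
    by (rule lift_modulo_finite_rank[OF field finite_group projective P d P0.module_axioms gmodule_homs_linear[OF d] exact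
        gmodule_homs_diff[OF P gmodule_homs_id t'] rank])
  ultimately show ?case using t' by blast
qed

text \<open>
  Composing a cocycle \<open>c\<close> with the homotopy formula gives \<open>c = c \<circ> t + c \<circ> d \<circ> s + c \<circ> \<rho>\<close>.  The first term
  is a coboundary since \<open>t\<close> factors through the differential, the second vanishes, and \<open>\<rho>\<close> has finite
  rank.
\<close>

lemma cocycle_finite_rank:
  assumes M: "group_module K G M" and c: "c \<in> cocycles K G P d m M"
  obtains c' E where "c' \<in> cocycles K G P d m M" "ext_class m M c' = ext_class m M c"
    "finite E" "E \<subseteq> carrier M" "\<And>x. x \<in> carrier (P m) \<Longrightarrow> c' x \<in> submodule_hull K M E"
proof -
  obtain t s W where t: "t \<in> gmodule_homs K G (P m) (P m)" "factors_through_differential m t"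
    and s: "s \<in> gmodule_homs K G (P m) (P (Suc m))"
    and W: "submodule W K (P m)" "finite_rank K (P m) W"
    and x: "\<forall>x \<in> carrier (P m). (x \<ominus>\<^bsub>P m\<^esub> t x) \<ominus>\<^bsub>P m\<^esub> d m (s x) \<in> W"
    using identity_homotopic_to_finite_rank[of m] by (elim exE conjE)
  interpret Pm: module K "P m" by (rule group_module_module[OF P])
  interpret M: module K M by (rule group_module_module[OF M])
  interpret H: module K "Hom m M" by (rule Hom_module[OF M])
  let ?\<rho> = "\<lambda>x. (x \<ominus>\<^bsub>P m\<^esub> t x) \<ominus>\<^bsub>P m\<^esub> d m (s x)"
  have \<rho>: "?\<rho> \<in> gmodule_homs K G (P m) (P m)"
    by (rule gmodule_homs_diff[OF P gmodule_homs_diff[OF P gmodule_homs_id t(1)] gmodule_homs_compose[OF s d]])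
  have ch: "c \<in> carrier (Hom m M)" "c \<in> gmodule_homs K G (P m) M" using c by (auto simp: cocycles_iff hom_module_carrier)
  note cl = gmodule_homs_linear[OF ch(2)]
  define c' where "c' = compose (carrier (P m)) c ?\<rho>"
  define b where "b = compose (carrier (P m)) c t"
  have c'h: "c' \<in> carrier (Hom m M)"
    unfolding c'_def by (rule linear_maps_closed[OF pre_compose_linear[OF P P M \<rho>] ch(1)])
  have bh: "b \<in> carrier (Hom m M)"
    unfolding b_def by (rule linear_maps_closed[OF pre_compose_linear[OF P P M t(1)] ch(1)])
  have b: "b \<in> coboundaries K G P d m M"
  proof (cases m)
    case 0
    then have "b = \<zero>\<^bsub>Hom m M\<^esub>"
      using t(2) linear_maps_zero[OF Pm.module_axioms M.module_axioms cl]
      by (auto simp: b_def factors_through_differential_def compose_def hom_module_simps intro!: restrict_ext)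
    then show ?thesis using 0 by simp
  next
    case (Suc n)
    then obtain u where u: "u \<in> gmodule_homs K G (P n) (P m)" "\<And>x. x \<in> carrier (P m) \<Longrightarrow> t x = u (d n x)"
      using t(2) by (auto simp: factors_through_differential_def)
    have "compose (carrier (P n)) c u \<in> carrier (Hom n M)"
      by (rule linear_maps_closed[OF pre_compose_linear[OF P P M u(1)] ch(1)])
    moreover have "b = compose (carrier (P m)) (compose (carrier (P n)) c u) (d n)"
      using Suc u(2) d_closed by (auto simp: b_def compose_def intro!: restrict_ext)
    ultimately show ?thesis using Suc by auto
  qed
  have "c \<ominus>\<^bsub>Hom m M\<^esub> c' = b"
  proof (rule hom_module_eqI[OF H.M.minus_closed[OF ch(1) c'h] bh])
    fix x assume x: "x \<in> carrier (P m)"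
    have tx: "t x \<in> carrier (P m)" by (rule linear_maps_closed[OF gmodule_homs_linear[OF t(1)] x])
    have sx: "s x \<in> carrier (P (Suc m))" by (rule linear_maps_closed[OF gmodule_homs_linear[OF s] x])
    have "c (d m (s x)) = \<zero>\<^bsub>M\<^esub>" using c sx by (simp add: cocycles_iff)
    then have "c (?\<rho> x) = c x \<ominus>\<^bsub>M\<^esub> c (t x)"
      using x tx d_closed[OF sx] linear_maps_closed[OF cl] linear_maps_minus[OF Pm.module_axioms M.module_axioms cl]
      by (simp add: M.M.minus_eq)
    then have "c x \<ominus>\<^bsub>M\<^esub> c (?\<rho> x) = c (t x)"
      using x tx linear_maps_closed[OF cl] by (simp add: M.M.minus_eq M.M.minus_add M.M.a_assoc[symmetric] M.M.r_neg)
    then show "(c \<ominus>\<^bsub>Hom m M\<^esub> c') x = b x"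
      using hom_module_minus_apply[OF P M ch(1) c'h x] x by (simp add: c'_def b_def compose_eq)
  qed
  with b have cob: "c \<ominus>\<^bsub>Hom m M\<^esub> c' \<in> coboundaries K G P d m M" by simp
  have diff: "c' = c \<ominus>\<^bsub>Hom m M\<^esub> (c \<ominus>\<^bsub>Hom m M\<^esub> c')"
    using ch(1) c'h by (simp add: H.M.minus_eq H.M.minus_add H.M.a_assoc[symmetric] H.M.r_neg)
  have "c \<ominus>\<^bsub>Hom m M\<^esub> (c \<ominus>\<^bsub>Hom m M\<^esub> c') \<in> cocycles K G P d m M"
    by (rule submodule_minus[OF H.module_axioms cocycles_submodule[OF M] c subsetD[OF coboundaries_cocycles[OF M] cob]])
  then have c': "c' \<in> cocycles K G P d m M" by (subst diff)
  have eq: "ext_class m M c' = ext_class m M c" using ext_class_eq_iff[OF M c c'] cob by simp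
  obtain E where E: "finite E" "E \<subseteq> carrier (P m)" "W \<subseteq> submodule_hull K (P m) E"
    using W(2) by (auto simp: finite_rank_def)
  have "c' y \<in> submodule_hull K M (c ` E)" if y: "y \<in> carrier (P m)" for y
  proof -
    have "?\<rho> y \<in> submodule_hull K (P m) E" using x y E(3) by blast
    then have "c (?\<rho> y) \<in> submodule_hull K M (c ` E)"
      by (rule linear_maps_image_hull[OF Pm.module_axioms M.module_axioms cl E(2)])
    then show ?thesis using y by (simp add: c'_def compose_eq)
  qed
  moreover have "finite (c ` E)" "c ` E \<subseteq> carrier M" using E linear_maps_closed[OF cl] by auto
  ultimately show ?thesis by (intro that[OF c' eq])
qed

end

section \<open>Products of homotopy classes of loops\<close>

lemma continuous_map_join:
  assumes f: "continuous_map (prod_topology X' (top_of_set {0..1::real})) S f"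
    and h: "continuous_map (prod_topology X' (top_of_set {0..1})) S h"
    and eq: "\<And>s. s \<in> topspace X' \<Longrightarrow> f (s, 1) = h (s, 0)"
  shows "continuous_map (prod_topology X' (top_of_set {0..1})) S
    (\<lambda>z. if snd z \<le> 1/2 then f (fst z, 2 * snd z) else h (fst z, 2 * snd z - 1))"
proof (rule continuous_map_cases_le)
  let ?X = "prod_topology X' (top_of_set {0..1::real})"
  have snd: "continuous_map (subtopology ?X V) euclideanreal snd" for V
    by (rule continuous_map_into_fulltopology[OF continuous_map_from_subtopology[OF continuous_map_snd]])
  have fst: "continuous_map (subtopology ?X V) X' fst" for V
    by (rule continuous_map_from_subtopology[OF continuous_map_fst])
  show "continuous_map ?X euclideanreal snd"
    by (rule continuous_map_into_fulltopology[OF continuous_map_snd])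
  show "continuous_map ?X euclideanreal (\<lambda>z. 1/2)" by simp
  let ?V = "{z \<in> topspace ?X. snd z \<le> 1/2}" and ?W = "{z \<in> topspace ?X. 1/2 \<le> snd z}"
  have "continuous_map (subtopology ?X ?V) (top_of_set {0..1}) (\<lambda>z. 2 * snd z)"
    using snd[of ?V] by (auto simp: continuous_map_in_subtopology intro!: continuous_map_real_mult_left)
  from continuous_map_compose[OF continuous_map_pairedI[OF fst this] f]
  show "continuous_map (subtopology ?X ?V) S (\<lambda>z. f (fst z, 2 * snd z))" by (simp add: o_def)
  have "continuous_map (subtopology ?X ?W) (top_of_set {0..1}) (\<lambda>z. 2 * snd z - 1)"
    using snd[of ?W]
    by (auto simp: continuous_map_in_subtopology intro!: continuous_map_real_mult_left continuous_map_diff)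
  from continuous_map_compose[OF continuous_map_pairedI[OF fst this] h]
  show "continuous_map (subtopology ?X ?W) S (\<lambda>z. h (fst z, 2 * snd z - 1))" by (simp add: o_def)
  show "f (fst z, 2 * snd z) = h (fst z, 2 * snd z - 1)" if "z \<in> topspace ?X" "snd z = 1/2" for z
  proof -
    have "2 * snd z = 1" using that(2) by simp
    then show ?thesis using that(1) eq[of "fst z"] by auto
  qed
qed

text \<open>
  The two homotopies are joined at each time; they agree where they meet because both keep the base
  point fixed.
\<close>

lemma join_loops_homotopic:
  assumes p: "homotopic_with (\<lambda>r. r 0 = x \<and> r 1 = x) (top_of_set {0..1}) S p p'"
    and q: "homotopic_with (\<lambda>r. r 0 = x \<and> r 1 = x) (top_of_set {0..1}) S q q'"
  shows "homotopic_with (\<lambda>r. r 0 = x \<and> r 1 = x) (top_of_set {0..1}) S (join_loops p q) (join_loops p' q')"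
proof -
  obtain h where h: "continuous_map (prod_topology (top_of_set {0..1::real}) (top_of_set {0..1})) S h"
      "\<And>t. h (0, t) = p t" "\<And>t. h (1, t) = p' t" "\<And>s. s \<in> {0..1} \<Longrightarrow> h (s, 0) = x \<and> h (s, 1) = x"
    using p unfolding homotopic_with_def by auto
  obtain k where k: "continuous_map (prod_topology (top_of_set {0..1::real}) (top_of_set {0..1})) S k"
      "\<And>t. k (0, t) = q t" "\<And>t. k (1, t) = q' t" "\<And>s. s \<in> {0..1} \<Longrightarrow> k (s, 0) = x \<and> k (s, 1) = x"
    using q unfolding homotopic_with_def by auto
  show ?thesis
    unfolding homotopic_with_def
    by (rule exI, intro conjI, rule continuous_map_join[OF h(1) k(1)])
      (use h k in \<open>auto simp: join_loops_def\<close>)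
qed

lemma loop_class_eq:
  assumes "homotopic_with (\<lambda>r. r 0 = x \<and> r 1 = x) (top_of_set {0..1}) S p q"
  shows "loop_class S x p = loop_class S x q"
  unfolding loop_class_def using assms homotopic_with_trans homotopic_with_sym by blast

lemma based_loops_iff:
  "p \<in> based_loops S x \<longleftrightarrow> homotopic_with (\<lambda>r. r 0 = x \<and> r 1 = x) (top_of_set {0..1}) S p p"
  by (auto simp: based_loops_def pathin_def)

text \<open>
  The product of two classes is a union of classes, one for each pair of representatives; by
  \<open>join_loops_homotopic\<close> these are all the same class.
\<close>

lemma fundamental_group_mult_closed:
  assumes "A \<in> carrier (fundamental_group S x)" "B \<in> carrier (fundamental_group S x)"
  shows "A \<otimes>\<^bsub>fundamental_group S x\<^esub> B \<in> carrier (fundamental_group S x)"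
proof -
  obtain p q where p: "p \<in> based_loops S x" "A = loop_class S x p" and q: "q \<in> based_loops S x" "B = loop_class S x q"
    using assms by (auto simp: fundamental_group_def)
  have j: "join_loops p q \<in> based_loops S x"
    using p(1) q(1) unfolding based_loops_iff by (rule join_loops_homotopic)
  have "loop_class S x (join_loops p' q') = loop_class S x (join_loops p q)" if "p' \<in> A" "q' \<in> B" for p' q'
  proof -
    have "homotopic_with (\<lambda>r. r 0 = x \<and> r 1 = x) (top_of_set {0..1}) S p p'"
      "homotopic_with (\<lambda>r. r 0 = x \<and> r 1 = x) (top_of_set {0..1}) S q q'"
      using that p(2) q(2) by (auto simp: loop_class_def)
    from loop_class_eq[OF join_loops_homotopic[OF this]] show ?thesis by simp
  qed
  moreover have "p \<in> A" "q \<in> B" using p q by (auto simp: loop_class_def based_loops_iff)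
  ultimately have "(\<Union>p'\<in>A. \<Union>q'\<in>B. loop_class S x (join_loops p' q')) = loop_class S x (join_loops p q)" by blast
  then show ?thesis using j by (simp add: fundamental_group_def)
qed

section \<open>Conjugation of homomorphisms\<close>

text \<open>
  \<open>conj_hom\<close> produces extensional functions, whose values off the carrier of \<open>\<Gamma>\<close> are unspecified.  That
  conjugation preserves the homomorphism equation for \<open>\<gamma>\<close> and \<open>\<delta>\<close> thus requires their product to be in the
  carrier.
\<close>

locale conjugated_homs = G: group G
  for \<Gamma> :: "('s, 'c) monoid_scheme" and G :: "('g, 'b) monoid_scheme" (structure) +
  fixes U :: "'g set"
  assumes \<Gamma>_closed: "\<lbrakk>\<gamma> \<in> carrier \<Gamma>; \<delta> \<in> carrier \<Gamma>\<rbrakk> \<Longrightarrow> \<gamma> \<otimes>\<^bsub>\<Gamma>\<^esub> \<delta> \<in> carrier \<Gamma>"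
    and U: "subgroup U G"
begin

abbreviation "C \<equiv> centralizer G U"
abbreviation "N \<equiv> normalizer G U"
abbreviation "\<Omega> \<equiv> homs_onto \<Gamma> G U"
abbreviation "\<Omega>' \<equiv> \<Union>V\<in>conjugacy_class G U. homs_onto \<Gamma> G V"
abbreviation "cj \<equiv> conj_hom \<Gamma> G"

lemma inv_cancel [simp]:
  assumes "a \<in> carrier G" "b \<in> carrier G"
  shows "inv a \<otimes> (a \<otimes> b) = b" "a \<otimes> (inv a \<otimes> b) = b"
  using assms by (simp_all add: G.m_assoc[symmetric])

lemma U_sub: "u \<in> U \<Longrightarrow> u \<in> carrier G" using subgroup.mem_carrier[OF U] .

lemma conj_set: "V \<subseteq> carrier G \<Longrightarrow> a \<in> carrier G \<Longrightarrow> a <# V #> inv a = (\<lambda>v. a \<otimes> v \<otimes> inv a) ` V"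
  by (auto simp: l_coset_def r_coset_def)

lemma homs_onto_closed: "f \<in> homs_onto \<Gamma> G V \<Longrightarrow> \<gamma> \<in> carrier \<Gamma> \<Longrightarrow> f \<gamma> \<in> carrier G"
  by (auto simp: homs_onto_def hom_def)

lemma homs_onto_image: "f \<in> homs_onto \<Gamma> G V \<Longrightarrow> f ` carrier \<Gamma> = V"
  by (simp add: homs_onto_def)

lemma cj_closed:
  assumes f: "f \<in> homs_onto \<Gamma> G V" and a: "a \<in> carrier G"
  shows "cj a f \<in> homs_onto \<Gamma> G (a <# V #> inv a)"
proof -
  note fc = homs_onto_closed[OF f]
  have V: "V \<subseteq> carrier G" using fc homs_onto_image[OF f] by auto
  have "a \<otimes> (f \<gamma> \<otimes> f \<delta>) \<otimes> inv a = (a \<otimes> f \<gamma> \<otimes> inv a) \<otimes> (a \<otimes> f \<delta> \<otimes> inv a)"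
    if "\<gamma> \<in> carrier \<Gamma>" "\<delta> \<in> carrier \<Gamma>" for \<gamma> \<delta>
    using a fc that by (simp add: G.m_assoc)
  then have "cj a f \<in> hom \<Gamma> G"
    using f a fc by (auto simp: hom_def conj_hom_def \<Gamma>_closed homs_onto_def)
  moreover have "cj a f ` carrier \<Gamma> = a <# V #> inv a"
    using conj_set[OF V a] homs_onto_image[OF f] by (auto simp: conj_hom_def image_iff)
  ultimately show ?thesis by (simp add: homs_onto_def conj_hom_def)
qed

lemma cj_mult:
  assumes f: "f \<in> homs_onto \<Gamma> G V" and "a \<in> carrier G" "b \<in> carrier G"
  shows "cj (a \<otimes> b) f = cj a (cj b f)"
  using assms homs_onto_closed[OF f] by (auto simp: conj_hom_def G.m_assoc G.inv_mult_group intro!: restrict_ext)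

lemma cj_one: "f \<in> homs_onto \<Gamma> G V \<Longrightarrow> cj \<one> f = f"
  using homs_onto_closed[of f V] by (auto simp: conj_hom_def homs_onto_def extensional_def fun_eq_iff)

lemma centralizer_subgroup: "subgroup C G"
proof (rule G.subgroupI)
  show "C \<subseteq> carrier G" by (auto simp: centralizer_def)
  have "\<one> \<in> C" using U_sub by (simp add: centralizer_def)
  then show "C \<noteq> {}" by blast
next
  fix a assume "a \<in> C"
  then have a: "a \<in> carrier G" "\<And>u. u \<in> U \<Longrightarrow> a \<otimes> u = u \<otimes> a" by (auto simp: centralizer_def)
  have "inv a \<otimes> u = u \<otimes> inv a" if u: "u \<in> U" for u
  proof -
    have "inv a \<otimes> (a \<otimes> u) \<otimes> inv a = inv a \<otimes> (u \<otimes> a) \<otimes> inv a" using a(2)[OF u] by simp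
    then show ?thesis using a(1) U_sub[OF u] by (simp add: G.m_assoc)
  qed
  then show "inv a \<in> C" using a by (simp add: centralizer_def)
  fix b assume "b \<in> C"
  then have b: "b \<in> carrier G" "\<And>u. u \<in> U \<Longrightarrow> b \<otimes> u = u \<otimes> b" by (auto simp: centralizer_def)
  have "a \<otimes> b \<otimes> u = u \<otimes> (a \<otimes> b)" if u: "u \<in> U" for u
  proof -
    have "a \<otimes> b \<otimes> u = a \<otimes> u \<otimes> b" using a(1) b U_sub[OF u] b(2)[OF u] by (simp add: G.m_assoc)
    also have "\<dots> = u \<otimes> (a \<otimes> b)" using a b(1) U_sub[OF u] a(2)[OF u] by (simp add: G.m_assoc)
    finally show ?thesis .
  qed
  then show "a \<otimes> b \<in> C" using a b by (simp add: centralizer_def)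
qed

lemma coset_eq_iff_diff:
  assumes "a \<in> carrier G" "b \<in> carrier G"
  shows "a <# C = b <# C \<longleftrightarrow> inv a \<otimes> b \<in> C"
proof
  assume "a <# C = b <# C"
  then have "b \<in> a <# C" using G.lcos_self[OF assms(2) centralizer_subgroup] by simp
  then show "inv a \<otimes> b \<in> C"
    using subgroup.lcos_module_imp[OF centralizer_subgroup G.group_axioms assms(1)] by simp
next
  assume "inv a \<otimes> b \<in> C"
  then have "b \<in> a <# C"
    using assms by (auto simp: l_coset_def intro!: bexI[of _ "inv a \<otimes> b"])
  then show "a <# C = b <# C"
    using G.l_repr_independence[OF _ assms(1) centralizer_subgroup] by simp
qed

text \<open>
  The condition \<open>a f(\<gamma>) a\<inverse> = b f(\<gamma>) b\<inverse>\<close> means that \<open>a\<inverse> b\<close> commutes with \<open>f(\<gamma>)\<close>, and the values of \<open>f\<close> are the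
  elements of \<open>U\<close>.
\<close>

lemma cj_eq_iff:
  assumes f: "f \<in> \<Omega>" and a: "a \<in> carrier G" "b \<in> carrier G"
  shows "cj a f = cj b f \<longleftrightarrow> a <# C = b <# C"
proof -
  have "a \<otimes> u \<otimes> inv a = b \<otimes> u \<otimes> inv b \<longleftrightarrow> (inv a \<otimes> b) \<otimes> u = u \<otimes> (inv a \<otimes> b)" if "u \<in> U" for u
  proof -
    have u: "u \<in> carrier G" using U_sub that .
    have "a \<otimes> u \<otimes> inv a = b \<otimes> u \<otimes> inv b \<longleftrightarrow> inv a \<otimes> (a \<otimes> u \<otimes> inv a) \<otimes> b = inv a \<otimes> (b \<otimes> u \<otimes> inv b) \<otimes> b"
      using a u by simp
    also have "inv a \<otimes> (a \<otimes> u \<otimes> inv a) \<otimes> b = u \<otimes> (inv a \<otimes> b)"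
      using a u by (simp add: G.m_assoc)
    also have "inv a \<otimes> (b \<otimes> u \<otimes> inv b) \<otimes> b = (inv a \<otimes> b) \<otimes> u"
      using a u by (simp add: G.m_assoc)
    finally show ?thesis by auto
  qed
  then have "cj a f = cj b f \<longleftrightarrow> (\<forall>u \<in> U. (inv a \<otimes> b) \<otimes> u = u \<otimes> (inv a \<otimes> b))"
    using homs_onto_image[OF f] by (auto simp: conj_hom_def fun_eq_iff)
  also have "\<dots> \<longleftrightarrow> inv a \<otimes> b \<in> C" using a by (auto simp: centralizer_def)
  finally show ?thesis using coset_eq_iff_diff[OF a] by simp
qed

lemma normalizer_iff: "b \<in> N \<longleftrightarrow> b \<in> carrier G \<and> b <# U #> inv b = U"
  using subgroup.subset[OF U] by (auto simp: normalizer_def stabilizer_def)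

lemma cj_normalizer: "f \<in> \<Omega> \<Longrightarrow> b \<in> N \<Longrightarrow> cj b f \<in> \<Omega>"
  using cj_closed[of f U b] by (auto simp: normalizer_iff)

lemma normalizerI: "f \<in> \<Omega> \<Longrightarrow> b \<in> carrier G \<Longrightarrow> cj b f \<in> \<Omega> \<Longrightarrow> b \<in> N"
  using cj_closed[of f U b] homs_onto_image[of "cj b f"] by (auto simp: normalizer_iff)

lemma normalizer_subgroup: "subgroup N G"
  by (rule G.normalizer_imp_subgroup[OF subgroup.subset[OF U]])

lemma centralizer_normalizer: "c \<in> C \<Longrightarrow> c \<in> N"
proof -
  assume c: "c \<in> C"
  then have cc: "c \<in> carrier G" and "\<And>u. u \<in> U \<Longrightarrow> c \<otimes> u = u \<otimes> c" by (auto simp: centralizer_def)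
  then have "c \<otimes> u \<otimes> inv c = u" if "u \<in> U" for u using that U_sub[OF that] by (simp add: G.m_assoc)
  then have "(\<lambda>u. c \<otimes> u \<otimes> inv c) ` U = U" by auto
  then show "c \<in> N" using conj_set[OF subgroup.subset[OF U] cc] cc by (simp add: normalizer_iff)
qed

lemma normalizer_conj_centralizer:
  assumes b: "b \<in> N" and c: "c \<in> C"
  shows "inv b \<otimes> c \<otimes> b \<in> C"
proof -
  have bc: "b \<in> carrier G" "c \<in> carrier G" using b c by (auto simp: normalizer_iff centralizer_def)
  have "(inv b \<otimes> c \<otimes> b) \<otimes> u = u \<otimes> (inv b \<otimes> c \<otimes> b)" if u: "u \<in> U" for u
  proof -
    have uc: "u \<in> carrier G" using U_sub[OF u] .
    have "b \<otimes> u \<otimes> inv b \<in> U"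
      using b u conj_set[OF subgroup.subset[OF U] bc(1)] by (auto simp: normalizer_iff)
    then have "c \<otimes> (b \<otimes> u \<otimes> inv b) = (b \<otimes> u \<otimes> inv b) \<otimes> c" using c by (auto simp: centralizer_def)
    then have "inv b \<otimes> (c \<otimes> (b \<otimes> u \<otimes> inv b)) \<otimes> b = inv b \<otimes> ((b \<otimes> u \<otimes> inv b) \<otimes> c) \<otimes> b" by simp
    moreover have "inv b \<otimes> (c \<otimes> (b \<otimes> u \<otimes> inv b)) \<otimes> b = (inv b \<otimes> c \<otimes> b) \<otimes> u"
      using bc uc by (simp add: G.m_assoc)
    moreover have "inv b \<otimes> ((b \<otimes> u \<otimes> inv b) \<otimes> c) \<otimes> b = u \<otimes> (inv b \<otimes> c \<otimes> b)"
      using bc uc by (simp add: G.m_assoc)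
    ultimately show ?thesis by simp
  qed
  then show ?thesis using bc by (simp add: centralizer_def)
qed

lemma centralizer_rcoset:
  assumes b: "b \<in> N"
  shows "C #> b = b <# C"
proof -
  have bc: "b \<in> carrier G" using b by (simp add: normalizer_iff)
  have ib: "inv b \<in> N" using subgroup.m_inv_closed[OF normalizer_subgroup b] .
  have C: "c \<in> carrier G" if "c \<in> C" for c using that by (simp add: centralizer_def)
  show ?thesis
  proof
    show "C #> b \<subseteq> b <# C"
    proof
      fix y assume "y \<in> C #> b"
      then obtain c where c: "c \<in> C" "y = c \<otimes> b" by (auto simp: r_coset_def)
      then have "y = b \<otimes> (inv b \<otimes> c \<otimes> b)" using bc C by (simp add: G.m_assoc)
      then show "y \<in> b <# C" using normalizer_conj_centralizer[OF b c(1)] by (auto simp: l_coset_def)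
    qed
    show "b <# C \<subseteq> C #> b"
    proof
      fix y assume "y \<in> b <# C"
      then obtain c where c: "c \<in> C" "y = b \<otimes> c" by (auto simp: l_coset_def)
      then have "y = (b \<otimes> c \<otimes> inv b) \<otimes> b" using bc C by (simp add: G.m_assoc)
      then show "y \<in> C #> b"
        using normalizer_conj_centralizer[OF ib c(1)] bc by (auto simp: r_coset_def)
    qed
  qed
qed

abbreviation "Z \<equiv> normalizer_quotient G U"

lemma Z_carrier: "carrier Z = (\<lambda>b. b <# C) ` N"
  by (auto simp: normalizer_quotient_def FactGroup_def RCOSETS_def r_coset_def simp flip: centralizer_rcoset)

lemma Z_some:
  assumes "z \<in> carrier Z"
  shows "(SOME b. b \<in> z) \<in> N" "z = (SOME b. b \<in> z) <# C"
proof -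
  obtain b where b: "b \<in> N" "z = b <# C" using assms Z_carrier by auto
  have bc: "b \<in> carrier G" using b by (simp add: normalizer_iff)
  have "b \<in> z" using G.lcos_self[OF bc centralizer_subgroup] b(2) by simp
  then have s: "(SOME b. b \<in> z) \<in> b <# C" using someI[of "\<lambda>b. b \<in> z"] b(2) by simp
  then obtain c where "c \<in> C" "(SOME b. b \<in> z) = b \<otimes> c" by (auto simp: l_coset_def)
  then show "(SOME b. b \<in> z) \<in> N"
    using b(1) centralizer_normalizer subgroup.m_closed[OF normalizer_subgroup] by simp
  show "z = (SOME b. b \<in> z) <# C"
    using G.l_repr_independence[OF s bc centralizer_subgroup] b(2) by simp
qed

lemma lcoset_some:
  assumes "A \<in> lcosets C"
  shows "(SOME a. a \<in> A) \<in> carrier G" "A = (SOME a. a \<in> A) <# C"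
proof -
  obtain a where a: "a \<in> carrier G" "A = a <# C" using assms by (auto simp: LCOSETS_def)
  have "a \<in> A" using G.lcos_self[OF a(1) centralizer_subgroup] a(2) by simp
  then have s: "(SOME a. a \<in> A) \<in> a <# C" using someI[of "\<lambda>a. a \<in> A"] a(2) by simp
  then show "(SOME a. a \<in> A) \<in> carrier G"
    using subgroup.elemlcos_carrier[OF centralizer_subgroup G.group_axioms a(1)] by simp
  show "A = (SOME a. a \<in> A) <# C"
    using G.l_repr_independence[OF s a(1) centralizer_subgroup] a(2) by simp
qed

lemma lcosetI: "a \<in> carrier G \<Longrightarrow> a <# C \<in> lcosets C"
  by (auto simp: LCOSETS_def)

lemma lcosetE:
  assumes "A \<in> lcosets C"
  obtains a where "a \<in> carrier G" "A = a <# C"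
  using assms by (auto simp: LCOSETS_def)

lemma C_sub: "C \<subseteq> carrier G" by (auto simp: centralizer_def)

lemma left_translate: "a \<in> carrier G \<Longrightarrow> b \<in> carrier G \<Longrightarrow> a <# (b <# C) = (a \<otimes> b) <# C"
  by (rule G.lcos_m_assoc[OF C_sub])

text \<open>
  As \<open>b\<close> normalizes \<open>C\<close>, the set \<open>C b C\<close> is the single coset \<open>b C\<close>.
\<close>

lemma right_translate:
  assumes a: "a \<in> carrier G" and b: "b \<in> N"
  shows "(a <# C) <#> (b <# C) = (a \<otimes> b) <# C"
proof -
  have bc: "b \<in> carrier G" using b by (simp add: normalizer_iff)
  have "(a <# C) <#> (b <# C) = a <# (C <#> (b <# C))"
    using a bc C_sub G.l_coset_subset_G[OF C_sub bc]
    by (auto simp: l_coset_def set_mult_def G.m_assoc subset_iff)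
  also have "C <#> (b <# C) = C <#> (C #> b)" by (simp add: centralizer_rcoset[OF b])
  also have "\<dots> = (C <#> C) #> b" by (rule G.setmult_rcos_assoc[OF C_sub C_sub bc])
  also have "\<dots> = b <# C" using G.subgroup_mult_id[OF centralizer_subgroup] centralizer_rcoset[OF b] by simp
  finally show ?thesis using left_translate[OF a bc] by simp
qed

text \<open>
  The map \<open>G/C \<rightarrow> \<Omega>'\<close> whose image is the orbit of \<open>f\<close>.  By \<open>cj_eq_iff\<close> it does not depend on the chosen
  element of the coset and is injective.
\<close>

definition orbit_map :: "('s \<Rightarrow> 'g) \<Rightarrow> 'g set \<Rightarrow> 's \<Rightarrow> 'g"
  where "orbit_map f A = cj (SOME a. a \<in> A) f"

lemma orbit_map_coset: "f \<in> \<Omega> \<Longrightarrow> a \<in> carrier G \<Longrightarrow> orbit_map f (a <# C) = cj a f"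
  unfolding orbit_map_def using lcoset_some[OF lcosetI[of a]] by (subst cj_eq_iff) auto

lemma orbit_map_inj: "f \<in> \<Omega> \<Longrightarrow> inj_on (orbit_map f) (lcosets C)"
  by (rule inj_onI) (auto elim!: lcosetE simp: orbit_map_coset cj_eq_iff)

lemma cj_\<Omega>': "f \<in> \<Omega> \<Longrightarrow> a \<in> carrier G \<Longrightarrow> cj a f \<in> \<Omega>'"
  using cj_closed[of f U a] by (auto simp: conjugacy_class_def)

lemma orbit_map_closed: "f \<in> \<Omega> \<Longrightarrow> A \<in> lcosets C \<Longrightarrow> orbit_map f A \<in> \<Omega>'"
  by (auto elim!: lcosetE simp only: orbit_map_coset cj_\<Omega>')

lemma \<Omega>'_cases:
  assumes "h \<in> \<Omega>'"
  obtains a f where "a \<in> carrier G" "f \<in> \<Omega>" "h = cj a f"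
proof -
  obtain a where a: "a \<in> carrier G" "h \<in> homs_onto \<Gamma> G (a <# U #> inv a)"
    using assms by (auto simp: conjugacy_class_def)
  have Us: "U \<subseteq> carrier G" by (rule subgroup.subset[OF U])
  have aU: "a <# U #> inv a \<subseteq> carrier G" using conj_set[OF Us a(1)] a(1) U_sub by auto
  have "inv a <# (a <# U #> inv a) #> inv (inv a) = (\<lambda>u. inv a \<otimes> (a \<otimes> u \<otimes> inv a) \<otimes> a) ` U"
    using conj_set[OF aU, of "inv a"] conj_set[OF Us a(1)] a(1) by (simp add: image_image)
  also have "\<dots> = (\<lambda>u. u) ` U"
    by (rule image_cong[OF refl]) (use a(1) U_sub in \<open>simp add: G.m_assoc\<close>)
  finally have "cj (inv a) h \<in> \<Omega>" using cj_closed[OF a(2), of "inv a"] a(1) by simp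
  moreover have "h = cj a (cj (inv a) h)"
    using cj_mult[OF a(2) a(1), of "inv a"] cj_one[OF a(2)] a(1) by simp
  ultimately show ?thesis using that a(1) by blast
qed

lemma cj_\<Omega>'_closed: "h \<in> \<Omega>' \<Longrightarrow> a \<in> carrier G \<Longrightarrow> cj a h \<in> \<Omega>'"
  by (erule \<Omega>'_cases) (simp only: cj_mult[symmetric] cj_\<Omega>' G.m_closed)

lemma cj_\<Omega>'_mult: "h \<in> \<Omega>' \<Longrightarrow> a \<in> carrier G \<Longrightarrow> b \<in> carrier G \<Longrightarrow> cj (a \<otimes> b) h = cj a (cj b h)"
  using cj_mult by blast

lemma cj_\<Omega>'_one: "h \<in> \<Omega>' \<Longrightarrow> cj \<one> h = h"
  using cj_one by blast

text \<open>
  The elements of \<open>\<Omega>\<close> in the \<open>G\<close>-orbit of \<open>f\<close> form its \<open>N\<close>-orbit, by \<open>normalizerI\<close>; so quantifying over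
  \<open>G\<close> selects one element from each \<open>Z\<close>-orbit on \<open>\<Omega>\<close> and at the same time from each \<open>G\<close>-orbit on
  \<open>\<Omega>'\<close>.
\<close>

definition representative :: "('s \<Rightarrow> 'g) \<Rightarrow> 's \<Rightarrow> 'g"
  where "representative f = (SOME f'. f' \<in> \<Omega> \<and> (\<exists>b \<in> carrier G. f' = cj b f))"

definition orbit_representatives :: "('s \<Rightarrow> 'g) set"
  where "orbit_representatives = representative ` \<Omega>"

lemma representative: "f \<in> \<Omega> \<Longrightarrow> representative f \<in> \<Omega> \<and> (\<exists>b \<in> carrier G. representative f = cj b f)"
  unfolding representative_def by (rule someI[of _ f]) (use cj_one[of f U] in \<open>force intro: bexI[of _ \<one>]\<close>)

lemma orbit_representatives_sub: "orbit_representatives \<subseteq> \<Omega>"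
  using representative by (auto simp: orbit_representatives_def)

lemma cj_inv: "f \<in> homs_onto \<Gamma> G V \<Longrightarrow> b \<in> carrier G \<Longrightarrow> cj (inv b) (cj b f) = f"
  using cj_mult[of f V "inv b" b] cj_one[of f V] by simp

lemma orbit_representatives_cover:
  assumes f: "f \<in> \<Omega>"
  obtains b t where "b \<in> N" "t \<in> orbit_representatives" "f = cj b t"
proof -
  obtain b where b: "b \<in> carrier G" "representative f = cj b f" "representative f \<in> \<Omega>" using representative[OF f] by blast
  have "f = cj (inv b) (representative f)" using cj_inv[OF f b(1)] b(2) by simp
  moreover from this have "inv b \<in> N" using normalizerI[OF b(3), of "inv b"] b(1) f by simp
  ultimately show ?thesis using that f by (auto simp: orbit_representatives_def)
qed

lemma orbit_representatives_unique:
  assumes t: "t \<in> orbit_representatives" "t' \<in> orbit_representatives"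
    and a: "a \<in> carrier G" "a' \<in> carrier G" and eq: "cj a t = cj a' t'"
  shows "t = t'"
proof -
  obtain f f' where f: "f \<in> \<Omega>" "t = representative f" "f' \<in> \<Omega>" "t' = representative f'"
    using t by (auto simp: orbit_representatives_def)
  obtain b b' where b: "b \<in> carrier G" "t = cj b f" "b' \<in> carrier G" "t' = cj b' f'"
    using representative[OF f(1)] representative[OF f(3)] f by metis
  have e: "cj (a \<otimes> b) f = cj (a' \<otimes> b') f'" using eq b a f(1,3) by (simp add: cj_mult)
  have "(\<exists>c \<in> carrier G. h = cj c f) \<longleftrightarrow> (\<exists>c \<in> carrier G. h = cj c f')" for h
  proof -
    have "f = cj (inv (a \<otimes> b) \<otimes> (a' \<otimes> b')) f'"
      using cj_inv[OF f(1), of "a \<otimes> b"] e a b f(3) cj_mult[OF f(3), of "inv (a \<otimes> b)" "a' \<otimes> b'"] by simp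
    moreover have "f' = cj (inv (a' \<otimes> b') \<otimes> (a \<otimes> b)) f"
      using cj_inv[OF f(3), of "a' \<otimes> b'"] e a b f(1) cj_mult[OF f(1), of "inv (a' \<otimes> b')" "a \<otimes> b"] by simp
    ultimately show ?thesis
      using cj_mult[OF f(1)] cj_mult[OF f(3)] a b by (metis G.inv_closed G.m_closed)
  qed
  then show ?thesis using f by (simp add: representative_def)
qed

end

section \<open>The permutation module of a union of orbits\<close>

locale orbit_modules = conjugated_homs \<Gamma> G U + K: cring K
  for K :: "('k, 'a) ring_scheme" and \<Gamma> :: "('s, 'c) monoid_scheme"
    and G :: "('g, 'b) monoid_scheme" (structure) and U :: "'g set"
begin

abbreviation "FA \<equiv> free_module K (lcosets C)"
abbreviation "FO \<equiv> free_module K \<Omega>'"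
abbreviation "A \<equiv> coset_module K G C"
abbreviation "r \<equiv> coset_right_action K G C"
abbreviation "MU \<equiv> rep_module_onto K \<Gamma> G U"
abbreviation "MO \<equiv> rep_module K \<Gamma> G (conjugacy_class G U)"
abbreviation "T \<equiv> orbit_representatives"

lemma FA_module: "module K FA" and FO_module: "module K FO" and F\<Omega>_module: "module K (free_module K \<Omega>)"
  by (rule free_module_module[OF K.is_cring])+

lemma A_simps [simp]: "carrier A = carrier FA" "add A = add FA" "zero A = zero FA" "smult A = smult FA"
  by (simp_all add: coset_module_def)

lemma MO_simps [simp]: "carrier MO = carrier FO" "add MO = add FO" "zero MO = zero FO" "smult MO = smult FO"
  by (simp_all add: rep_module_def)

lemma MU_simps [simp]: "carrier MU = carrier (free_module K \<Omega>)" "add MU = add (free_module K \<Omega>)"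
    "zero MU = zero (free_module K \<Omega>)" "smult MU = smult (free_module K \<Omega>)"
  by (simp_all add: rep_module_onto_def)

lemma linear_maps_simps [simp]:
  "linear_maps K A M = linear_maps K FA M" "linear_maps K M A = linear_maps K M FA"
  "linear_maps K MO M = linear_maps K FO M" "linear_maps K M MO = linear_maps K M FO"
  "linear_maps K MU M = linear_maps K (free_module K \<Omega>) M"
  by (simp_all add: linear_maps_def)

lemma left_translate_closed: "a \<in> carrier G \<Longrightarrow> B \<in> lcosets C \<Longrightarrow> a <# B \<in> lcosets C"
  by (auto elim!: lcosetE simp: left_translate intro!: lcosetI)

lemma A_gmodule: "group_module K G A"
  unfolding coset_module_def
proof (rule permutation_module_group_module[OF K.is_cring G.group_axioms])
  fix a b B assume a: "a \<in> carrier G" "b \<in> carrier G" and B: "B \<in> lcosets C"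
  show "(a \<otimes> b) <# B = a <# (b <# B)"
    using B a by (auto elim!: lcosetE simp: left_translate G.m_assoc)
next
  fix B assume "B \<in> lcosets C"
  then show "\<one> <# B = B" by (auto elim!: lcosetE simp: left_translate)
qed (rule left_translate_closed)

lemma MO_gmodule: "group_module K G MO"
  unfolding rep_module_def
  by (rule permutation_module_group_module[OF K.is_cring G.group_axioms])
    (rule cj_\<Omega>'_closed cj_\<Omega>'_one cj_\<Omega>'_mult; assumption)+

lemma MU_module: "module K MU"
  unfolding rep_module_onto_def by (rule permutation_module_module[OF K.is_cring])

lemma A_module: "module K A" and MO_module: "module K MO"
  by (rule group_module_module[OF A_gmodule] group_module_module[OF MO_gmodule])+

lemma A_basis: "B \<in> lcosets C \<Longrightarrow> basis_vec K B \<in> carrier FA"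
  and MO_basis: "h \<in> \<Omega>' \<Longrightarrow> basis_vec K h \<in> carrier FO"
  and MU_basis: "f \<in> \<Omega> \<Longrightarrow> basis_vec K f \<in> carrier (free_module K \<Omega>)"
  by (rule basis_vec_closed[OF K.is_cring]; assumption)+

lemma A_gact: "a \<in> carrier G \<Longrightarrow> B \<in> lcosets C \<Longrightarrow> gact A a (basis_vec K B) = basis_vec K (a <# B)"
  unfolding coset_module_def permutation_module_simps
  by (rule linear_extension_basis_vec[OF FA_module]) (rule A_basis[OF left_translate_closed])

lemma MO_gact: "a \<in> carrier G \<Longrightarrow> h \<in> \<Omega>' \<Longrightarrow> gact MO a (basis_vec K h) = basis_vec K (cj a h)"
  unfolding rep_module_def permutation_module_simps
  by (rule linear_extension_basis_vec[OF FO_module]) (rule MO_basis[OF cj_\<Omega>'_closed])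

lemma r_basis_closed: "z \<in> carrier Z \<Longrightarrow> B \<in> lcosets C \<Longrightarrow> B <#> z \<in> lcosets C"
proof -
  assume z: "z \<in> carrier Z" and B: "B \<in> lcosets C"
  obtain a where a: "a \<in> carrier G" "B = a <# C" using B by (rule lcosetE)
  obtain b where b: "b \<in> N" "z = b <# C" using z Z_carrier by auto
  then have "b \<in> carrier G" by (simp add: normalizer_iff)
  then show "B <#> z \<in> lcosets C" using a b by (simp add: right_translate lcosetI)
qed

lemma r_basis: "z \<in> carrier Z \<Longrightarrow> B \<in> lcosets C \<Longrightarrow> r z (basis_vec K B) = basis_vec K (B <#> z)"
  unfolding coset_right_action_def
  by (rule linear_extension_basis_vec[OF FA_module]) (rule A_basis[OF r_basis_closed])

lemma r_hom:
  assumes z: "z \<in> carrier Z"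
  shows "r z \<in> gmodule_homs K G A A"
proof -
  have "r z \<in> linear_maps K FA A"
    unfolding coset_right_action_def linear_maps_simps
    by (rule linear_extension_linear[OF FA_module]) (rule A_basis[OF r_basis_closed[OF z]])
  moreover have "r z (basis_vec K (a <# B)) = gact A a (r z (basis_vec K B))"
    if a: "a \<in> carrier G" and B: "B \<in> lcosets C" for a B
  proof -
    obtain a' where a': "a' \<in> carrier G" "B = a' <# C" using B by (rule lcosetE)
    obtain b where b: "b \<in> N" "z = b <# C" using z Z_carrier by auto
    then have "b \<in> carrier G" by (simp add: normalizer_iff)
    then have "(a <# B) <#> z = a <# (B <#> z)"
      using a a' b by (simp add: right_translate left_translate G.m_assoc)
    then show ?thesis
      using a B by (simp add: r_basis[OF z] A_gact left_translate_closed r_basis_closed[OF z])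
  qed
  ultimately show ?thesis
    by (subst (1) coset_module_def) (rule permutation_module_homI[OF K.is_cring _ A_gmodule left_translate_closed])
qed

text \<open>
  For \<open>t \<in> T\<close> the maps \<open>push t\<close> and \<open>pull t\<close> are the inclusion of the summand \<open>K[G/C]\<close> that belongs to the
  orbit of \<open>t\<close> and the projection onto it: extension by zero and restriction along \<open>orbit_map t\<close>.
\<close>

definition push :: "('s \<Rightarrow> 'g) \<Rightarrow> ('g set \<Rightarrow> 'k) \<Rightarrow> ('s \<Rightarrow> 'g) \<Rightarrow> 'k"
  where "push f = linear_extension K FO (\<lambda>B. basis_vec K (orbit_map f B))"

definition pull :: "('s \<Rightarrow> 'g) \<Rightarrow> (('s \<Rightarrow> 'g) \<Rightarrow> 'k) \<Rightarrow> 'g set \<Rightarrow> 'k"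
  where "pull f y = (\<lambda>B. if B \<in> lcosets C then y (orbit_map f B) else \<zero>\<^bsub>K\<^esub>)"

lemma push_basis: "f \<in> \<Omega> \<Longrightarrow> B \<in> lcosets C \<Longrightarrow> push f (basis_vec K B) = basis_vec K (orbit_map f B)"
  unfolding push_def by (rule linear_extension_basis_vec[OF FO_module]) (rule MO_basis[OF orbit_map_closed])

lemma orbit_map_translate:
  "f \<in> \<Omega> \<Longrightarrow> a \<in> carrier G \<Longrightarrow> B \<in> lcosets C \<Longrightarrow> orbit_map f (a <# B) = cj a (orbit_map f B)"
  by (auto elim!: lcosetE simp: left_translate orbit_map_coset cj_mult)

lemma push_linear: "f \<in> \<Omega> \<Longrightarrow> push f \<in> linear_maps K FA FO"
  unfolding push_def by (rule linear_extension_linear[OF FO_module]) (rule MO_basis[OF orbit_map_closed])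

lemma push_hom:
  assumes f: "f \<in> \<Omega>"
  shows "push f \<in> gmodule_homs K G A MO"
proof -
  have "push f (basis_vec K (a <# B)) = gact MO a (push f (basis_vec K B))"
    if a: "a \<in> carrier G" and B: "B \<in> lcosets C" for a B
    using MO_gact[OF a orbit_map_closed[OF f B]]
    by (simp only: push_basis[OF f] left_translate_closed[OF a B] B orbit_map_translate[OF f a B])
  moreover have "push f \<in> linear_maps K FA MO" using push_linear[OF f] by simp
  ultimately show ?thesis
    by (subst coset_module_def) (rule permutation_module_homI[OF K.is_cring _ MO_gmodule left_translate_closed])
qed

lemma orbit_map_eqD:
  assumes "t \<in> T" "s \<in> T" "B \<in> lcosets C" "B' \<in> lcosets C" "orbit_map t B = orbit_map s B'"
  shows "t = s" "B = B'"
proof -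
  have ts: "t \<in> \<Omega>" "s \<in> \<Omega>" using assms(1,2) orbit_representatives_sub by auto
  obtain a a' where a: "a \<in> carrier G" "B = a <# C" "a' \<in> carrier G" "B' = a' <# C"
    using assms(3,4) by (auto elim!: lcosetE)
  have "cj a t = cj a' s" using assms(5) a ts by (simp add: orbit_map_coset)
  then show "t = s" by (rule orbit_representatives_unique[OF assms(1,2) a(1,3)])
  then show "B = B'" using assms(3-5) orbit_map_inj[OF ts(2)] by (auto dest: inj_onD)
qed

lemma orbit_map_cover:
  assumes "h \<in> \<Omega>'"
  obtains t B where "t \<in> T" "B \<in> lcosets C" "h = orbit_map t B"
proof -
  obtain a f where a: "a \<in> carrier G" "f \<in> \<Omega>" "h = cj a f" using assms by (rule \<Omega>'_cases)
  obtain b t where b: "b \<in> N" "t \<in> T" "f = cj b t" using a(2) by (rule orbit_representatives_cover)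
  have bc: "b \<in> carrier G" using b by (simp add: normalizer_iff)
  have t: "t \<in> \<Omega>" using b(2) orbit_representatives_sub by auto
  have "h = orbit_map t ((a \<otimes> b) <# C)" using a b bc t by (simp add: orbit_map_coset cj_mult)
  then show ?thesis using that b(2) a(1) bc lcosetI by blast
qed

lemma pull_linear:
  assumes f: "f \<in> \<Omega>"
  shows "pull f \<in> linear_maps K FO FA"
proof (rule linear_mapsI)
  fix y assume y: "y \<in> carrier FO"
  have "finite (lcosets C \<inter> orbit_map f -` {h. y h \<noteq> \<zero>\<^bsub>K\<^esub>})"
    using finite_vimage_IntI[OF free_moduleD(2)[OF y] orbit_map_inj[OF f]] by (simp add: Int_commute)
  then show "pull f y \<in> carrier FA"
    by (rule free_moduleI[rotated]) (use free_moduleD(1)[OF y] in \<open>auto simp: pull_def\<close>)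
qed (auto simp: pull_def fun_eq_iff)

lemma pull_push:
  assumes t: "t \<in> T" "s \<in> T" and v: "v \<in> carrier FA"
  shows "pull t (push s v) = (if s = t then v else \<zero>\<^bsub>FA\<^esub>)"
proof -
  have ts: "t \<in> \<Omega>" "s \<in> \<Omega>" using t orbit_representatives_sub by auto
  have lin: "(\<lambda>v. pull t (push s v)) \<in> linear_maps K FA FA"
    by (rule linear_maps_compose[OF push_linear[OF ts(2)] pull_linear[OF ts(1)]])
  have rhs: "(\<lambda>v. if s = t then v else \<zero>\<^bsub>FA\<^esub>) \<in> linear_maps K FA FA"
  proof -
    interpret FA: module K FA by (rule FA_module)
    show ?thesis by (rule linear_mapsI) (auto simp del: free_module_simps)
  qed
  show ?thesis
  proof (rule linear_maps_eq_on_basis[OF FA_module lin rhs _ v])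
    fix B assume B: "B \<in> lcosets C"
    show "pull t (push s (basis_vec K B)) = (if s = t then basis_vec K B else \<zero>\<^bsub>FA\<^esub>)"
      unfolding push_basis[OF ts(2) B]
    proof (rule ext)
      fix D
      have "orbit_map t D = orbit_map s B \<longleftrightarrow> s = t \<and> D = B" if "D \<in> lcosets C"
        using orbit_map_eqD[OF t that B] by blast
      then show "pull t (basis_vec K (orbit_map s B)) D = (if s = t then basis_vec K B else \<zero>\<^bsub>FA\<^esub>) D"
        using B by (auto simp: pull_def basis_vec_def)
    qed
  qed
qed

lemma pull_basis:
  assumes t: "t \<in> T" "s \<in> T" and B: "B \<in> lcosets C"
  shows "pull t (basis_vec K (orbit_map s B)) = (if s = t then basis_vec K B else \<zero>\<^bsub>FA\<^esub>)"
  using pull_push[OF t A_basis[OF B]] push_basis[OF _ B, of s] t(2) orbit_representatives_sub by auto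

lemma pull_hom:
  assumes t: "t \<in> T"
  shows "pull t \<in> gmodule_homs K G MO A"
proof -
  have t\<Omega>: "t \<in> \<Omega>" using t orbit_representatives_sub by auto
  have "pull t (basis_vec K (cj a h)) = gact A a (pull t (basis_vec K h))"
    if a: "a \<in> carrier G" and h: "h \<in> \<Omega>'" for a h
  proof -
    obtain s B where s: "s \<in> T" "B \<in> lcosets C" "h = orbit_map s B" using h by (rule orbit_map_cover)
    have s\<Omega>: "s \<in> \<Omega>" using s(1) orbit_representatives_sub by auto
    have "cj a h = orbit_map s (a <# B)" using s s\<Omega> a by (simp add: orbit_map_translate)
    moreover have "gact A a \<zero>\<^bsub>FA\<^esub> = \<zero>\<^bsub>FA\<^esub>"
      using linear_maps_zero[OF A_module A_module gact_linear[OF A_gmodule a]] by simp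
    ultimately show ?thesis
      using s a by (simp add: pull_basis[OF t s(1)] A_gact left_translate_closed del: free_module_simps)
  qed
  moreover have "pull t \<in> linear_maps K (free_module K \<Omega>') A" using pull_linear[OF t\<Omega>] by simp
  ultimately show ?thesis
    by (subst rep_module_def) (rule permutation_module_homI[OF K.is_cring _ A_gmodule cj_\<Omega>'_closed])
qed

text \<open>
  The orbits of the elements of \<open>T\<close> cover \<open>\<Omega>'\<close>.
\<close>

lemma pull_zeroD:
  assumes y: "y \<in> carrier FO" and "\<And>t. t \<in> T \<Longrightarrow> pull t y = \<zero>\<^bsub>FA\<^esub>"
  shows "y = \<zero>\<^bsub>FO\<^esub>"
proof -
  have "y h = \<zero>\<^bsub>K\<^esub>" for h
  proof (cases "h \<in> \<Omega>'")
    case True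
    then obtain t B where t: "t \<in> T" "B \<in> lcosets C" "h = orbit_map t B" by (rule orbit_map_cover)
    then show ?thesis using fun_cong[OF assms(2)[OF t(1)], of B] by (simp add: pull_def)
  next
    case False
    then show ?thesis using free_moduleD(3)[OF y] by blast
  qed
  then show ?thesis by auto
qed

text \<open>
  The bilinear extension of \<open>(a C, f) \<mapsto> a f a\<inverse>\<close>.
\<close>

definition conj_pairing :: "('g set \<Rightarrow> 'k) \<Rightarrow> (('s \<Rightarrow> 'g) \<Rightarrow> 'k) \<Rightarrow> ('s \<Rightarrow> 'g) \<Rightarrow> 'k"
  where "conj_pairing v = linear_extension K FO (\<lambda>f. push f v)"

lemma conj_pairing_right_linear: "v \<in> carrier FA \<Longrightarrow> conj_pairing v \<in> linear_maps K (free_module K \<Omega>) FO"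
  unfolding conj_pairing_def by (rule linear_extension_linear[OF FO_module]) (rule linear_maps_closed[OF push_linear])

lemma conj_pairing_basis: "v \<in> carrier FA \<Longrightarrow> f \<in> \<Omega> \<Longrightarrow> conj_pairing v (basis_vec K f) = push f v"
  unfolding conj_pairing_def by (rule linear_extension_basis_vec[OF FO_module]) (rule linear_maps_closed[OF push_linear])

lemma conj_pairing_left_linear:
  assumes w: "w \<in> carrier (free_module K \<Omega>)"
  shows "(\<lambda>v. conj_pairing v w) \<in> linear_maps K FA FO"
proof (rule linear_mapsI)
  interpret FA: module K FA by (rule FA_module)
  interpret FO: module K FO by (rule FO_module)
  fix v assume v: "v \<in> carrier FA"
  show "conj_pairing v w \<in> carrier FO" using linear_maps_closed[OF conj_pairing_right_linear[OF v] w] .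
  note pc = linear_maps_closed[OF push_linear]
  { fix c assume c: "c \<in> carrier K"
    have "conj_pairing (c \<odot>\<^bsub>FA\<^esub> v) w = linear_extension K FO (\<lambda>f. c \<odot>\<^bsub>FO\<^esub> push f v) w"
      unfolding conj_pairing_def
      by (rule linear_extension_cong[OF FO_module w linear_maps_smult[OF push_linear c v] FO.smult_closed[OF c pc[OF _ v]]])
    then show "conj_pairing (c \<odot>\<^bsub>FA\<^esub> v) w = c \<odot>\<^bsub>FO\<^esub> conj_pairing v w"
      using linear_extension_smult_family[OF FO_module _ c w, of "\<lambda>f. push f v"] pc v by (simp add: conj_pairing_def del: free_module_simps) }
  fix v' assume v': "v' \<in> carrier FA"
  have "conj_pairing (v \<oplus>\<^bsub>FA\<^esub> v') w = linear_extension K FO (\<lambda>f. push f v \<oplus>\<^bsub>FO\<^esub> push f v') w"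
    unfolding conj_pairing_def
    by (rule linear_extension_cong[OF FO_module w linear_maps_add[OF push_linear v v'] FO.M.a_closed[OF pc[OF _ v] pc[OF _ v']]])
  then show "conj_pairing (v \<oplus>\<^bsub>FA\<^esub> v') w = conj_pairing v w \<oplus>\<^bsub>FO\<^esub> conj_pairing v' w"
    using linear_extension_add_family[OF FO_module _ _ w, of "\<lambda>f. push f v" "\<lambda>f. push f v'"] pc v v'
    by (simp add: conj_pairing_def del: free_module_simps)
qed

lemma conj_pairing_hom:
  assumes w: "w \<in> carrier (free_module K \<Omega>)"
  shows "(\<lambda>v. conj_pairing v w) \<in> gmodule_homs K G A MO"
proof (rule gmodule_homsI)
  show "(\<lambda>v. conj_pairing v w) \<in> linear_maps K A MO" using conj_pairing_left_linear[OF w] by simp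
  fix a v assume a: "a \<in> carrier G" and "v \<in> carrier A"
  then have v: "v \<in> carrier FA" by simp
  have av: "gact A a v \<in> carrier FA" using gact_closed[OF A_gmodule a] v by simp
  have ga: "gact MO a \<in> linear_maps K FO FO" using gact_linear[OF MO_gmodule a] by simp
  show "conj_pairing (gact A a v) w = gact MO a (conj_pairing v w)"
  proof (rule linear_maps_eq_on_basis[OF FO_module conj_pairing_right_linear[OF av] linear_maps_compose[OF conj_pairing_right_linear[OF v] ga] _ w])
    fix f assume f: "f \<in> \<Omega>"
    show "conj_pairing (gact A a v) (basis_vec K f) = gact MO a (conj_pairing v (basis_vec K f))"
      unfolding conj_pairing_basis[OF v f] conj_pairing_basis[OF av f]
      by (rule gmodule_homs_gact[OF push_hom[OF f] a]) (simp add: v)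
  qed
qed

lemma MU_gact:
  assumes "z \<in> carrier Z" "f \<in> \<Omega>"
  shows "gact MU z (basis_vec K f) = basis_vec K (cj (SOME b. b \<in> z) f)"
  unfolding rep_module_onto_def permutation_module_simps
  by (rule linear_extension_basis_vec[OF F\<Omega>_module]) (rule MU_basis[OF cj_normalizer[OF assms(2) Z_some(1)[OF assms(1)]]])

lemma MU_gact_linear:
  assumes "z \<in> carrier Z"
  shows "gact MU z \<in> linear_maps K (free_module K \<Omega>) (free_module K \<Omega>)"
  unfolding rep_module_onto_def permutation_module_simps
  by (rule linear_extension_linear[OF F\<Omega>_module]) (rule MU_basis[OF cj_normalizer[OF _ Z_some(1)[OF assms]]])

lemma r_linear: "z \<in> carrier Z \<Longrightarrow> r z \<in> linear_maps K FA FA"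
  using gmodule_homs_linear[OF r_hom] by simp

text \<open>
  On basis vectors both sides are \<open>(a b) f (a b)\<inverse> = a (b f b\<inverse>) a\<inverse>\<close>.
\<close>

lemma conj_pairing_balanced:
  assumes z: "z \<in> carrier Z" and v: "v \<in> carrier FA" and w: "w \<in> carrier (free_module K \<Omega>)"
  shows "conj_pairing (r z v) w = conj_pairing v (gact MU z w)"
proof -
  define b where "b = (SOME b. b \<in> z)"
  have b: "b \<in> N" "z = b <# C" using Z_some[OF z] by (simp_all add: b_def)
  have bc: "b \<in> carrier G" using b(1) by (simp add: normalizer_iff)
  have rv: "r z v \<in> carrier FA" by (rule linear_maps_closed[OF r_linear[OF z] v])
  show ?thesis
  proof (rule linear_maps_eq_on_basis[OF FO_module conj_pairing_right_linear[OF rv]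
        linear_maps_compose[OF MU_gact_linear[OF z] conj_pairing_right_linear[OF v]] _ w])
    fix f assume f: "f \<in> \<Omega>"
    have bf: "cj b f \<in> \<Omega>" by (rule cj_normalizer[OF f b(1)])
    have "push f (r z v) = push (cj b f) v"
    proof (rule linear_maps_eq_on_basis[OF FO_module linear_maps_compose[OF r_linear[OF z] push_linear[OF f]] push_linear[OF bf] _ v])
      fix B assume B: "B \<in> lcosets C"
      obtain a where a: "a \<in> carrier G" "B = a <# C" using B by (rule lcosetE)
      have "orbit_map f (B <#> z) = orbit_map (cj b f) B"
        using a b bc f bf by (simp add: right_translate orbit_map_coset cj_mult)
      then show "push f (r z (basis_vec K B)) = push (cj b f) (basis_vec K B)"
        using push_basis[OF f r_basis_closed[OF z B]] push_basis[OF bf B] by (simp add: r_basis[OF z B])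
    qed
    then show "conj_pairing (r z v) (basis_vec K f) = conj_pairing v (gact MU z (basis_vec K f))"
      by (simp add: MU_gact[OF z f] b_def[symmetric] conj_pairing_basis rv v f bf)
  qed
qed

lemma balanced_map_conj_pairing: "balanced_map K Z A r MU MO conj_pairing"
proof -
  interpret MU: module K MU by (rule MU_module)
  interpret MO: module K MO by (rule MO_module)
  interpret A: module K A by (rule A_module)
  show ?thesis
  proof
    fix z x assume "z \<in> carrier Z" "x \<in> carrier A"
    then show "r z x \<in> carrier A" using linear_maps_closed[OF r_linear] by simp
  next
    fix z y assume "z \<in> carrier Z" "y \<in> carrier MU"
    then show "gact MU z y \<in> carrier MU" using linear_maps_closed[OF MU_gact_linear] by simp
  next
    fix y assume "y \<in> carrier MU"
    then show "(\<lambda>x. conj_pairing x y) \<in> linear_maps K A MO" using conj_pairing_left_linear by simp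
  next
    fix x assume "x \<in> carrier A"
    then show "conj_pairing x \<in> linear_maps K MU MO" using conj_pairing_right_linear by simp
  next
    fix z x y assume "z \<in> carrier Z" "x \<in> carrier A" "y \<in> carrier MU"
    then show "conj_pairing (r z x) y = conj_pairing x (gact MU z y)" using conj_pairing_balanced by simp
  qed
qed

lemma MU_span:
  assumes "submodule L K MU" "\<And>f. f \<in> \<Omega> \<Longrightarrow> basis_vec K f \<in> L"
  shows "carrier MU \<subseteq> L"
proof -
  interpret MU: module K MU by (rule MU_module)
  have "submodule L K (free_module K \<Omega>)"
    using linear_maps_preimage_submodule[OF F\<Omega>_module MU_module, of "\<lambda>x. x" L] assms(1) MU.submoduleE(1)[OF assms(1)]
    by (simp add: linear_maps_def Int_absorb1 Collect_conj_eq)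
  then show ?thesis using submodule_free_module_eqI[OF K.is_cring _ assms(2)] by auto
qed

lemma MU_represented:
  assumes "f \<in> \<Omega>"
  shows "\<exists>z\<in>carrier Z. \<exists>t\<in>T. basis_vec K f = gact MU z (basis_vec K t)"
proof -
  obtain b t where b: "b \<in> N" "t \<in> T" "f = cj b t" using assms by (rule orbit_representatives_cover)
  have z: "b <# C \<in> carrier Z" using b(1) Z_carrier by auto
  let ?b = "SOME b'. b' \<in> b <# C"
  have t: "t \<in> \<Omega>" using b(2) orbit_representatives_sub by auto
  have "cj ?b t = f"
    using Z_some[OF z] b t by (metis cj_eq_iff normalizer_iff)
  then have "basis_vec K f = gact MU (b <# C) (basis_vec K t)" using MU_gact[OF z t] by simp
  then show ?thesis using z b(2) by blast
qed

lemma MO_span: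
  assumes L: "submodule L K MO" and "\<And>v t. v \<in> carrier FA \<Longrightarrow> t \<in> T \<Longrightarrow> conj_pairing v (basis_vec K t) \<in> L"
  shows "carrier MO \<subseteq> L"
proof -
  interpret MO: module K MO by (rule MO_module)
  have "submodule L K FO"
    using linear_maps_preimage_submodule[OF FO_module MO_module, of "\<lambda>x. x" L] assms(1) MO.submoduleE(1)[OF assms(1)]
    by (simp add: linear_maps_def Int_absorb1 Collect_conj_eq)
  moreover have "basis_vec K h \<in> L" if h: "h \<in> \<Omega>'" for h
  proof -
    obtain t B where t: "t \<in> T" "B \<in> lcosets C" "h = orbit_map t B" using h by (rule orbit_map_cover)
    then show ?thesis
      using assms(2)[OF A_basis[OF t(2)] t(1)] orbit_representatives_sub
      by (simp add: conj_pairing_basis A_basis push_basis subset_iff)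
  qed
  ultimately have "w \<in> L" if "w \<in> carrier FO" for w
    using that by (rule submodule_free_module_eqI[OF K.is_cring])
  then show ?thesis by auto
qed

lemma projections_conj_pairing: "balanced_map_projections K Z A r MU MO conj_pairing \<Omega> T (basis_vec K) pull"
proof -
  interpret balanced_map K Z A r MU MO conj_pairing by (rule balanced_map_conj_pairing)
  have T: "t \<in> \<Omega>" if "t \<in> T" for t using that orbit_representatives_sub by auto
  show ?thesis
  proof (unfold_locales, goal_cases)
    case (1 L) then show ?case by (rule MU_span)
  next
    case (2 s) then show ?case using MU_basis by simp
  next
    case 3 show ?case by (rule orbit_representatives_sub)
  next
    case (4 s) then show ?case by (rule MU_represented)
  next
    case (5 t) then show ?case using pull_linear[OF T] by simp
  next
    case (6 t s x) then show ?case using pull_push[of t s x] by (simp add: conj_pairing_basis T)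
  next
    case (7 L) then show ?case using MO_span by simp
  qed
qed

lemma conj_pairing_coset:
  assumes "a \<in> carrier G" "f \<in> \<Omega>"
  shows "conj_pairing (basis_vec K (a <# C)) (basis_vec K f) = basis_vec K (cj a f)"
  using assms by (simp add: conj_pairing_basis A_basis lcosetI push_basis orbit_map_coset)

lemma tensor_gmodule_simps:
  "carrier (tensor_gmodule K Z A r MU) = carrier (tensor_product K Z A r MU)"
  "add (tensor_gmodule K Z A r MU) = add (tensor_product K Z A r MU)"
  "smult (tensor_gmodule K Z A r MU) = smult (tensor_product K Z A r MU)"
  "gact (tensor_gmodule K Z A r MU) = (\<lambda>a Q. \<Union>w\<in>Q.
       tensor_relations K Z A r MU +>\<^bsub>free_module K (carrier A \<times> carrier MU)\<^esub>
       linear_extension K (free_module K (carrier A \<times> carrier MU)) (\<lambda>(x, y). basis_vec K (gact A a x, y)) w)"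
  by (simp_all add: tensor_gmodule_def module.extend_def gmodule.fields_def del: A_simps MU_simps)

text \<open>
  The action of \<open>a\<close> on a tensor \<open>Q\<close> is a union of cosets, one for each representative of \<open>Q\<close>.  That these
  coincide is deduced from the injectivity of \<open>\<Phi>\<close>: two representatives of \<open>Q\<close> have the same value under
  \<open>ext\<close>, and since \<open>ext\<close> commutes with \<open>a\<close>, so do their translates.
\<close>

lemma tensor_iso:
  obtains \<Phi> where "\<Phi> \<in> gmodule_isos K G (tensor_gmodule K Z A r MU) MO"
    "\<forall>x \<in> carrier A. \<forall>y \<in> carrier MU. \<Phi> (pure_tensor K Z A r MU x y) = conj_pairing x y"
proof -
  interpret balanced_map_projections K Z A r MU MO conj_pairing \<Omega> T "basis_vec K" pull by (rule projections_conj_pairing)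
  interpret F: module K F by (rule F_module)
  note [simp del] = A_simps MU_simps MO_simps linear_maps_simps free_module_simps
  obtain \<Phi> where \<Phi>: "\<Phi> \<in> linear_maps K tensor MO" "\<And>w. w \<in> carrier F \<Longrightarrow> \<Phi> (rel +>\<^bsub>F\<^esub> w) = ext w"
      "\<And>x y. x \<in> carrier A \<Longrightarrow> y \<in> carrier MU \<Longrightarrow> \<Phi> (pure x y) = conj_pairing x y"
    using tensor_lift by blast
  have iso: "\<Phi> \<in> linear_isos K tensor MO" by (rule lift_is_iso[OF \<Phi>(1,3)])
  then have inj: "inj_on \<Phi> (carrier tensor)" by (simp add: linear_isos_def bij_betw_def)
  have "\<Phi> (gact (tensor_gmodule K Z A r MU) a Q) = gact MO a (\<Phi> Q)"
    if a: "a \<in> carrier G" and Q: "Q \<in> carrier tensor" for a Q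
  proof -
    let ?g = "linear_extension K F (\<lambda>(x, y). basis_vec K (gact A a x, y))"
    have bas: "basis_vec K (gact A a x, y) \<in> carrier F" if "x \<in> carrier A" "y \<in> carrier MU" for x y
      by (rule basis_F[OF gact_closed[OF A_gmodule a that(1)] that(2)])
    have g: "?g \<in> linear_maps K F F" by (rule linear_extension_pairs_linear[OF F_module bas])
    have gb: "?g (basis_vec K (x, y)) = basis_vec K (gact A a x, y)" if "x \<in> carrier A" "y \<in> carrier MU" for x y
      using linear_extension_basis_vec[OF F_module, of "\<lambda>(x, y). basis_vec K (gact A a x, y)" "(x, y)"] bas[OF that]
      by simp
    have ext_g: "ext (?g w) = gact MO a (ext w)" if w: "w \<in> carrier F" for w
    proof (rule linear_maps_eq_on_basis[OF MO_module linear_maps_compose[OF g ext_linear]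
          linear_maps_compose[OF ext_linear gact_linear[OF MO_gmodule a]] _ w])
      fix s assume "s \<in> carrier A \<times> carrier MU"
      then obtain x y where s: "s = (x, y)" "x \<in> carrier A" "y \<in> carrier MU" by auto
      have "conj_pairing (gact A a x) y = gact MO a (conj_pairing x y)"
        using gmodule_homs_gact[OF conj_pairing_hom a s(2)] s(3) by (simp add: MU_simps)
      then show "ext (?g (basis_vec K s)) = gact MO a (ext (basis_vec K s))"
        using s by (simp add: gb ext_basis gact_closed[OF A_gmodule a])
    qed
    obtain w0 where w0: "w0 \<in> carrier F" "Q = rel +>\<^bsub>F\<^esub> w0"
      using Q unfolding tensor_product_def quotient_module_carrier by blast
    note cc = linear_maps_closed[OF tensor_map_linear] and gc = linear_maps_closed[OF g]
    have "rel +>\<^bsub>F\<^esub> ?g w = rel +>\<^bsub>F\<^esub> ?g w0" if w: "w \<in> Q" for w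
    proof -
      have wF: "w \<in> carrier F"
        using w w0 F.M.a_r_coset_subset_G[OF F.submoduleE(1)[OF rel_submodule] w0(1)] by blast
      have "w \<ominus>\<^bsub>F\<^esub> w0 \<in> rel" using w w0(2) mem_coset_iff[OF F_module rel_submodule w0(1) wF] by simp
      then have "rel +>\<^bsub>F\<^esub> w = rel +>\<^bsub>F\<^esub> w0" using coset_eq_iff[OF F_module rel_submodule wF w0(1)] by simp
      then have "ext w = ext w0" using \<Phi>(2)[OF wF] \<Phi>(2)[OF w0(1)] by simp
      then have "\<Phi> (rel +>\<^bsub>F\<^esub> ?g w) = \<Phi> (rel +>\<^bsub>F\<^esub> ?g w0)"
        using \<Phi>(2)[OF gc[OF wF]] \<Phi>(2)[OF gc[OF w0(1)]] ext_g[OF wF] ext_g[OF w0(1)] by simp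
      then show ?thesis by (rule inj_onD[OF inj _ cc[OF gc[OF wF]] cc[OF gc[OF w0(1)]]])
    qed
    moreover have "w0 \<in> Q"
      using w0 mem_coset_iff[OF F_module rel_submodule w0(1) w0(1)] submodule_zero[OF rel_submodule]
      by (simp add: F.M.minus_eq F.M.r_neg)
    ultimately have "(\<Union>w\<in>Q. rel +>\<^bsub>F\<^esub> ?g w) = rel +>\<^bsub>F\<^esub> ?g w0" by blast
    then have "gact (tensor_gmodule K Z A r MU) a Q = rel +>\<^bsub>F\<^esub> ?g w0"
      by (simp only: tensor_gmodule_simps)
    then show ?thesis
      using \<Phi>(2)[OF gc[OF w0(1)]] ext_g[OF w0(1)] \<Phi>(2)[OF w0(1)] w0(2) by simp
  qed
  then have "\<Phi> \<in> gmodule_isos K G (tensor_gmodule K Z A r MU) MO"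
    using iso by (auto simp: gmodule_isos_def gmodule_homs_def linear_isos_def linear_maps_def tensor_gmodule_simps)
  then show ?thesis by (rule that) (simp add: \<Phi>(3))
qed

end

section \<open>Cohomology of the permutation module\<close>

locale orbit_cohomology = orbit_modules K \<Gamma> G U + finite_group_resolution K G P d e
  for K :: "('k, 'a) ring_scheme" and \<Gamma> :: "('s, 'c) monoid_scheme"
    and G :: "('g, 'b) monoid_scheme" (structure) and U :: "'g set"
    and P :: "nat \<Rightarrow> ('k, 'p, 'g) gmodule" and d :: "nat \<Rightarrow> 'p \<Rightarrow> 'p" and e :: "'p \<Rightarrow> 'k"
begin

abbreviation "rH m z \<equiv> Ext_map K G P d m A (r z)"

text \<open>
  The map on cohomology induced by \<open>v \<mapsto> conj_pairing v w\<close>, as a function of the cohomology class and of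
  \<open>w\<close>.
\<close>

definition Ext_pairing :: "nat \<Rightarrow> ('p \<Rightarrow> 'g set \<Rightarrow> 'k) set \<Rightarrow> (('s \<Rightarrow> 'g) \<Rightarrow> 'k) \<Rightarrow> ('p \<Rightarrow> ('s \<Rightarrow> 'g) \<Rightarrow> 'k) set"
  where "Ext_pairing m \<xi> w = Ext_map K G P d m MO (\<lambda>v. conj_pairing v w) \<xi>"

lemma balanced_map_Ext_pairing: "balanced_map K Z (Ext m A) (rH m) MU (Ext m MO) (Ext_pairing m)"
proof -
  interpret b: balanced_map K Z A r MU MO conj_pairing by (rule balanced_map_conj_pairing)
  interpret EA: module K "Ext m A" by (rule Ext_is_module[OF A_gmodule])
  interpret EO: module K "Ext m MO" by (rule Ext_is_module[OF MO_gmodule])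
  have hom: "(\<lambda>v. conj_pairing v w) \<in> gmodule_homs K G A MO" if "w \<in> carrier MU" for w
    using conj_pairing_hom that by simp
  show ?thesis
  proof
    fix z x assume "z \<in> carrier Z" "x \<in> carrier (Ext m A)"
    then show "rH m z x \<in> carrier (Ext m A)" by (intro linear_maps_closed[OF Ext_map_linear[OF A_gmodule A_gmodule r_hom]])
  next
    fix z y assume "z \<in> carrier Z" "y \<in> carrier MU"
    then show "gact MU z y \<in> carrier MU" by (rule b.left_closed)
  next
    fix y assume "y \<in> carrier MU"
    then show "(\<lambda>x. Ext_pairing m x y) \<in> linear_maps K (Ext m A) (Ext m MO)"
      unfolding Ext_pairing_def by (intro Ext_map_linear[OF A_gmodule MO_gmodule hom])
  next
    fix x assume x: "x \<in> carrier (Ext m A)"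
    show "Ext_pairing m x \<in> linear_maps K MU (Ext m MO)"
    proof (rule linear_mapsI)
      fix y assume y: "y \<in> carrier MU"
      show "Ext_pairing m x y \<in> carrier (Ext m MO)"
        unfolding Ext_pairing_def by (rule linear_maps_closed[OF Ext_map_linear[OF A_gmodule MO_gmodule hom[OF y]] x])
      { fix y' assume y': "y' \<in> carrier MU"
        have "Ext_pairing m x (y \<oplus>\<^bsub>MU\<^esub> y') = Ext_map K G P d m MO (\<lambda>v. conj_pairing v y \<oplus>\<^bsub>MO\<^esub> conj_pairing v y') x"
          unfolding Ext_pairing_def by (rule Ext_map_cong[OF A_gmodule x]) (rule linear_maps_add[OF b.linear_right y y'])
        then show "Ext_pairing m x (y \<oplus>\<^bsub>MU\<^esub> y') = Ext_pairing m x y \<oplus>\<^bsub>Ext m MO\<^esub> Ext_pairing m x y'"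
          unfolding Ext_pairing_def using Ext_map_add[OF A_gmodule MO_gmodule hom[OF y] hom[OF y'] x] by (simp only:) }
      fix c assume c: "c \<in> carrier K"
      have "Ext_pairing m x (c \<odot>\<^bsub>MU\<^esub> y) = Ext_map K G P d m MO (\<lambda>v. c \<odot>\<^bsub>MO\<^esub> conj_pairing v y) x"
        unfolding Ext_pairing_def by (rule Ext_map_cong[OF A_gmodule x]) (rule linear_maps_smult[OF b.linear_right c y])
      then show "Ext_pairing m x (c \<odot>\<^bsub>MU\<^esub> y) = c \<odot>\<^bsub>Ext m MO\<^esub> Ext_pairing m x y"
        unfolding Ext_pairing_def using Ext_map_smult[OF A_gmodule MO_gmodule hom[OF y] c x] by (simp only:)
    qed
  next
    fix z x y assume z: "z \<in> carrier Z" and x: "x \<in> carrier (Ext m A)" and y: "y \<in> carrier MU"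
    have "Ext_pairing m (rH m z x) y = Ext_map K G P d m MO (\<lambda>v. conj_pairing (r z v) y) x"
      unfolding Ext_pairing_def by (rule Ext_map_compose[OF A_gmodule A_gmodule MO_gmodule r_hom[OF z] hom[OF y] x])
    also have "\<dots> = Ext_pairing m x (gact MU z y)"
      unfolding Ext_pairing_def by (rule Ext_map_cong[OF A_gmodule x]) (rule b.balanced[OF z _ y])
    finally show "Ext_pairing m (rH m z x) y = Ext_pairing m x (gact MU z y)" .
  qed
qed

lemma Ext_pairing_basis:
  assumes "\<xi> \<in> carrier (Ext m A)" "f \<in> \<Omega>"
  shows "Ext_pairing m \<xi> (basis_vec K f) = Ext_map K G P d m MO (push f) \<xi>"
  unfolding Ext_pairing_def by (rule Ext_map_cong[OF A_gmodule assms(1)]) (simp add: conj_pairing_basis assms(2))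

lemma Ext_pull_push:
  assumes t: "t \<in> T" "s \<in> T" and \<xi>: "\<xi> \<in> carrier (Ext m A)"
  shows "Ext_map K G P d m A (pull t) (Ext_map K G P d m MO (push s) \<xi>) = (if s = t then \<xi> else \<zero>\<^bsub>Ext m A\<^esub>)"
proof -
  have s: "s \<in> \<Omega>" using t(2) orbit_representatives_sub by auto
  have "Ext_map K G P d m A (pull t) (Ext_map K G P d m MO (push s) \<xi>) = Ext_map K G P d m A (\<lambda>v. pull t (push s v)) \<xi>"
    by (rule Ext_map_compose[OF A_gmodule MO_gmodule A_gmodule push_hom[OF s] pull_hom[OF t(1)] \<xi>])
  also have "\<dots> = Ext_map K G P d m A (\<lambda>v. if s = t then v else \<zero>\<^bsub>A\<^esub>) \<xi>"
    by (rule Ext_map_cong[OF A_gmodule \<xi>]) (simp add: pull_push[OF t])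
  also have "\<dots> = (if s = t then \<xi> else \<zero>\<^bsub>Ext m A\<^esub>)"
    using Ext_map_id[OF A_gmodule \<xi>] Ext_map_zero[OF A_gmodule A_gmodule \<xi>] by (cases "s = t") simp_all
  finally show ?thesis .
qed

text \<open>
  Splitting off the component \<open>push t \<circ> pull t \<circ> c\<close> removes \<open>t\<close> from the finite set \<open>D\<close> of orbits that \<open>c\<close>
  involves.  The class of the component is induced by \<open>push t\<close> from a class with values in \<open>K[G/C]\<close>.
\<close>

lemma ext_class_finitely_many_orbits:
  assumes L: "submodule L K (Ext m MO)"
    and gen: "\<And>\<xi> t. \<xi> \<in> carrier (Ext m A) \<Longrightarrow> t \<in> T \<Longrightarrow> Ext_map K G P d m MO (push t) \<xi> \<in> L"
    and "finite D" "D \<subseteq> T" "c \<in> cocycles K G P d m MO"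
      "\<And>x t. x \<in> carrier (P m) \<Longrightarrow> t \<in> T - D \<Longrightarrow> pull t (c x) = \<zero>\<^bsub>FA\<^esub>"
  shows "ext_class m MO c \<in> L"
  using assms(3-)
proof (induction D arbitrary: c rule: finite_induct)
  case empty
  have ch: "c \<in> carrier (Hom m MO)" using empty by (simp add: cocycles_iff)
  interpret H: module K "Hom m MO" by (rule Hom_module[OF MO_gmodule])
  have "c = \<zero>\<^bsub>Hom m MO\<^esub>"
  proof (rule hom_module_eqI[OF ch H.M.zero_closed])
    fix x assume x: "x \<in> carrier (P m)"
    have "c x \<in> carrier FO" using hom_module_closed[OF ch x] by simp
    moreover have "\<And>t. t \<in> T \<Longrightarrow> pull t (c x) = \<zero>\<^bsub>FA\<^esub>" using empty.prems(3)[OF x] by simp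
    ultimately have "c x = \<zero>\<^bsub>FO\<^esub>" by (rule pull_zeroD)
    then show "c x = \<zero>\<^bsub>Hom m MO\<^esub> x" using x by (simp add: hom_module_simps)
  qed
  then show ?case using ext_class_zero[OF MO_gmodule] submodule_zero[OF L] by simp
next
  case (insert t D)
  interpret EO: module K "Ext m MO" by (rule Ext_is_module[OF MO_gmodule])
  interpret H: module K "Hom m MO" by (rule Hom_module[OF MO_gmodule])
  interpret FA: module K FA by (rule FA_module)
  have t: "t \<in> T" and D: "D \<subseteq> T" using insert.prems(1) by auto
  have t\<Omega>: "t \<in> \<Omega>" using t orbit_representatives_sub by auto
  note c = insert.prems(2)
  have ch: "c \<in> carrier (Hom m MO)" using c by (simp add: cocycles_iff)
  let ?pp = "\<lambda>v. push t (pull t v)"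
  have pp: "?pp \<in> gmodule_homs K G MO MO" by (rule gmodule_homs_compose[OF pull_hom[OF t] push_hom[OF t\<Omega>]])
  define c1 where "c1 = compose (carrier (P m)) ?pp c"
  have c1: "c1 \<in> cocycles K G P d m MO" unfolding c1_def by (rule post_compose_cocycle[OF MO_gmodule MO_gmodule pp c])
  have c1h: "c1 \<in> carrier (Hom m MO)" using c1 by (simp add: cocycles_iff)
  define c2 where "c2 = c \<ominus>\<^bsub>Hom m MO\<^esub> c1"
  have c2: "c2 \<in> cocycles K G P d m MO"
    unfolding c2_def by (rule submodule_minus[OF H.module_axioms cocycles_submodule[OF MO_gmodule] c c1])
  have c2h: "c2 \<in> carrier (Hom m MO)" using c2 by (simp add: cocycles_iff)
  have "pull s (c2 x) = \<zero>\<^bsub>FA\<^esub>" if x: "x \<in> carrier (P m)" and s: "s \<in> T - D" for x s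
  proof -
    have s\<Omega>: "s \<in> \<Omega>" using s orbit_representatives_sub by auto
    have cx: "c x \<in> carrier FO" "c1 x \<in> carrier FO"
      using hom_module_closed[OF ch x] hom_module_closed[OF c1h x] by simp_all
    have ptc: "pull t (c x) \<in> carrier FA" by (rule linear_maps_closed[OF pull_linear[OF t\<Omega>] cx(1)])
    have psc: "pull s (c x) \<in> carrier FA" by (rule linear_maps_closed[OF pull_linear[OF s\<Omega>] cx(1)])
    have "pull s (c2 x) = pull s (c x \<ominus>\<^bsub>MO\<^esub> c1 x)"
      unfolding c2_def hom_module_minus_apply[OF P MO_gmodule ch c1h x] by (rule refl)
    also have "pull s (c x \<ominus>\<^bsub>MO\<^esub> c1 x) = pull s (c x) \<ominus>\<^bsub>A\<^esub> pull s (c1 x)"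
      using linear_maps_minus[OF MO_module A_module gmodule_homs_linear[OF pull_hom], of s "c x" "c1 x"] s cx by simp
    also have "pull s (c1 x) = (if t = s then pull t (c x) else \<zero>\<^bsub>FA\<^esub>)"
      using pull_push[of s t, OF _ t ptc] s x by (simp add: c1_def compose_eq)
    also have "pull s (c x) \<ominus>\<^bsub>A\<^esub> \<dots> = \<zero>\<^bsub>A\<^esub>"
    proof (cases "t = s")
      case True
      interpret A: module K A by (rule A_module)
      have "pull s (c x) \<in> carrier A" using psc by simp
      then have "pull s (c x) \<ominus>\<^bsub>A\<^esub> pull s (c x) = \<zero>\<^bsub>A\<^esub>" unfolding A.M.minus_eq by (rule A.M.r_neg)
      then show ?thesis using True by simp
    next
      case False
      then have "pull s (c x) = \<zero>\<^bsub>FA\<^esub>" using insert.prems(3)[OF x] s by simp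
      then have "pull s (c x) \<ominus>\<^bsub>A\<^esub> \<zero>\<^bsub>A\<^esub> = \<zero>\<^bsub>A\<^esub>"
        using module_minus_zero[OF A_module, of "pull s (c x)"] psc by simp
      then show ?thesis using False by simp
    qed
    finally show ?thesis by simp
  qed
  then have 2: "ext_class m MO c2 \<in> L" by (rule insert.IH[OF D c2])
  have "ext_class m MO c1 = Ext_map K G P d m MO ?pp (ext_class m MO c)"
    unfolding c1_def by (rule Ext_map_class[OF MO_gmodule MO_gmodule pp c, symmetric])
  also have "\<dots> = Ext_map K G P d m MO (push t) (Ext_map K G P d m A (pull t) (ext_class m MO c))"
    by (rule Ext_map_compose[OF MO_gmodule A_gmodule MO_gmodule pull_hom[OF t] push_hom[OF t\<Omega>] ext_class_closed[OF MO_gmodule c], symmetric])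
  finally have 1: "ext_class m MO c1 \<in> L"
    using gen[OF linear_maps_closed[OF Ext_map_linear[OF MO_gmodule A_gmodule pull_hom[OF t]] ext_class_closed[OF MO_gmodule c]] t] by simp
  have "c1 \<oplus>\<^bsub>Hom m MO\<^esub> c2 = c"
    unfolding c2_def H.M.minus_eq
    using H.M.a_lcomm[OF c1h ch H.M.a_inv_closed[OF c1h]] ch c1h by (simp add: H.M.r_neg)
  then have "ext_class m MO c = ext_class m MO c1 \<oplus>\<^bsub>Ext m MO\<^esub> ext_class m MO c2"
    using ext_class_add[OF MO_gmodule c1 c2] by simp
  then show ?case using EO.submoduleE(5)[OF L 1 2] by simp
qed

text \<open>
  A cocycle of finite rank takes values supported in a finite subset of \<open>\<Omega>'\<close>, hence in finitely many
  orbits.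
\<close>

lemma Ext_MO_span:
  assumes L: "submodule L K (Ext m MO)"
    and gen: "\<And>\<xi> t. \<xi> \<in> carrier (Ext m A) \<Longrightarrow> t \<in> T \<Longrightarrow> Ext_pairing m \<xi> (basis_vec K t) \<in> L"
  shows "carrier (Ext m MO) \<subseteq> L"
proof
  fix \<eta> assume "\<eta> \<in> carrier (Ext m MO)"
  then obtain c0 where c0: "c0 \<in> cocycles K G P d m MO" "\<eta> = ext_class m MO c0" by (rule Ext_cases[OF MO_gmodule])
  obtain c E where c: "c \<in> cocycles K G P d m MO" "ext_class m MO c = ext_class m MO c0"
    and E: "finite E" "E \<subseteq> carrier MO" "\<And>x. x \<in> carrier (P m) \<Longrightarrow> c x \<in> submodule_hull K MO E"
    by (rule cocycle_finite_rank[OF MO_gmodule c0(1)]) blast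
  interpret MO: module K MO by (rule MO_module)
  interpret K: cring K by (rule K.is_cring)
  define S where "S = (\<Union>u\<in>E. {h. u h \<noteq> \<zero>\<^bsub>K\<^esub>})"
  have "finite S" using E(1,2) free_moduleD(2) by (auto simp: S_def)
  have supp: "u h = \<zero>\<^bsub>K\<^esub>" if u: "u \<in> submodule_hull K MO E" and h: "h \<notin> S" for u h
  proof -
    have "(\<lambda>u. u h) \<in> linear_maps K MO (trivial_gmodule K)"
      by (rule linear_mapsI) (auto simp: trivial_gmodule_def free_moduleD(1))
    from linear_maps_kernel_submodule[OF MO_module trivial_module this]
    have "submodule {u \<in> carrier MO. u h = \<zero>\<^bsub>K\<^esub>} K MO" by (simp add: trivial_gmodule_def)
    moreover have "E \<subseteq> {u \<in> carrier MO. u h = \<zero>\<^bsub>K\<^esub>}" using E(2) h by (auto simp: S_def)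
    ultimately have "submodule_hull K MO E \<subseteq> {u \<in> carrier MO. u h = \<zero>\<^bsub>K\<^esub>}" by (rule submodule_hull_least)
    then show ?thesis using u by auto
  qed
  define D where "D = {t \<in> T. \<exists>B \<in> lcosets C. orbit_map t B \<in> S}"
  have "finite {t \<in> T. \<exists>B \<in> lcosets C. orbit_map t B = h}" for h
  proof -
    define V where "V = {t \<in> T. \<exists>B \<in> lcosets C. orbit_map t B = h}"
    define t0 where "t0 = (SOME t. t \<in> V)"
    have "t = t0" if t: "t \<in> V" for t
    proof -
      have t0: "t0 \<in> V" unfolding t0_def using t by (rule someI[of "\<lambda>t. t \<in> V"])
      obtain B where B: "B \<in> lcosets C" "orbit_map t B = h" using t unfolding V_def by blast
      obtain B' where B': "B' \<in> lcosets C" "orbit_map t0 B' = h" using t0 unfolding V_def by blast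
      show "t = t0"
        by (rule orbit_map_eqD(1)[OF _ _ B(1) B'(1)]) (use t t0 B(2) B'(2) in \<open>auto simp: V_def\<close>)
    qed
    then have "V \<subseteq> {t0}" by blast
    then have "finite V" by (rule finite_subset) (rule finite.insertI[OF finite.emptyI])
    then show ?thesis unfolding V_def .
  qed
  then have "finite (\<Union>h\<in>S. {t \<in> T. \<exists>B \<in> lcosets C. orbit_map t B = h})"
    using \<open>finite S\<close> by blast
  moreover have "D \<subseteq> (\<Union>h\<in>S. {t \<in> T. \<exists>B \<in> lcosets C. orbit_map t B = h})" unfolding D_def by blast
  ultimately have D: "finite D" by (rule finite_subset[rotated])
  have "ext_class m MO c \<in> L"
  proof (rule ext_class_finitely_many_orbits[OF L _ D _ c(1)])
    show "D \<subseteq> T" by (auto simp: D_def)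
    show "Ext_map K G P d m MO (push t) \<xi> \<in> L" if "\<xi> \<in> carrier (Ext m A)" "t \<in> T" for \<xi> t
      using gen[OF that] Ext_pairing_basis[OF that(1)] that(2) orbit_representatives_sub by auto
    show "pull t (c x) = \<zero>\<^bsub>FA\<^esub>" if x: "x \<in> carrier (P m)" and t: "t \<in> T - D" for x t
    proof (rule ext)
      fix B
      show "pull t (c x) B = \<zero>\<^bsub>FA\<^esub> B"
        using t supp[OF E(3)[OF x]] by (auto simp: pull_def D_def)
    qed
  qed
  then show "\<eta> \<in> L" using c(2) c0(2) by simp
qed

lemma projections_Ext_pairing:
  "balanced_map_projections K Z (Ext m A) (rH m) MU (Ext m MO) (Ext_pairing m) \<Omega> T (basis_vec K)
    (\<lambda>t. Ext_map K G P d m A (pull t))"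
proof -
  interpret b: balanced_map_projections K Z A r MU MO conj_pairing \<Omega> T "basis_vec K" pull by (rule projections_conj_pairing)
  interpret balanced_map K Z "Ext m A" "rH m" MU "Ext m MO" "Ext_pairing m" by (rule balanced_map_Ext_pairing)
  have T: "t \<in> \<Omega>" if "t \<in> T" for t using that orbit_representatives_sub by auto
  show ?thesis
  proof (unfold_locales, goal_cases)
    case (1 L) then show ?case by (rule MU_span)
  next
    case (2 s) then show ?case by (rule b.B_basis)
  next
    case 3 show ?case by (rule orbit_representatives_sub)
  next
    case (4 s) then show ?case by (rule MU_represented)
  next
    case (5 t) then show ?case by (intro Ext_map_linear[OF MO_gmodule A_gmodule pull_hom])
  next
    case (6 t s x) then show ?case by (simp only: Ext_pairing_basis[OF _ T] Ext_pull_push)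
  next
    case (7 L) show ?case by (rule Ext_MO_span[OF 7])
  qed
qed

lemma Ext_iso:
  obtains \<Psi> where "\<Psi> \<in> linear_isos K (tensor_product K Z (Ext m A) (rH m) MU) (Ext m MO)"
    "\<forall>\<xi> \<in> carrier (Ext m A). \<forall>w \<in> carrier MU.
      \<Psi> (pure_tensor K Z (Ext m A) (rH m) MU \<xi> w) = Ext_pairing m \<xi> w"
proof -
  interpret balanced_map_projections K Z "Ext m A" "rH m" MU "Ext m MO" "Ext_pairing m" \<Omega> T "basis_vec K"
      "\<lambda>t. Ext_map K G P d m A (pull t)" by (rule projections_Ext_pairing)
  obtain \<Psi> where \<Psi>: "\<Psi> \<in> linear_maps K tensor (Ext m MO)" "\<And>w. w \<in> carrier F \<Longrightarrow> \<Psi> (rel +>\<^bsub>F\<^esub> w) = ext w"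
      "\<And>x y. x \<in> carrier (Ext m A) \<Longrightarrow> y \<in> carrier MU \<Longrightarrow> \<Psi> (pure x y) = Ext_pairing m x y"
    by (rule tensor_lift) blast
  have "\<Psi> \<in> linear_isos K tensor (Ext m MO)" by (rule lift_is_iso[OF \<Psi>(1,3)])
  then show ?thesis by (rule that) (intro ballI \<Psi>(3))
qed

end

theorem theorem6p2:
  fixes K :: "('k, 'a) ring_scheme"
    and G :: "('g, 'b) monoid_scheme"
    and g :: nat and S :: "'s topology" and x :: 's
    and U :: "'g set"
    and P :: "nat \<Rightarrow> ('k, 'p, 'g) gmodule"
  assumes K: "algebraically_closed K"
    and G: "group G" "finite (carrier G)"
    and surface: "closed_oriented_surface g S" "x \<in> topspace S"
    and \<Gamma>: "\<Gamma> = fundamental_group S x"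
    and U: "subgroup U G"
    and Os: "Os = conjugacy_class G U"
    and C: "C = centralizer G U"
    and Z: "Z = normalizer_quotient G U"
    and resolution: "projective_resolution K G P d e"
    and A: "A = coset_module K G C" "r = coset_right_action K G C"
    and M\<^sub>U: "M\<^sub>U = rep_module_onto K \<Gamma> G U"
    and M\<^sub>O: "M\<^sub>O = rep_module K \<Gamma> G Os"
    and H\<^sub>A: "H\<^sub>A = (\<lambda>m. Ext_module K G P d m A)" "r\<^sub>H = (\<lambda>m z. Ext_map K G P d m A (r z))"
  shows "\<exists>\<Phi> \<in> gmodule_isos K G (tensor_gmodule K Z A r M\<^sub>U) M\<^sub>O.
    (\<forall>a \<in> carrier G. \<forall>f \<in> homs_onto \<Gamma> G U.
       \<Phi> (pure_tensor K Z A r M\<^sub>U (basis_vec K (a <#\<^bsub>G\<^esub> C)) (basis_vec K f))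
       = basis_vec K (conj_hom \<Gamma> G a f)) \<and>
    (\<forall>m. \<exists>\<Psi> \<in> linear_isos K
              (tensor_product K Z (H\<^sub>A m) (r\<^sub>H m) M\<^sub>U) (Ext_module K G P d m M\<^sub>O).
       \<forall>\<xi> \<in> carrier (H\<^sub>A m). \<forall>w \<in> carrier M\<^sub>U.
         \<Psi> (pure_tensor K Z (H\<^sub>A m) (r\<^sub>H m) M\<^sub>U \<xi> w)
         = Ext_map K G P d m M\<^sub>O (\<lambda>v. \<Phi> (pure_tensor K Z A r M\<^sub>U v w)) \<xi>)"
proof -
  note names = C Z A M\<^sub>U M\<^sub>O Os H\<^sub>A
  have field: "field K" using K by (simp add: algebraically_closed_def)
  have cring: "cring K" using field by (simp add: field_def domain_def)
  interpret orbit_cohomology K \<Gamma> G U P d e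
    by (intro orbit_cohomology.intro orbit_modules.intro conjugated_homs.intro conjugated_homs_axioms.intro
        finite_group_resolution.intro G U field cring resolution)
      (simp add: \<Gamma> fundamental_group_mult_closed)
  obtain \<Phi> where \<Phi>: "\<Phi> \<in> gmodule_isos K G (tensor_gmodule K Z A r M\<^sub>U) M\<^sub>O"
      "\<forall>x \<in> carrier A. \<forall>y \<in> carrier M\<^sub>U. \<Phi> (pure_tensor K Z A r M\<^sub>U x y) = conj_pairing x y"
    unfolding names by (rule tensor_iso)
  show ?thesis
  proof (intro bexI[OF _ \<Phi>(1)] conjI ballI allI)
    fix a f assume "a \<in> carrier G" "f \<in> homs_onto \<Gamma> G U"
    then show "\<Phi> (pure_tensor K Z A r M\<^sub>U (basis_vec K (a <#\<^bsub>G\<^esub> C)) (basis_vec K f)) = basis_vec K (conj_hom \<Gamma> G a f)"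
      using \<Phi>(2) conj_pairing_coset A_basis[OF lcosetI] MU_basis unfolding names by simp
  next
    fix m
    obtain \<Psi> where \<Psi>: "\<Psi> \<in> linear_isos K (tensor_product K Z (H\<^sub>A m) (r\<^sub>H m) M\<^sub>U) (Ext_module K G P d m M\<^sub>O)"
      "\<forall>\<xi> \<in> carrier (H\<^sub>A m). \<forall>w \<in> carrier M\<^sub>U. \<Psi> (pure_tensor K Z (H\<^sub>A m) (r\<^sub>H m) M\<^sub>U \<xi> w) = Ext_pairing m \<xi> w"
      unfolding names by (rule Ext_iso)
    have "Ext_pairing m \<xi> w = Ext_map K G P d m M\<^sub>O (\<lambda>v. \<Phi> (pure_tensor K Z A r M\<^sub>U v w)) \<xi>"
      if \<xi>: "\<xi> \<in> carrier (H\<^sub>A m)" and w: "w \<in> carrier M\<^sub>U" for \<xi> w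
      unfolding Ext_pairing_def M\<^sub>O Os
      by (rule Ext_map_cong[OF A_gmodule])
       (use \<Phi>(2) w \<xi> in \<open>auto simp: names\<close>)
    then show "\<exists>\<Psi> \<in> linear_isos K (tensor_product K Z (H\<^sub>A m) (r\<^sub>H m) M\<^sub>U) (Ext_module K G P d m M\<^sub>O).
       \<forall>\<xi> \<in> carrier (H\<^sub>A m). \<forall>w \<in> carrier M\<^sub>U.
         \<Psi> (pure_tensor K Z (H\<^sub>A m) (r\<^sub>H m) M\<^sub>U \<xi> w)
         = Ext_map K G P d m M\<^sub>O (\<lambda>v. \<Phi> (pure_tensor K Z A r M\<^sub>U v w)) \<xi>"
      using \<Psi> by (intro bexI[OF _ \<Psi>(1)]) simp
  qed
qed

end
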